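(* Let $F$ be a field of odd characteristic $p$, let $r$ be an odd prime power not divisible by $p$, let $d\ge 1$, and let $\mathfrak A_d$ be the dual polar scheme on $[{}^2A_{2d}(r)]$. If the adjacency algebra $F\mathfrak A_d$ is a local algebra, then $$F\mathfrak A_d\cong P/W_d$$ as $F$-algebras, where $P=F[X_1,X_2,\dots]/(X_1^p,X_2^p,\dots)$ and $W_d$ is the ideal of $P$ generated by the (images of the) monomials of weight greater than $d$.
   Context: Let $q=r^2$. $[{}^2A_{2d}(r)]$ denotes the space $\mathbb F_q^{2d+1}$ equipped with a non-degenerate Hermitian form. Let $X$ be the set of maximal totally isotropic subspaces of this space (all have dimension $d$), and for $i=0,\dots,d$ let $R_i=\{(x,y)\in X\times X:\dim(x\cap y)=d-i\}$. Then $(X,\{R_i\}_{i=0}^d)$ is a symmetric association scheme of class $d$, the dual polar scheme on $[{}^2A_{2d}(r)]$. Its adjacency matrices are $A_i$ with $(A_i)_{xy}=1$ if $(x,y)\in R_i$ and $0$ otherwise; for a field $F$ the adjacency algebra $F\mathfrak A_d=\bigoplus_{i=0}^d FA_i$ is the (commutative) algebra of $F$-linear combinations of the $A_i$, viewed as matrices over $F$. A local algebra is one with a unique maximal ideal. Weight: a monomial $X_{i_1}^{k_1}\cdots X_{i_s}^{k_s}$ (distinct indices $i_j\ge1$, exponents $k_j\ge 0$) has weight $\sum_{j=1}^s k_j p^{i_j-1}$; in particular $X_i$ has weight $p^{i-1}$. *)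

theory Defs
  imports
    "HOL-Analysis.Cartesian_Space"
    "HOL-Library.Poly_Mapping"
    "HOL-Number_Theory.Prime_Powers"
    "HOL-Algebra.QuotRing"
    "HOL-Algebra.Module"
begin

section \<open>The dual polar scheme of a Hermitian space\<close>

text \<open>
  The involution of the field with \<open>r\<^sup>2\<close> elements is \<open>a \<mapsto> a ^ r\<close>.  Semilinearity in the
  second argument follows from linearity in the first one and conjugate symmetry.
\<close>

definition hermitian_form :: "nat \<Rightarrow> ('k::field ^ 'n \<Rightarrow> 'k ^ 'n \<Rightarrow> 'k) \<Rightarrow> bool" where
  "hermitian_form r h \<longleftrightarrow>
     (\<forall>u v w. h (u + v) w = h u w + h v w) \<and>
     (\<forall>a u w. h (a *s u) w = a * h u w) \<and>
     (\<forall>u w. h w u = h u w ^ r)"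

definition nondegenerate_form :: "('k::field ^ 'n \<Rightarrow> 'k ^ 'n \<Rightarrow> 'k) \<Rightarrow> bool" where
  "nondegenerate_form h \<longleftrightarrow> (\<forall>u. (\<forall>w. h u w = 0) \<longrightarrow> u = 0)"

definition totally_isotropic :: "('k::field ^ 'n \<Rightarrow> 'k ^ 'n \<Rightarrow> 'k) \<Rightarrow> ('k ^ 'n) set \<Rightarrow> bool" where
  "totally_isotropic h U \<longleftrightarrow> vec.subspace U \<and> (\<forall>u\<in>U. \<forall>w\<in>U. h u w = 0)"

definition maximal_isotropics :: "('k::field ^ 'n \<Rightarrow> 'k ^ 'n \<Rightarrow> 'k) \<Rightarrow> ('k ^ 'n) set set" where
  "maximal_isotropics h =
     {U. totally_isotropic h U \<and> (\<forall>V. totally_isotropic h V \<and> U \<subseteq> V \<longrightarrow> V = U)}"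

text \<open>\<open>dim (x \<inter> y) = d - i\<close>, written without truncated subtraction.\<close>

definition dual_polar_rel ::
    "('k::field ^ 'n \<Rightarrow> 'k ^ 'n \<Rightarrow> 'k) \<Rightarrow> nat \<Rightarrow> nat \<Rightarrow> (('k ^ 'n) set \<times> ('k ^ 'n) set) set" where
  "dual_polar_rel h d i =
     {(x, y). x \<in> maximal_isotropics h \<and> y \<in> maximal_isotropics h \<and> vec.dim (x \<inter> y) + i = d}"


section \<open>Adjacency algebras\<close>

text \<open>
  Matrices indexed by a finite set \<open>X\<close> are represented by functions of two arguments that
  vanish outside \<open>X \<times> X\<close>.
\<close>

definition adjacency_matrix :: "(nat \<Rightarrow> ('x \<times> 'x) set) \<Rightarrow> nat \<Rightarrow> 'x \<Rightarrow> 'x \<Rightarrow> 'f::field" where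
  "adjacency_matrix R i = (\<lambda>x y. if (x, y) \<in> R i then 1 else 0)"

definition adjacency_algebra ::
    "'x set \<Rightarrow> (nat \<Rightarrow> ('x \<times> 'x) set) \<Rightarrow> nat \<Rightarrow> ('f::field, 'x \<Rightarrow> 'x \<Rightarrow> 'f) module" where
  "adjacency_algebra X R d =
     \<lparr>carrier = {M. \<exists>c. M = (\<lambda>x y. \<Sum>i\<le>d. c i * adjacency_matrix R i x y)},
      mult = (\<lambda>M N x y. \<Sum>z\<in>X. M x z * N z y),
      one = (\<lambda>x y. if x \<in> X \<and> x = y then 1 else 0),
      zero = (\<lambda>x y. 0),
      add = (\<lambda>M N x y. M x y + N x y),
      smult = (\<lambda>c M x y. c * M x y)\<rparr>"

definition dual_polar_algebra ::
    "('k::field ^ 'n \<Rightarrow> 'k ^ 'n \<Rightarrow> 'k) \<Rightarrow> nat \<Rightarrow>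
     ('f::field, ('k ^ 'n) set \<Rightarrow> ('k ^ 'n) set \<Rightarrow> 'f) module" where
  "dual_polar_algebra h d = adjacency_algebra (maximal_isotropics h) (dual_polar_rel h d) d"


section \<open>Local algebras, quotients and isomorphisms of algebras\<close>

definition local_algebra :: "('b, 'm) ring_scheme \<Rightarrow> bool" where
  "local_algebra A \<longleftrightarrow> (\<exists>!I. maximalideal I A)"

text \<open>The library's quotient ring drops the scalar multiplication; it is put back here.\<close>

definition quotient_algebra :: "('f, 'b) module \<Rightarrow> 'b set \<Rightarrow> ('f, 'b set) module" where
  "quotient_algebra A I =
     ring.extend (A Quot I)
       \<lparr>smult = (\<lambda>c U. \<Union>u\<in>U. I +>\<^bsub>A\<^esub> (c \<odot>\<^bsub>A\<^esub> u))\<rparr>"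

text \<open>The scalars range over the whole type \<open>'f\<close>, which is the base field.\<close>

definition algebra_isomorphic :: "('f::field, 'a) module \<Rightarrow> ('f, 'b) module \<Rightarrow> bool" where
  "algebra_isomorphic A B \<longleftrightarrow>
     (\<exists>\<phi>\<in>ring_iso A B. \<forall>c. \<forall>x\<in>carrier A. \<phi> (c \<odot>\<^bsub>A\<^esub> x) = c \<odot>\<^bsub>B\<^esub> \<phi> x)"


section \<open>The algebras \<open>P\<close> and \<open>P / W\<^sub>d\<close>\<close>

text \<open>
  The type \<open>(nat \<Rightarrow>\<^sub>0 nat) \<Rightarrow>\<^sub>0 'f\<close> is the polynomial ring in countably many variables.  Variables
  are indexed from \<open>0\<close>: index \<open>j\<close> stands for \<open>X\<^bsub>j+1\<^esub>\<close>, whose weight is \<open>p ^ j\<close>.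
\<close>

definition monomial :: "(nat \<Rightarrow>\<^sub>0 nat) \<Rightarrow> (nat \<Rightarrow>\<^sub>0 nat) \<Rightarrow>\<^sub>0 'f::field" where
  "monomial m = Poly_Mapping.single m 1"

definition variable :: "nat \<Rightarrow> (nat \<Rightarrow>\<^sub>0 nat) \<Rightarrow>\<^sub>0 'f::field" where
  "variable j = monomial (Poly_Mapping.single j 1)"

definition weight :: "nat \<Rightarrow> (nat \<Rightarrow>\<^sub>0 nat) \<Rightarrow> nat" where
  "weight p m = (\<Sum>j\<in>Poly_Mapping.keys m. Poly_Mapping.lookup m j * p ^ j)"

definition polynomial_algebra :: "('f::field, (nat \<Rightarrow>\<^sub>0 nat) \<Rightarrow>\<^sub>0 'f) module" where
  "polynomial_algebra =
     \<lparr>carrier = UNIV, mult = (*), one = 1, zero = 0, add = (+),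
      smult = (\<lambda>c f. Poly_Mapping.single 0 c * f)\<rparr>"

definition pth_power_ideal :: "nat \<Rightarrow> ((nat \<Rightarrow>\<^sub>0 nat) \<Rightarrow>\<^sub>0 'f::field) set" where
  "pth_power_ideal p = genideal polynomial_algebra {variable j ^ p | j. True}"

definition truncated_algebra :: "nat \<Rightarrow> ('f::field, ((nat \<Rightarrow>\<^sub>0 nat) \<Rightarrow>\<^sub>0 'f) set) module" where
  "truncated_algebra p = quotient_algebra polynomial_algebra (pth_power_ideal p)"

definition weight_ideal :: "nat \<Rightarrow> nat \<Rightarrow> ((nat \<Rightarrow>\<^sub>0 nat) \<Rightarrow>\<^sub>0 'f::field) set set" where
  "weight_ideal p d =
     genideal (truncated_algebra p)
       {pth_power_ideal p +>\<^bsub>polynomial_algebra\<^esub> monomial m | m. weight p m > d}"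

end

theory Submission
  imports Defs "HOL-Computational_Algebra.Polynomial" "HOL-Number_Theory.Residues" "HOL-Algebra.Ring_Divisibility"
begin

text \<open>
  Let \<open>C\<^sub>i\<close> be the matrix whose \<open>(x, y)\<close> entry is the number of subspaces of dimension \<open>d - i\<close>
  of \<open>x \<inter> y\<close>.  The \<open>C\<^sub>i\<close> arise from the adjacency matrices by a unitriangular change of basis.
  Multiplication by \<open>C\<^sub>1\<close> is triangular with respect to them, and in a local algebra its diagonal
  entries must coincide; for \<open>d \<ge> 2\<close> this forces \<open>r = -1\<close> in \<open>F\<close>.

  The \<open>(x, y)\<close> entry of \<open>C\<^sub>i C\<^sub>j\<close> is a sum over pairs \<open>U \<le> x\<close>, \<open>V \<le> y\<close> of the number of maximal
  isotropic subspaces containing \<open>U + V\<close>.  If \<open>r = -1\<close> in \<open>F\<close>, that number vanishes in \<open>F\<close> unless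
  \<open>U + V\<close> is itself maximal, and every power of \<open>q\<close> counting complements is \<open>1\<close>; what remains is
  \<open>C\<^sub>i C\<^sub>j = binom(i + j, j) C\<^sub>i\<^sub>+\<^sub>j\<close>, so the \<open>C\<^sub>i\<close> multiply like divided powers \<open>x\<^sup>i / i!\<close>
  truncated above degree \<open>d\<close>.  Since \<open>binom(n, p\<^sup>j) \<equiv> n div p\<^sup>j\<close> modulo \<open>p\<close>, a monomial with
  exponents below \<open>p\<close> in the \<open>C\<close> of index \<open>p\<^sup>j\<close> is a unit times \<open>C\<^sub>w\<close>, \<open>w\<close> its weight, and every
  other monomial vanishes.
\<close>

text \<open>If a and b are distinct eigenvalues of multiplication by C_1, then C_1 - a and C_1 - b
  are non-units that differ by a nonzero scalar, which a local algebra forbids. Only the first three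
  diagonal entries are compared; with R the image of r in F, their equality says R^(2d+1) = -1 and
  R^(2d-1) = -R^2. For d = 1 there are only two entries, and they give R^3 = -1 instead of R = -1;
  the relation C_1^2 = 0 is then checked by itself.

  The vanishing in F of the number of maximal isotropic subspaces over a smaller isotropic U is a
  cancellation: for an isotropic v in perp U outside U, the subspaces that miss v number, in F,
  minus those that contain v. The sign is r^3 = -1, and r^3 + 1 is the number of maximal subspaces
  over a hyperplane of one.

  The isomorphism comes from the map that sends the variable of weight p^j to C_(p^j). It kills p-th
  powers because one of the binomial factors met on the way is p, and its kernel is found by reading
  the exponents of a monomial with exponents below p as the base p digits of its weight.\<close>

hide_const (open) Divisibility.prime

section \<open>Counting subspaces over a finite field\<close>

lemma card_subspace:
  fixes U :: "('k::{field,finite} ^ 'n::finite) set"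
  assumes "vec.subspace U"
  shows "card U = CARD('k) ^ vec.dim U"
proof -
  obtain B where B: "B \<subseteq> U" "vec.independent B" "U \<subseteq> vec.span B" "card B = vec.dim U"
    by (rule vec.basis_exists)
  have "card (vec.span B) = CARD('k) ^ card B" if "vec.independent B" for B :: "('k ^ 'n) set"
    using finite[of B] that
  proof (induction B rule: finite_induct)
    case (insert a B)
    have ind: "vec.independent B" "a \<notin> vec.span B"
      using insert.prems insert.hyps by (auto simp: vec.independent_insert)
    have "bij_betw (\<lambda>(c, v). c *s a + v) (UNIV \<times> vec.span B) (vec.span (insert a B))"
    proof (rule bij_betwI')
      fix s t :: "'k \<times> ('k ^ 'n)"
      assume s: "s \<in> UNIV \<times> vec.span B" and t: "t \<in> UNIV \<times> vec.span B"
      obtain c v c' v' where [simp]: "s = (c, v)" "t = (c', v')" by fastforce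
      show "((case s of (c, v) \<Rightarrow> c *s a + v) = (case t of (c, v) \<Rightarrow> c *s a + v)) = (s = t)"
      proof
        assume "(case s of (c, v) \<Rightarrow> c *s a + v) = (case t of (c, v) \<Rightarrow> c *s a + v)"
        then have eq: "(c - c') *s a = v' - v" 
          by (simp add: vec.scale_left_diff_distrib algebra_simps)
        have "v' - v \<in> vec.span B" using s t by (auto intro: vec.span_diff)
        then have "(c - c') *s a \<in> vec.span B" using eq by simp
        then have "c = c'" 
          using ind(2) vec.span_scale[of "(c - c') *s a" B "inverse (c - c')"]
          by (cases "c = c'") auto
        then show "s = t" using eq by simp
      qed simp
    next
      fix s :: "'k \<times> ('k ^ 'n)" assume "s \<in> UNIV \<times> vec.span B"
      then show "(case s of (c, v) \<Rightarrow> c *s a + v) \<in> vec.span (insert a B)"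
        using vec.span_mono[of B "insert a B"] vec.span_base[of a "insert a B"]
        by (auto intro!: vec.span_add vec.span_scale)
    next
      fix y assume "y \<in> vec.span (insert a B)"
      then obtain k where "y - k *s a \<in> vec.span B" by (auto simp: vec.span_insert)
      then show "\<exists>s\<in>UNIV \<times> vec.span B. y = (case s of (c, v) \<Rightarrow> c *s a + v)"
        by (intro bexI[of _ "(k, y - k *s a)"]) auto
    qed
    from bij_betw_same_card[OF this] show ?case
      using insert ind by (simp add: card_cartesian_product)
  qed simp
  moreover have "vec.span B = U"
    using B assms by (metis subset_antisym vec.span_minimal)
  ultimately show ?thesis using B by metis
qed

lemma card_scalars_ge_2: "CARD('k::{field,finite}) \<ge> 2"
  using card_mono[of UNIV "{0, 1 :: 'k}"] by simp

lemma card_fibres: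
  assumes "finite A" "\<And>b. b \<in> B \<Longrightarrow> card {a \<in> A. f a = b} = c" "f ` A \<subseteq> B" "finite B"
  shows "card A = card B * c"
proof -
  have "card A = card (\<Union>b\<in>B. {a \<in> A. f a = b})"
    using assms(3) by (intro arg_cong[where f=card]) auto
  also have "\<dots> = (\<Sum>b\<in>B. card {a \<in> A. f a = b})"
    using assms by (intro card_UN_disjoint) auto
  finally show ?thesis using assms by simp
qed

lemma sum_card_swap:
  assumes "finite A" "finite B"
  shows "(\<Sum>a\<in>A. card {b \<in> B. P a b}) = (\<Sum>b\<in>B. card {a \<in> A. P a b})"
proof -
  have "(\<Sum>a\<in>A. card {b \<in> B. P a b}) = (\<Sum>a\<in>A. \<Sum>b\<in>B. if P a b then 1 else 0)"
    using assms by (simp add: sum.If_cases Int_def)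
  also have "\<dots> = (\<Sum>b\<in>B. \<Sum>a\<in>A. if P a b then 1 else 0)" by (rule sum.swap)
  also have "\<dots> = (\<Sum>b\<in>B. card {a \<in> A. P a b})"
    using assms by (simp add: sum.If_cases Int_def)
  finally show ?thesis .
qed

lemma card_kernel_functional:
  fixes B :: "('k::{field,finite} ^ 'n::finite) set"
  assumes B: "vec.subspace B" and add: "\<And>u v. f (u + v) = f u + f v"
    and scale: "\<And>a u. f (a *s u) = a * f u" and "b \<in> B" "f b \<noteq> (0::'k)"
  shows "CARD('k) * card {v \<in> B. f v = 0} = card B"
proof -
  have fibre: "card {v \<in> B. f v = c} = card {v \<in> B. f v = 0}" for c
  proof -
    \<comment> \<open>A vector of \<open>B\<close> with value \<open>c\<close>; translation by it
      carries the kernel onto the fibre over \<open>c\<close>.\<close>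
    define w where "w = (c / f b) *s b"
    have w: "w \<in> B" "f w = c" using assms by (auto simp: w_def vec.subspace_scale)
    have minus: "f (v - w) = f v - f w" for v
      using add[of "v - w" w] by simp
    have "bij_betw (\<lambda>v. v + w) {v \<in> B. f v = 0} {v \<in> B. f v = c}"
    proof (rule bij_betwI[where g = "\<lambda>v. v - w"])
      show "(\<lambda>v. v + w) \<in> {v \<in> B. f v = 0} \<rightarrow> {v \<in> B. f v = c}"
        using w B by (auto simp: add intro: vec.subspace_add)
      show "(\<lambda>v. v - w) \<in> {v \<in> B. f v = c} \<rightarrow> {v \<in> B. f v = 0}"
        using w B by (auto simp: minus intro: vec.subspace_diff)
    qed simp_all
    from bij_betw_same_card[OF this] show ?thesis by simp
  qed
  show ?thesis
    using card_fibres[of B UNIV f, OF _ fibre] by simp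
qed

definition subspace_sum :: "('k::field ^ 'n::finite) set \<Rightarrow> ('k ^ 'n) set \<Rightarrow> ('k ^ 'n) set" where
  "subspace_sum U V = {u + v | u v. u \<in> U \<and> v \<in> V}"

lemma subspace_subspace_sum:
  "vec.subspace U \<Longrightarrow> vec.subspace V \<Longrightarrow> vec.subspace (subspace_sum U V)"
  unfolding subspace_sum_def by (rule vec.subspace_sums)

lemma subspace_sum_subset_iff:
  assumes "vec.subspace U" "vec.subspace V" "vec.subspace T"
  shows "subspace_sum U V \<subseteq> T \<longleftrightarrow> U \<subseteq> T \<and> V \<subseteq> T"
proof
  assume "subspace_sum U V \<subseteq> T"
  moreover have "u \<in> subspace_sum U V" if "u \<in> U" for u
    unfolding subspace_sum_def mem_Collect_eq
    by (rule exI[of _ u], rule exI[of _ 0]) (simp add: that vec.subspace_0[OF assms(2)])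
  moreover have "v \<in> subspace_sum U V" if "v \<in> V" for v
    unfolding subspace_sum_def mem_Collect_eq
    by (rule exI[of _ 0], rule exI[of _ v]) (simp add: that vec.subspace_0[OF assms(1)])
  ultimately show "U \<subseteq> T \<and> V \<subseteq> T" by blast
qed (use assms in \<open>auto simp: subspace_sum_def intro!: vec.subspace_add\<close>)

lemma card_subspace_sum:
  fixes U V :: "('k::{field,finite} ^ 'n::finite) set"
  assumes U: "vec.subspace U" and V: "vec.subspace V"
  shows "card U * card V = card (subspace_sum U V) * card (U \<inter> V)"
proof -
  have fibre: "card {a \<in> U \<times> V. fst a + snd a = w} = card (U \<inter> V)" if w: "w \<in> subspace_sum U V" for w
  proof -
    obtain u v where uv: "u \<in> U" "v \<in> V" "w = u + v" using w by (auto simp: subspace_sum_def)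
    have "bij_betw (\<lambda>t. (u + t, v - t)) (U \<inter> V) {a \<in> U \<times> V. fst a + snd a = w}"
    proof (rule bij_betwI[where g = "\<lambda>a. fst a - u"])
      show "(\<lambda>a. fst a - u) \<in> {a \<in> U \<times> V. fst a + snd a = w} \<rightarrow> U \<inter> V"
      proof
        fix a assume "a \<in> {a \<in> U \<times> V. fst a + snd a = w}"
        then have a: "fst a \<in> U" "snd a \<in> V" "fst a + snd a = w" by auto
        then have "fst a - u = v - snd a" using uv by (simp add: algebra_simps)
        then show "fst a - u \<in> U \<inter> V" using a uv U V by (metis IntI vec.subspace_diff)
      qed
    qed (use uv U V in \<open>auto simp: vec.subspace_add vec.subspace_diff algebra_simps\<close>)
    from bij_betw_same_card[OF this] show ?thesis by simp
  qed
  have "card (U \<times> V) = card (subspace_sum U V) * card (U \<inter> V)"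
    by (rule card_fibres[OF _ fibre]) (auto simp: subspace_sum_def, blast)
  then show ?thesis by (simp add: card_cartesian_product)
qed

lemma dim_subspace_sum:
  fixes U V :: "('k::{field,finite} ^ 'n::finite) set"
  assumes U: "vec.subspace U" and V: "vec.subspace V"
  shows "vec.dim (subspace_sum U V) + vec.dim (U \<inter> V) = vec.dim U + vec.dim V"
proof -
  have "CARD('k) ^ (vec.dim U + vec.dim V) = CARD('k) ^ (vec.dim (subspace_sum U V) + vec.dim (U \<inter> V))"
    using card_subspace_sum[OF U V] U V
    by (simp add: card_subspace subspace_subspace_sum vec.subspace_inter power_add)
  then show ?thesis using card_scalars_ge_2[where 'k='k] by simp
qed

text \<open>A subspace not inside the hyperplane \<open>T'\<close> spans \<open>T\<close> together
  with it, so the dimension formula for the sum loses exactly one.\<close>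

lemma dim_Int_hyperplane:
  fixes T :: "('k::{field,finite} ^ 'n::finite) set"
  assumes "vec.subspace T" "vec.subspace T'" "T' \<subseteq> T" "vec.dim T = Suc (vec.dim T')"
    and "vec.subspace V" "V \<subseteq> T" "\<not> V \<subseteq> T'"
  shows "vec.dim V = Suc (vec.dim (V \<inter> T'))"
proof -
  let ?S = "subspace_sum V T'"
  have S: "vec.subspace ?S" "?S \<subseteq> T"
    using assms by (auto simp: subspace_subspace_sum subspace_sum_subset_iff)
  have "T' \<subseteq> ?S" "V \<subseteq> ?S" using subspace_sum_subset_iff[of V T' ?S] assms S by auto
  then have "T' \<subset> ?S" using assms by auto
  then have "vec.dim T' < vec.dim ?S"
    using S assms by (intro vec.dim_psubset) (simp add: vec.span_eq_iff[THEN iffD2])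
  moreover have "vec.dim ?S \<le> vec.dim T" using S by (intro vec.dim_subset)
  ultimately show ?thesis using dim_subspace_sum[of V T'] assms by simp
qed

lemma dim_insert_subspace:
  assumes "vec.subspace V" "v \<notin> V"
  shows "vec.dim (insert v V) = Suc (vec.dim V)"
  using assms by (simp add: vec.dim_insert vec.span_eq_iff[THEN iffD2])

lemma in_span_insert_subspace_iff:
  assumes "vec.subspace V"
  shows "x \<in> vec.span (insert v V) \<longleftrightarrow> (\<exists>c. x - c *s v \<in> V)"
  using assms by (simp add: vec.span_insert vec.span_eq_iff[THEN iffD2])

lemma subspace_scale_cancel:
  assumes "vec.subspace (V :: ('k::field ^ 'n::finite) set)" "c *s v \<in> V" "c \<noteq> 0"
  shows "v \<in> V"
  using vec.subspace_scale[OF assms(1,2), of "inverse c"] assms(3) by simp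

text \<open>Each vector of \<open>T - T'\<close> lies in exactly one such \<open>V\<close>, namely
  the span of it and \<open>V'\<close>. So the sets \<open>V - V'\<close>, each of size (q - 1)
  |V'|, partition \<open>T - T'\<close>, which has size (q - 1) |T'|.\<close>

lemma card_extensions_across_hyperplane:
  fixes T :: "('k::{field,finite} ^ 'n::finite) set"
  assumes T: "vec.subspace T" "vec.subspace T'" "T' \<subseteq> T" "vec.dim T = Suc (vec.dim T')"
    and V': "vec.subspace V'" "V' \<subseteq> T'"
  shows "card {V. vec.subspace V \<and> V \<subseteq> T \<and> V \<inter> T' = V' \<and> \<not> V \<subseteq> T'} * card V' = card T'"
    (is "card ?S * _ = _")
proof -
  let ?q = "CARD('k)"
  have dimV: "vec.dim V = Suc (vec.dim V')" if "V \<in> ?S" for V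
    using dim_Int_hyperplane[OF T, of V] that by auto
  have cardV: "card (V - V') = (?q - 1) * card V'" if V: "V \<in> ?S" for V
  proof -
    have "V' \<subseteq> V" using V by auto
    then have "card (V - V') = card V - card V'" by (intro card_Diff_subset) auto
    then show ?thesis using dimV[OF V] V V'(1) by (simp add: card_subspace diff_mult_distrib)
  qed
  have span: "V = vec.span (insert v V')" if "V \<in> ?S" "v \<in> V - V'" for V v
  proof (rule sym[OF vec.subspace_dim_equal])
    show "vec.span (insert v V') \<subseteq> V" using that by (intro vec.span_minimal) auto
    show "vec.dim V \<le> vec.dim (vec.span (insert v V'))"
      using that dimV[OF that(1)] V'(1) by (simp add: dim_insert_subspace)
  qed (use that in auto)
  have "T - T' = (\<Union>V\<in>?S. V - V')"
  proof (intro equalityI subsetI)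
    fix v assume v: "v \<in> T - T'"
    let ?V = "vec.span (insert v V')"
    have vV: "v \<in> ?V" by (simp add: vec.span_base)
    have "?V \<inter> T' = V'"
    proof (intro equalityI subsetI)
      fix x assume x: "x \<in> ?V \<inter> T'"
      then obtain c where c: "x - c *s v \<in> V'" using V' by (auto simp: in_span_insert_subspace_iff)
      then have "c *s v \<in> T'" using vec.subspace_diff[OF T(2), of x "x - c *s v"] x V' by auto
      then have "c = 0" using subspace_scale_cancel[OF T(2), of c v] v by auto
      then show "x \<in> V'" using c by simp
    qed (use V' in \<open>auto intro: vec.span_base\<close>)
    moreover have "?V \<subseteq> T" using v V' T by (intro vec.span_minimal) auto
    ultimately have "?V \<in> ?S" using v vV by auto
    then show "v \<in> (\<Union>V\<in>?S. V - V')" using vV v V' by blast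
  qed auto
  then have "card (T - T') = card (\<Union>V\<in>?S. V - V')" by simp
  also have "\<dots> = (\<Sum>V\<in>?S. card (V - V'))"
  proof (intro card_UN_disjoint ballI impI)
    fix V1 V2 assume V: "V1 \<in> ?S" "V2 \<in> ?S" "V1 \<noteq> V2"
    then show "(V1 - V') \<inter> (V2 - V') = {}" using span[OF V(1)] span[OF V(2)] by blast
  qed auto
  also have "\<dots> = (\<Sum>V\<in>?S. (?q - 1) * card V')" by (intro sum.cong cardV) auto
  also have "\<dots> = (?q - 1) * (card ?S * card V')" by (simp add: algebra_simps)
  finally have "card T - card T' = (?q - 1) * (card ?S * card V')" 
    using T by (subst (asm) card_Diff_subset) auto
  moreover have "card T - card T' = (?q - 1) * card T'"
    using T by (simp add: card_subspace diff_mult_distrib)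
  ultimately show ?thesis using card_scalars_ge_2[where 'k='k] by simp
qed

lemma card_extensions_across_hyperplane_power:
  fixes T :: "('k::{field,finite} ^ 'n::finite) set"
  assumes T: "vec.subspace T" "vec.subspace T'" "T' \<subseteq> T" "vec.dim T = Suc (vec.dim T')"
    and V': "vec.subspace V'" "V' \<subseteq> T'"
  shows "card {V. vec.subspace V \<and> V \<subseteq> T \<and> V \<inter> T' = V' \<and> \<not> V \<subseteq> T'}
    = CARD('k) ^ (vec.dim T' - vec.dim V')"
proof -
  have "vec.dim V' \<le> vec.dim T'" using V' by (intro vec.dim_subset)
  then have "card T' = CARD('k) ^ (vec.dim T' - vec.dim V') * card V'"
    using T V' by (simp add: card_subspace flip: power_add)
  moreover have "V' \<noteq> {}" using vec.subspace_0[OF V'(1)] by auto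
  ultimately show ?thesis using card_extensions_across_hyperplane[OF assms] by simp
qed

lemma exists_subspace_between:
  fixes W T :: "('k::field ^ 'n::finite) set"
  assumes "vec.subspace W" "vec.subspace T" "W \<subseteq> T" "vec.dim W \<le> k" "k \<le> vec.dim T"
  obtains V where "vec.subspace V" "W \<subseteq> V" "V \<subseteq> T" "vec.dim V = k"
proof -
  have "\<exists>V. vec.subspace V \<and> W \<subseteq> V \<and> V \<subseteq> T \<and> vec.dim V = k" using assms(4,5)
  proof (induction k rule: dec_induct)
    case base then show ?case using assms by auto
  next
    case (step k)
    then obtain V where V: "vec.subspace V" "W \<subseteq> V" "V \<subseteq> T" "vec.dim V = k" by auto
    then have "V \<noteq> T" using step by auto
    then obtain v where v: "v \<in> T" "v \<notin> V" using V by auto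
    have "vec.span (insert v V) \<subseteq> T" using V v assms by (intro vec.span_minimal) auto
    then show ?case using V v
      by (intro exI[of _ "vec.span (insert v V)"]) (auto simp: dim_insert_subspace intro: vec.span_base)
  qed
  then show ?thesis using that by blast
qed

text \<open>The Gaussian binomial coefficient, given by the q-Pascal rule that results from sorting
  subspaces by whether they lie in a fixed hyperplane. The recursion stays within the naturals, so
  it can be cast into F even where q becomes 1.\<close>

fun gauss_binomial :: "nat \<Rightarrow> nat \<Rightarrow> nat \<Rightarrow> nat" where
  "gauss_binomial q n 0 = 1"
| "gauss_binomial q 0 (Suc k) = 0"
| "gauss_binomial q (Suc n) (Suc k) = gauss_binomial q n (Suc k) + q ^ (n - k) * gauss_binomial q n k"

lemma gauss_binomial_eq_0: "n < k \<Longrightarrow> gauss_binomial q n k = 0"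
  by (induction q n k rule: gauss_binomial.induct) auto

lemma gauss_binomial_self [simp]: "gauss_binomial q n n = 1"
  by (induction n) (auto simp: gauss_binomial_eq_0)

lemma gauss_binomial_1: "gauss_binomial q n (Suc 0) = (\<Sum>i<n. q ^ i)"
  by (induction n) auto

lemma gauss_binomial_pred: "gauss_binomial q (Suc n) n = (\<Sum>i<Suc n. q ^ i)"
proof (induction n)
  case (Suc n)
  have "gauss_binomial q (Suc (Suc n)) (Suc n) = 1 + q * (\<Sum>i<Suc n. q ^ i)"
    using Suc by (simp del: sum.lessThan_Suc)
  also have "\<dots> = (\<Sum>i<Suc (Suc n). q ^ i)"
    by (subst (2) sum.lessThan_Suc_shift) (simp add: sum_distrib_left del: sum.lessThan_Suc)
  finally show ?case .
qed simp

text \<open>At q = 1 the q-Pascal rule is Pascal's rule. It applies because q = r^2 = 1 once r = -1,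
  and it is where the ordinary binomials of the divided power law come from.\<close>

lemma of_nat_gauss_binomial_q_1:
  assumes "of_nat q = (1 :: 'f::comm_semiring_1)"
  shows "of_nat (gauss_binomial q n k) = (of_nat (n choose k) :: 'f)"
  using assms by (induction q n k rule: gauss_binomial.induct) (auto simp: add.commute)

text \<open>Induction along a hyperplane \<open>T'\<close> of \<open>T\<close> through
  \<open>W\<close>: a \<open>V\<close> inside \<open>T'\<close> gives the first summand of the
  recursion, any other \<open>V\<close> meets \<open>T'\<close> in one dimension less and is an
  extension of \<open>V \<inter> T'\<close> across the hyperplane. The lower bound \<open>W\<close>
  serves for counting subspaces over a given one; \<open>W = {0}\<close> gives the plain
  count.\<close>

theorem card_subspaces_between:
  fixes W T :: "('k::{field,finite} ^ 'n::finite) set"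
  assumes "vec.subspace W" "vec.subspace T" "W \<subseteq> T" "vec.dim T = vec.dim W + n"
  shows "card {V. vec.subspace V \<and> W \<subseteq> V \<and> V \<subseteq> T \<and> vec.dim V = vec.dim W + k}
    = gauss_binomial CARD('k) n k"
  using assms(2-)
proof (induction n arbitrary: T k)
  case 0
  then have [simp]: "T = W" using vec.subspace_dim_equal[OF assms(1) 0(1)] by simp
  show ?case
  proof (cases k)
    case 0
    then have "{V. vec.subspace V \<and> W \<subseteq> V \<and> V \<subseteq> T \<and> vec.dim V = vec.dim W + k} = {W}"
      using assms(1) by auto
    then show ?thesis using 0 by simp
  next
    case (Suc k')
    then have "{V. vec.subspace V \<and> W \<subseteq> V \<and> V \<subseteq> T \<and> vec.dim V = vec.dim W + k} = {}" by auto
    then show ?thesis using Suc by (simp only: card.empty gauss_binomial.simps)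
  qed
next
  case (Suc n)
  show ?case
  proof (cases k)
    case 0
    have "{V. vec.subspace V \<and> W \<subseteq> V \<and> V \<subseteq> T \<and> vec.dim V = vec.dim W + k} = {W}"
    proof (intro equalityI subsetI)
      fix V assume "V \<in> {V. vec.subspace V \<and> W \<subseteq> V \<and> V \<subseteq> T \<and> vec.dim V = vec.dim W + k}"
      then show "V \<in> {W}" using vec.subspace_dim_equal[OF assms(1), of V] 0 by simp
    qed (use assms(1) Suc.prems 0 in auto)
    then show ?thesis using 0 by simp
  next
    case (Suc k')
    obtain T' where T': "vec.subspace T'" "W \<subseteq> T'" "T' \<subseteq> T" "vec.dim T' = vec.dim W + n"
      using exists_subspace_between[OF assms(1) Suc.prems(1,2), of "vec.dim W + n"] Suc.prems by auto
    let ?L = "\<lambda>j. {V. vec.subspace V \<and> W \<subseteq> V \<and> V \<subseteq> T' \<and> vec.dim V = vec.dim W + j}"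
    let ?E = "\<lambda>V'. {V. vec.subspace V \<and> V \<subseteq> T \<and> V \<inter> T' = V' \<and> \<not> V \<subseteq> T'}"
    have dT: "vec.dim T = Suc (vec.dim T')" using T' Suc.prems by simp
    note hyp = dim_Int_hyperplane[OF Suc.prems(1) T'(1,3) dT]
    have split: "{V. vec.subspace V \<and> W \<subseteq> V \<and> V \<subseteq> T \<and> vec.dim V = vec.dim W + k}
        = ?L (Suc k') \<union> (\<Union>V'\<in>?L k'. ?E V')" (is "?all = _")
    proof (intro equalityI subsetI)
      fix V assume V: "V \<in> ?all"
      show "V \<in> ?L (Suc k') \<union> (\<Union>V'\<in>?L k'. ?E V')"
      proof (cases "V \<subseteq> T'")
        case False
        then have "V \<inter> T' \<in> ?L k'" using V T' hyp[of V] Suc by (auto simp: vec.subspace_inter)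
        then show ?thesis using V False by auto
      qed (use V Suc in auto)
    next
      fix V assume "V \<in> ?L (Suc k') \<union> (\<Union>V'\<in>?L k'. ?E V')"
      then show "V \<in> ?all" using hyp[of V] T' Suc by (cases "V \<subseteq> T'") auto
    qed
    have "card ?all = card (?L (Suc k')) + card (\<Union>V'\<in>?L k'. ?E V')"
      unfolding split by (intro card_Un_disjoint) auto
    also have "card (\<Union>V'\<in>?L k'. ?E V') = (\<Sum>V'\<in>?L k'. card (?E V'))"
      by (intro card_UN_disjoint) auto
    also have "\<dots> = (\<Sum>V'\<in>?L k'. CARD('k) ^ (n - k'))"
      using card_extensions_across_hyperplane_power[OF Suc.prems(1) T'(1,3) dT] T'
      by (intro sum.cong) auto
    finally show ?thesis using Suc.IH[OF T'(1,2,4), of "Suc k'"] Suc.IH[OF T'(1,2,4), of k'] Suc by simp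
  qed
qed

lemma card_subspaces:
  fixes T :: "('k::{field,finite} ^ 'n::finite) set"
  assumes "vec.subspace T"
  shows "card {V. vec.subspace V \<and> V \<subseteq> T \<and> vec.dim V = k} = gauss_binomial CARD('k) (vec.dim T) k"
proof -
  have "{V. vec.subspace V \<and> {0} \<subseteq> V \<and> V \<subseteq> T \<and> vec.dim V = vec.dim {0 :: 'k ^ 'n} + k}
      = {V. vec.subspace V \<and> V \<subseteq> T \<and> vec.dim V = k}"
    by (auto dest: vec.subspace_0)
  then show ?thesis
    using card_subspaces_between[of "{0}" T "vec.dim T" k] assms by (auto dest: vec.subspace_0)
qed

text \<open>The dimension condition says \<open>V + S = T\<close>, so these are the complements of
  S/W in T/W. The exponent is left open because only its being a power of q matters: it becomes 1 in
  F when r = -1. Enlarging \<open>T\<close> by one dimension multiplies the count by q^(dim S - dim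
  W).\<close>

lemma card_complements:
  fixes S T W :: "('k::{field,finite} ^ 'n::finite) set"
  assumes "vec.subspace W" "vec.subspace S" "vec.subspace T" "W \<subseteq> S" "S \<subseteq> T"
  shows "\<exists>e. card {V. vec.subspace V \<and> V \<subseteq> T \<and> V \<inter> S = W \<and> vec.dim V + vec.dim S = vec.dim T + vec.dim W}
    = CARD('k) ^ e"
proof -
  have "\<exists>e. card {V. vec.subspace V \<and> V \<subseteq> T \<and> V \<inter> S = W \<and> vec.dim V + vec.dim S = vec.dim T + vec.dim W}
    = CARD('k) ^ e" if "vec.dim T = vec.dim S + n" for n
    using assms(3,5) that
  proof (induction n arbitrary: T)
    case 0
    then have "S = T" using vec.subspace_dim_equal[OF assms(2) 0(1)] by simp
    then have "{V. vec.subspace V \<and> V \<subseteq> T \<and> V \<inter> S = W \<and> vec.dim V + vec.dim S = vec.dim T + vec.dim W} = {W}"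
      using assms by auto
    then show ?case by (intro exI[of _ 0]) simp
  next
    case (Suc n)
    obtain T' where T': "vec.subspace T'" "S \<subseteq> T'" "T' \<subseteq> T" "vec.dim T' = vec.dim S + n"
      using exists_subspace_between[OF assms(2) Suc.prems(1,2), of "vec.dim S + n"] Suc.prems by auto
    have dT: "vec.dim T = Suc (vec.dim T')" using T' Suc.prems by simp
    note hyp = dim_Int_hyperplane[OF Suc.prems(1) T'(1,3) dT]
    let ?L = "{V. vec.subspace V \<and> V \<subseteq> T' \<and> V \<inter> S = W \<and> vec.dim V + vec.dim S = vec.dim T' + vec.dim W}"
    let ?E = "\<lambda>V'. {V. vec.subspace V \<and> V \<subseteq> T \<and> V \<inter> T' = V' \<and> \<not> V \<subseteq> T'}"
    have split: "{V. vec.subspace V \<and> V \<subseteq> T \<and> V \<inter> S = W \<and> vec.dim V + vec.dim S = vec.dim T + vec.dim W}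
      = (\<Union>V'\<in>?L. ?E V')" (is "?all = _")
    proof (intro equalityI subsetI)
      fix V assume V: "V \<in> ?all"
      have "\<not> V \<subseteq> T'"
      proof
        assume "V \<subseteq> T'"
        then have "subspace_sum V S \<subseteq> T'" using V T' assms by (auto simp: subspace_sum_subset_iff)
        then have "vec.dim (subspace_sum V S) \<le> vec.dim T'" by (rule vec.dim_subset)
        then show False using V dim_subspace_sum[of V S] assms dT by auto
      qed
      moreover have "V \<inter> T' \<in> ?L" 
        using V T' hyp[of V] dT calculation by (auto simp: vec.subspace_inter)
      ultimately show "V \<in> (\<Union>V'\<in>?L. ?E V')" using V by auto
    next
      fix V assume "V \<in> (\<Union>V'\<in>?L. ?E V')"
      then show "V \<in> ?all" using hyp[of V] T' dT by (cases "V \<subseteq> T'") auto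
    qed
    obtain e where e: "card ?L = CARD('k) ^ e" using Suc.IH[OF T'(1,2,4)] by blast
    have "card ?all = (\<Sum>V'\<in>?L. card (?E V'))"
      unfolding split by (intro card_UN_disjoint) auto
    also have "\<dots> = (\<Sum>V'\<in>?L. CARD('k) ^ (vec.dim S - vec.dim W))"
    proof (intro sum.cong refl)
      fix V' assume "V' \<in> ?L"
      moreover have "vec.dim W \<le> vec.dim S" using assms by (intro vec.dim_subset)
      ultimately show "card (?E V') = CARD('k) ^ (vec.dim S - vec.dim W)"
        using card_extensions_across_hyperplane_power[OF Suc.prems(1) T'(1,3) dT, of V'] T'
        by (auto intro!: arg_cong[where f = "(^) (CARD('k))"])
    qed
    finally show ?case using e by (intro exI[of _ "e + (vec.dim S - vec.dim W)"]) (simp add: power_add)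
  qed
  moreover have "vec.dim S \<le> vec.dim T" using assms by (intro vec.dim_subset)
  ultimately show ?thesis by (metis le_Suc_ex)
qed

section \<open>Traces and norms\<close>

lemma power_card_eq_self:
  fixes x :: "'k::{field,finite}"
  shows "x ^ CARD('k) = x"
proof (cases "x = 0")
  case False
  have "(\<Prod>y\<in>UNIV - {0}. x * y) = \<Prod>(UNIV - {0})"
    using False by (intro prod.reindex_bij_witness[of _ "\<lambda>y. y / x" "\<lambda>y. x * y"]) auto
  then have "x ^ (CARD('k) - 1) * \<Prod>(UNIV - {0 :: 'k}) = \<Prod>(UNIV - {0 :: 'k})"
    by (simp add: prod.distrib card_Diff_subset)
  then have "x ^ (CARD('k) - 1) = 1" by simp
  then show ?thesis by (metis One_nat_def Suc_pred mult.right_neutral power_Suc zero_less_card_finite)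
qed simp


text \<open>A tight pigeonhole: with at most \<open>m\<close> values, at most \<open>n\<close>
  points over each, and \<open>m * n\<close> points in all, no fibre can fall short. It converts
  bounds on the number of roots into surjectivity of trace and norm.\<close>

lemma card_fibre_eq_bound:
  assumes "finite A" "finite B" "f ` A \<subseteq> B" "card B \<le> m" "card A = m * n"
    and le: "\<And>b. b \<in> B \<Longrightarrow> card {a \<in> A. f a = b} \<le> n" and b: "b \<in> B"
  shows "card {a \<in> A. f a = b} = n"
proof (rule ccontr)
  assume neq: "card {a \<in> A. f a = b} \<noteq> n"
  have "card A = card (\<Union>b\<in>B. {a \<in> A. f a = b})"
    using assms(3) by (intro arg_cong[where f=card]) auto
  also have "\<dots> = (\<Sum>b\<in>B. card {a \<in> A. f a = b})"
    using assms by (intro card_UN_disjoint) auto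
  also have "\<dots> < (\<Sum>b\<in>B. n)"
    using assms(2) neq le b by (intro sum_strict_mono_ex1) (auto intro!: bexI[of _ b] simp: nat_less_le)
  also have "\<dots> \<le> m * n" using assms(4) by simp
  finally show False using assms(5) by simp
qed

section \<open>Root bounds and the fibres of trace and norm\<close>

lemma card_fixed_power_le:
  assumes "r > 1"
  shows "card {x :: 'k::field. x ^ r = x} \<le> r"
proof -
  let ?p = "Polynomial.monom 1 r - Polynomial.monom 1 1 :: 'k poly"
  have "Polynomial.coeff ?p r = 1" using assms by simp
  then have "?p \<noteq> 0" by (metis coeff_0 zero_neq_one)
  from card_poly_roots_bound[OF this]
  have "card {x :: 'k. x ^ r - x = 0} \<le> Polynomial.degree ?p" by (simp add: poly_monom)
  also have "\<dots> \<le> r" using assms by (intro degree_diff_le) (auto intro: order.trans[OF degree_monom_le])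
  finally show ?thesis by simp
qed

lemma card_trace_fibre_le:
  assumes "r > 1"
  shows "card {x :: 'k::field. x + x ^ r = c} \<le> r"
proof -
  let ?p = "Polynomial.monom 1 r + Polynomial.monom 1 1 - [:c:] :: 'k poly"
  have "Polynomial.coeff ?p r = 1" using assms by (cases r) (auto simp: coeff_pCons)
  then have "?p \<noteq> 0" by (metis coeff_0 zero_neq_one)
  from card_poly_roots_bound[OF this]
  have "card {x :: 'k. x ^ r + x - c = 0} \<le> Polynomial.degree ?p" by (simp add: poly_monom)
  also have "\<dots> \<le> r" using assms
    by (intro degree_diff_le degree_add_le) (auto intro: order.trans[OF degree_monom_le])
  finally show ?thesis by (simp add: add.commute)
qed

lemma card_power_fibre_le:
  assumes "n > 0"
  shows "card {x :: 'k::field. x ^ n = c} \<le> n"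
proof -
  let ?p = "Polynomial.monom 1 n - [:c:] :: 'k poly"
  have "Polynomial.coeff ?p n = 1" using assms by (cases n) (auto simp: coeff_pCons)
  then have "?p \<noteq> 0" by (metis coeff_0 zero_neq_one)
  from card_poly_roots_bound[OF this]
  have "card {x :: 'k. x ^ n - c = 0} \<le> Polynomial.degree ?p" by (simp add: poly_monom)
  also have "\<dots> \<le> n" using assms
    by (intro degree_diff_le) (auto intro: order.trans[OF degree_monom_le])
  finally show ?thesis by simp
qed

text \<open>The characteristic divides the field size \<open>r ^ 2\<close>, and \<open>r\<close> is
  a prime power, so \<open>r\<close> is a power of the characteristic.\<close>

lemma frobenius_add:
  fixes x y :: "'k::{field,finite}"
  assumes "primepow r" "CARD('k) = r ^ 2"
  shows "(x + y) ^ r = x ^ r + y ^ r"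
proof -
  have p: "prime CHAR('k)" using prime_CHAR_semidom[where ?'a = 'k] finite_imp_CHAR_pos[where ?'a = 'k] by simp
  obtain l k where l: "prime l" "k > 0" "r = l ^ k" using assms(1) by (auto simp: primepow_def)
  have "CHAR('k) dvd CARD('k)" by (rule CHAR_dvd_CARD)
  then have "CHAR('k) dvd l ^ (k * 2)" using assms(2) l by (simp add: power_mult)
  then have "CHAR('k) dvd l" using p prime_dvd_power by blast
  then have "CHAR('k) = l" using p l(1) by (simp add: primes_dvd_imp_eq)
  then show ?thesis using freshmans_dream'[of r k x y] p l by simp
qed

lemma frobenius_minus:
  fixes x :: "'k::{field,finite}"
  assumes "primepow r" "CARD('k) = r ^ 2"
  shows "(- x) ^ r = - (x ^ r)"
  using frobenius_add[OF assms, of x "- x"] primepow_gt_Suc_0[OF assms(1)]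
  by (simp add: power_0_left eq_neg_iff_add_eq_0 add.commute)

text \<open>The trace has at most r values (the elements fixed by the involution), at most r
  preimages of each, and r * r arguments.\<close>

lemma card_trace_fibre:
  fixes c :: "'k::{field,finite}"
  assumes r: "primepow r" "CARD('k) = r ^ 2" and c: "c ^ r = c"
  shows "card {x. x + x ^ r = c} = r"
proof -
  have r1: "r > 1" using r(1) by (simp add: primepow_gt_Suc_0)
  have "(x ^ r) ^ r = x" for x :: 'k
    using power_card_eq_self[of x] r by (simp add: power2_eq_square power_mult)
  then have "card {x \<in> UNIV. x + x ^ r = c} = r"
    using c r1 card_fixed_power_le[OF r1, where ?'k = 'k] card_trace_fibre_le[OF r1, where ?'k = 'k]
    by (intro card_fibre_eq_bound[where B = "{x. x ^ r = x}" and m = r])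
      (auto simp: frobenius_add[OF r] r(2) power2_eq_square add.commute)
  then show ?thesis by simp
qed

text \<open>As for the trace, on nonzero elements: at most r - 1 values, at most r + 1 preimages of
  each, (r - 1) (r + 1) arguments.\<close>

lemma norm_surj:
  fixes c :: "'k::{field,finite}"
  assumes r: "primepow r" "CARD('k) = r ^ 2" and c: "c ^ r = c" "c \<noteq> 0"
  obtains x where "x ^ Suc r = c"
proof -
  have r1: "r > 1" using r(1) by (simp add: primepow_gt_Suc_0)
  have fix_r: "(x ^ r) ^ r = x" for x :: 'k
    using power_card_eq_self[of x] r by (simp add: power2_eq_square power_mult)
  have "{x :: 'k. x ^ r = x} = insert 0 ({x. x ^ r = x} - {0})" using r1 by auto
  then have "card {x :: 'k. x ^ r = x} = Suc (card ({x :: 'k. x ^ r = x} - {0}))"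
    by (metis card_insert_disjoint Diff_iff finite insertCI)
  then have card_B: "card ({x :: 'k. x ^ r = x} - {0}) \<le> r - 1"
    using card_fixed_power_le[OF r1, where ?'k = 'k] by linarith
  have card_A: "card (UNIV - {0 :: 'k}) = (r - 1) * Suc r"
    using r(2) r1 by (simp add: card_Diff_subset power2_eq_square algebra_simps)
  have "card {x \<in> UNIV - {0}. x ^ Suc r = c} = Suc r"
  proof (rule card_fibre_eq_bound[OF _ _ _ card_B card_A])
    show "(\<lambda>x. x ^ Suc r) ` (UNIV - {0 :: 'k}) \<subseteq> {x. x ^ r = x} - {0}"
      using fix_r by (auto simp: power_mult_distrib)
    fix b assume "b \<in> {x :: 'k. x ^ r = x} - {0}"
    have "card {a \<in> UNIV - {0}. a ^ Suc r = b} \<le> card {a. a ^ Suc r = b}"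
      by (intro card_mono) auto
    also have "\<dots> \<le> Suc r" by (rule card_power_fibre_le) simp
    finally show "card {a \<in> UNIV - {0}. a ^ Suc r = b} \<le> Suc r" .
  qed (use c in auto)
  then have "{x \<in> UNIV - {0}. x ^ Suc r = c} \<noteq> {}" by (metis card.empty nat.distinct(1))
  then show ?thesis using that by blast
qed

section \<open>Hermitian spaces of odd dimension\<close>

locale hermitian_space =
  fixes h :: "'k::{field,finite} ^ 'n::finite \<Rightarrow> 'k ^ 'n \<Rightarrow> 'k" and r d :: nat
  assumes primepow_r: "primepow r" and card_k: "CARD('k) = r ^ 2"
    and card_n: "CARD('n) = 2 * d + 1"
    and herm: "hermitian_form r h" and nondeg: "nondegenerate_form h"
begin

abbreviation isotropic :: "('k ^ 'n) set \<Rightarrow> bool" where "isotropic \<equiv> totally_isotropic h"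
abbreviation X :: "('k ^ 'n) set set" where "X \<equiv> maximal_isotropics h"

text \<open>The varying vector sits in the first argument, the linear one, which makes
  \<open>perp U\<close> a subspace for every set \<open>U\<close>.\<close>

definition perp :: "('k ^ 'n) set \<Rightarrow> ('k ^ 'n) set" where
  "perp U = {v. \<forall>u\<in>U. h v u = 0}"

lemma r_gt_1: "r > 1" using primepow_r by (simp add: primepow_gt_Suc_0)

lemma q_gt_1: "CARD('k) > 1" using card_scalars_ge_2[where 'k='k] by simp

lemma
  shows h_add_left: "h (u + v) w = h u w + h v w"
    and h_scale_left: "h (a *s u) w = a * h u w"
    and h_conj: "h w u = h u w ^ r"
  using herm unfolding hermitian_form_def by blast+

lemma h_add_right: "h w (u + v) = h w u + h w v"
  using h_conj[of w "u + v"] h_conj[of w u] h_conj[of w v]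
  by (simp add: h_add_left frobenius_add[OF primepow_r card_k])

lemma h_scale_right: "h w (a *s u) = a ^ r * h w u"
  using h_conj[of w "a *s u"] h_conj[of w u] by (simp add: h_scale_left power_mult_distrib)

lemma h_zero_left [simp]: "h 0 w = 0"
  using h_scale_left[of 0 0 w] by simp

lemma h_zero_right [simp]: "h w 0 = 0"
  using h_conj[of w 0] r_gt_1 by simp

lemma h_eq_0_sym: "h u v = 0 \<longleftrightarrow> h v u = 0"
  using h_conj[of u v] h_conj[of v u] r_gt_1 by auto

section \<open>Orthogonality and isotropic subspaces\<close>

lemma subspace_perp [simp]: "vec.subspace (perp U)"
  by (rule vec.subspaceI) (auto simp: perp_def h_add_left h_scale_left)

lemma subset_perp_sym: "A \<subseteq> perp B \<longleftrightarrow> B \<subseteq> perp A"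
  using h_eq_0_sym by (auto simp: perp_def)

lemma perp_antimono: "A \<subseteq> B \<Longrightarrow> perp B \<subseteq> perp A"
  by (auto simp: perp_def)

lemma perp_span: "perp (vec.span U) = perp U"
  using subset_perp_sym[of U "perp U"] vec.span_minimal[OF _ subspace_perp, of U "perp U"]
    subset_perp_sym[of "vec.span U" "perp U"] perp_antimono[OF vec.span_superset[of U]] by blast

lemma iso_iff: "isotropic U \<longleftrightarrow> vec.subspace U \<and> U \<subseteq> perp U"
  by (auto simp: totally_isotropic_def perp_def)

lemma iso_subspace: "isotropic U \<Longrightarrow> vec.subspace U"
  by (simp add: iso_iff)

lemma iso_mono: "isotropic U \<Longrightarrow> vec.subspace V \<Longrightarrow> V \<subseteq> U \<Longrightarrow> isotropic V"
  by (auto simp: totally_isotropic_def)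

text \<open>Count the orthogonal pairs in \<open>A \<times> B\<close> from both sides. For fixed a,
  the b orthogonal to it are all of \<open>B\<close> when a is in \<open>perp B\<close> and a
  fraction 1/q of \<open>B\<close> otherwise.\<close>

lemma card_Int_perp:
  assumes A: "vec.subspace A" and B: "vec.subspace B"
  shows "card (A \<inter> perp B) * card B = card (B \<inter> perp A) * card A"
proof -
  have count: "CARD('k) * card {(a, b) \<in> A \<times> B. h a b = 0} = card A * card B + (CARD('k) - 1) * (card (A \<inter> perp B) * card B)"
    if B: "vec.subspace B" for A B
  proof -
    have *: "CARD('k) * card {b \<in> B. h a b = 0} = card B + (if a \<in> perp B then (CARD('k) - 1) * card B else 0)" for a
    proof (cases "a \<in> perp B")
      case True
      then have "{b \<in> B. h a b = 0} = B" by (auto simp: perp_def)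
      then show ?thesis using True q_gt_1 by (simp add: algebra_simps)
    next
      case False
      then obtain b where "b \<in> B" "h b a \<noteq> 0" using h_eq_0_sym by (auto simp: perp_def)
      with card_kernel_functional[of B "\<lambda>b. h b a" b, OF B h_add_left h_scale_left] False
      show ?thesis by (simp add: h_eq_0_sym[of a])
    qed
    have "card {(a, b) \<in> A \<times> B. h a b = 0} = card (Sigma A (\<lambda>a. {b \<in> B. h a b = 0}))"
      by (intro arg_cong[where f = card]) auto
    also have "\<dots> = (\<Sum>a\<in>A. card {b \<in> B. h a b = 0})" by (intro card_SigmaI) auto
    finally have "CARD('k) * card {(a, b) \<in> A \<times> B. h a b = 0} = (\<Sum>a\<in>A. CARD('k) * card {b \<in> B. h a b = 0})"
      by (simp add: sum_distrib_left)
    also have "\<dots> = card A * card B + card (A \<inter> perp B) * ((CARD('k) - 1) * card B)"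
      unfolding * by (simp add: sum.distrib flip: sum.inter_restrict)
    finally show ?thesis by (simp add: algebra_simps)
  qed
  have "bij_betw prod.swap {(a, b) \<in> A \<times> B. h a b = 0} {(a, b) \<in> B \<times> A. h a b = 0}"
    by (rule bij_betwI[where g = prod.swap]) (auto simp: h_eq_0_sym)
  from bij_betw_same_card[OF this] count[OF B, of A] count[OF A, of B]
  have "(CARD('k) - 1) * (card (A \<inter> perp B) * card B) = (CARD('k) - 1) * (card (B \<inter> perp A) * card A)"
    by (simp add: mult.commute)
  then show ?thesis using q_gt_1 by simp
qed

lemma dim_Int_perp:
  assumes "vec.subspace A" "vec.subspace B"
  shows "vec.dim (A \<inter> perp B) + vec.dim B = vec.dim (B \<inter> perp A) + vec.dim A"
proof -
  have "CARD('k) ^ (vec.dim (A \<inter> perp B) + vec.dim B) = CARD('k) ^ (vec.dim (B \<inter> perp A) + vec.dim A)"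
    using card_Int_perp[OF assms] assms by (simp add: card_subspace vec.subspace_inter power_add)
  then show ?thesis using q_gt_1 by simp
qed

lemma dim_perp:
  assumes "vec.subspace U"
  shows "vec.dim (perp U) + vec.dim U = 2 * d + 1"
proof -
  have "U \<inter> perp UNIV = {0}"
    using nondeg vec.subspace_0[OF assms] unfolding nondegenerate_form_def perp_def by auto
  then show ?thesis using dim_Int_perp[of UNIV U] assms card_n by (simp add: vec_dim_card del: vec.dim_UNIV)
qed

lemma iso_dim_le: "isotropic U \<Longrightarrow> vec.dim U \<le> d"
  using dim_perp[of U] vec.dim_subset[of U "perp U"] by (auto simp: iso_iff)

lemma iso_span_insert:
  assumes "isotropic U" "v \<in> perp U" "h v v = 0"
  shows "isotropic (vec.span (insert v U))"
proof -
  have "insert v U \<subseteq> perp (insert v U)"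
    using assms h_eq_0_sym by (auto simp: iso_iff perp_def)
  then show ?thesis using vec.span_minimal[OF _ subspace_perp] by (auto simp: iso_iff perp_span)
qed

text \<open>The quotient of \<open>perp U\<close> by \<open>U\<close> has dimension at least 3, so
  it contains two orthogonal directions v and w. If neither is isotropic, v + x w is, for an x whose
  norm is -h(v,v)/h(w,w); such an x exists because the norm is onto the fixed field. The result is
  outside \<open>U\<close> because it is not orthogonal to v.\<close>

lemma exists_isotropic_vector:
  assumes U: "isotropic U" "vec.dim U < d"
  obtains v where "v \<in> perp U" "v \<notin> U" "h v v = 0"
proof -
  have sU: "vec.subspace U" using U iso_subspace by simp
  have "vec.dim (perp U) > vec.dim U" using dim_perp[OF sU] U by simp
  then obtain v where v: "v \<in> perp U" "v \<notin> U" by (meson subsetI vec.dim_subset not_less)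
  show ?thesis
  proof (cases "h v v = 0")
    case False
    \<comment> \<open>Orthogonality to \<open>v\<close> costs at most one of the at least three
      dimensions by which \<open>perp U\<close> exceeds \<open>U\<close>.\<close>
    have hyp: "vec.dim (perp U) \<le> Suc (vec.dim (perp U \<inter> perp {v}))"
      using dim_Int_perp[of "perp U" "vec.span {v}"] vec.dim_le_card[of "vec.span {v} \<inter> perp (perp U)" "{v}"]
      vec.dim_subset[of "vec.span {v} \<inter> perp (perp U)" "vec.span {v}"]
      by (simp add: perp_span split: if_splits)
    then have "vec.dim (perp U \<inter> perp {v}) > vec.dim U" using dim_perp[OF sU] U by simp
    then obtain w where w: "w \<in> perp U" "w \<in> perp {v}" "w \<notin> U" by (meson subsetI vec.dim_subset not_less IntD1 IntD2)
    show ?thesis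
    proof (cases "h w w = 0")
      case hw: False
      have wv: "h w v = 0" "h v w = 0" using w h_eq_0_sym by (auto simp: perp_def)
      define c where "c = - (h v v / h w w)"
      have "c ^ r = c"
        using h_conj[of v v] h_conj[of w w]
        by (simp add: c_def power_divide frobenius_minus[OF primepow_r card_k])
      moreover have "c \<noteq> 0" using False hw by (simp add: c_def)
      ultimately obtain x where x: "x ^ Suc r = c" using norm_surj[OF primepow_r card_k] by blast
      define u where "u = v + x *s w"
      have "h u u = h v v + x ^ Suc r * h w w"
        by (simp add: u_def h_add_left h_add_right h_scale_left h_scale_right wv algebra_simps)
      then have "h u u = 0" using x hw by (simp add: c_def)
      moreover have "u \<in> perp U" unfolding u_def using v w by (intro vec.subspace_add vec.subspace_scale) auto
      moreover have "h v u = h v v" using wv by (simp add: u_def h_add_right h_scale_right)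
      then have "u \<notin> U" using v False by (auto simp: perp_def)
      ultimately show ?thesis using that by blast
    qed (use that w in blast)
  qed (use that v in blast)
qed

section \<open>Maximal isotropic subspaces\<close>

lemma maximal_iff: "x \<in> X \<longleftrightarrow> isotropic x \<and> vec.dim x = d"
proof
  assume x: "x \<in> X"
  then have i: "isotropic x" by (simp add: maximal_isotropics_def)
  have "vec.dim x = d"
  proof (rule ccontr)
    assume "vec.dim x \<noteq> d"
    then have "vec.dim x < d" using iso_dim_le[OF i] by simp
    then obtain v where v: "v \<in> perp x" "v \<notin> x" "h v v = 0" using exists_isotropic_vector[OF i] by blast
    then have "isotropic (vec.span (insert v x))" using iso_span_insert i by blast
    moreover have "insert v x \<subseteq> vec.span (insert v x)" by (rule vec.span_superset)
    ultimately show False using x v by (auto simp: maximal_isotropics_def)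
  qed
  with i show "isotropic x \<and> vec.dim x = d" by simp
next
  assume x: "isotropic x \<and> vec.dim x = d"
  then have "x = V" if "isotropic V" "x \<subseteq> V" for V
    using that iso_dim_le[of V] vec.subspace_dim_equal[of x V] iso_subspace by auto
  then show "x \<in> X" using x by (auto simp: maximal_isotropics_def)
qed

lemma maximal_subspace: "x \<in> X \<Longrightarrow> vec.subspace x"
  by (simp add: maximal_iff iso_subspace)

lemma iso_extend:
  assumes "isotropic U"
  obtains x where "x \<in> X" "U \<subseteq> x"
proof -
  have "\<exists>x\<in>X. U \<subseteq> x" using assms
  proof (induction "d - vec.dim U" arbitrary: U rule: less_induct)
    case less
    show ?case
    proof (cases "vec.dim U = d")
      case False
      then have lt: "vec.dim U < d" using iso_dim_le[OF less.prems] by simp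
      obtain v where v: "v \<in> perp U" "v \<notin> U" "h v v = 0"
        using exists_isotropic_vector[OF less.prems lt] by blast
      have "d - vec.dim (vec.span (insert v U)) < d - vec.dim U"
        using lt v dim_insert_subspace[OF iso_subspace[OF less.prems]] by simp
      from less.hyps[OF this iso_span_insert[OF less.prems v(1,3)]]
      show ?thesis using vec.span_superset[of "insert v U"] by blast
    qed (use less.prems in \<open>auto simp: maximal_iff\<close>)
  qed
  then show ?thesis using that by blast
qed

lemma mem_maximal:
  assumes "x \<in> X" "v \<in> perp x" "h v v = 0"
  shows "v \<in> x"
proof -
  have "isotropic (vec.span (insert v x))" using assms by (simp add: iso_span_insert maximal_iff)
  then have "vec.dim (insert v x) \<le> vec.dim x" using assms iso_dim_le[of "vec.span (insert v x)"]
    by (simp add: maximal_iff)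
  then show ?thesis using dim_insert_subspace[OF maximal_subspace[OF assms(1)], of v] by (cases "v \<in> x") auto
qed

lemma iso_Int_perp_maximal:
  assumes "isotropic U" "x \<in> X"
  shows "U \<inter> perp x = U \<inter> x"
proof -
  have "x \<subseteq> perp x" using assms(2) by (simp add: maximal_iff iso_iff)
  moreover have "v \<in> x" if "v \<in> U" "v \<in> perp x" for v
    using mem_maximal[OF assms(2) that(2)] that(1) assms(1) by (simp add: totally_isotropic_def)
  ultimately show ?thesis by blast
qed

lemma dim_maximal_Int_perp:
  assumes "isotropic U" "x \<in> X"
  shows "vec.dim (x \<inter> perp U) + vec.dim U = d + vec.dim (U \<inter> x)"
  using dim_Int_perp[of x U] assms iso_Int_perp_maximal[OF assms] by (simp add: maximal_iff iso_iff)

end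

section \<open>Counting maximal isotropic subspaces over a given one\<close>

context hermitian_space
begin

lemma maximal_eq_span_insert:
  assumes "x \<in> X" "vec.subspace H" "H \<subseteq> x" "Suc (vec.dim H) = d" "v \<in> x" "v \<notin> H"
  shows "x = vec.span (insert v H)"
proof (rule sym[OF vec.subspace_dim_equal])
  show "vec.span (insert v H) \<subseteq> x"
    using assms by (intro vec.span_minimal) (auto simp: maximal_subspace)
  show "vec.dim x \<le> vec.dim (vec.span (insert v H))"
    using assms by (simp add: dim_insert_subspace maximal_iff)
qed (use assms maximal_subspace in auto)

lemma maximal_subset_perp: "x \<in> X \<Longrightarrow> x \<subseteq> perp x"
  by (simp add: maximal_iff iso_iff)

text \<open>For isotropic \<open>e\<close>, the value of the form at v + t e is h(v,v) plus the
  trace of t h(e,v). As t varies, t h(e,v) runs through the field, so the count is that of a trace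
  fibre.\<close>

lemma card_isotropic_translates:
  assumes "h e v \<noteq> 0" "h e e = 0"
  shows "card {t. h (v + t *s e) (v + t *s e) = 0} = r"
proof -
  have eq: "h (v + t *s e) (v + t *s e) = h v v + (t * h e v + (t * h e v) ^ r)" for t
    using h_conj[of v e] assms(2)
    by (simp add: h_add_left h_add_right h_scale_left h_scale_right power_mult_distrib algebra_simps)
  have "bij_betw (\<lambda>t. t * h e v) {t. h (v + t *s e) (v + t *s e) = 0} {s. s + s ^ r = - h v v}"
    using assms(1) by (intro bij_betwI[where g = "\<lambda>s. s / h e v"]) (auto simp: eq add_eq_0_iff add.commute)
  from bij_betw_same_card[OF this] have "card {t. h (v + t *s e) (v + t *s e) = 0} = card {s. s + s ^ r = - h v v}" .
  also have "\<dots> = r"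
    using h_conj[of v v] by (intro card_trace_fibre primepow_r card_k) (simp add: frobenius_minus[OF primepow_r card_k])
  finally show ?thesis .
qed

text \<open>Modulo \<open>H\<close>, \<open>perp H\<close> is a Hermitian space of dimension 3 and
  the maximal subspaces over \<open>H\<close> are its isotropic points. The other subspaces
  partition, outside \<open>H\<close>, the isotropic vectors \<open>?I\<close> of \<open>?D\<close>.
  A line of \<open>?D\<close> in the direction of a vector \<open>e\<close> of \<open>z0\<close>
  outside \<open>H\<close> has r isotropic points among its q, so |I| = |D| r / q, and division by
  the (q - 1) q^(d-1) vectors that each subspace contributes leaves q r = r^3.\<close>

lemma card_other_maximals_over_hyperplane:
  assumes H: "isotropic H" "Suc (vec.dim H) = d" and z0: "z0 \<in> X" "H \<subseteq> z0"
  shows "card {z \<in> X. H \<subseteq> z \<and> z \<noteq> z0} = r ^ 3"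
proof -
  let ?S = "{z \<in> X. H \<subseteq> z \<and> z \<noteq> z0}" and ?D = "perp H - perp z0"
  let ?I = "{v \<in> perp H - perp z0. h v v = 0}" and ?m = "vec.dim H"
  have sH: "vec.subspace H" using H iso_subspace by simp
  have z0p: "z0 \<subseteq> perp z0" "perp z0 \<subseteq> perp H" using z0 maximal_subset_perp perp_antimono by auto
  note span = maximal_eq_span_insert[OF _ sH _ H(2)]
  have "\<not> z0 \<subseteq> H" using H(2) z0 vec.dim_subset[of z0 H] by (auto simp: maximal_iff)
  then obtain e where e: "e \<in> z0" "e \<notin> H" by auto
  have ee: "h e e = 0" using e z0 by (auto simp: maximal_iff totally_isotropic_def)
  have z0_span: "z0 = vec.span (insert e H)" using span[OF z0] e by simp
  have he: "h e v \<noteq> 0" if "v \<in> ?D" for v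
  proof
    assume "h e v = 0"
    then have "v \<in> perp (insert e H)" using that h_eq_0_sym by (auto simp: perp_def)
    then show False using that z0_span perp_span by auto
  qed
  have I_eq: "?I = (\<Union>z\<in>?S. z - H)"
  proof (intro equalityI subsetI)
    fix v assume v: "v \<in> ?I"
    let ?z = "vec.span (insert v H)"
    have vH: "v \<notin> H" using v z0 z0p by auto
    have vz: "v \<in> ?z" "H \<subseteq> ?z" using vec.span_superset[of "insert v H"] by auto
    have "isotropic ?z" using v H by (intro iso_span_insert) auto
    then have "?z \<in> X" using vH H dim_insert_subspace[OF sH] by (simp add: maximal_iff)
    moreover have "?z \<noteq> z0" using vz v z0p by auto
    ultimately show "v \<in> (\<Union>z\<in>?S. z - H)" using vH vz by blast
  next
    fix v assume "v \<in> (\<Union>z\<in>?S. z - H)"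
    then obtain z where z: "z \<in> X" "H \<subseteq> z" "z \<noteq> z0" "v \<in> z" "v \<notin> H" by auto
    have zp: "z \<subseteq> perp z" using z maximal_subset_perp by auto
    then have v: "v \<in> perp H" "h v v = 0" using z perp_antimono[of H z] by (auto simp: perp_def)
    moreover have "v \<notin> perp z0"
    proof
      assume "v \<in> perp z0"
      then have "v \<in> z0" using mem_maximal z0 v by simp
      then show False using span[OF z0] span[OF z(1,2)] z by metis
    qed
    ultimately show "v \<in> ?I" by simp
  qed
  have "card ?I = (\<Sum>z\<in>?S. card (z - H))"
    unfolding I_eq
  proof (intro card_UN_disjoint ballI impI)
    fix z z' assume "z \<in> ?S" "z' \<in> ?S" "z \<noteq> z'"
    then show "(z - H) \<inter> (z' - H) = {}" using span[of z] span[of z'] by blast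
  qed auto
  also have "\<dots> = (\<Sum>z\<in>?S. (CARD('k) - 1) * CARD('k) ^ ?m)"
  proof (intro sum.cong refl)
    fix z assume z: "z \<in> ?S"
    then have "card (z - H) = card z - card H" by (intro card_Diff_subset) auto
    then show "card (z - H) = (CARD('k) - 1) * CARD('k) ^ ?m"
      using z sH H(2)[symmetric] by (simp add: card_subspace maximal_subspace maximal_iff diff_mult_distrib)
  qed
  finally have card_I: "card ?I = card ?S * ((CARD('k) - 1) * CARD('k) ^ ?m)" by simp
  have shift: "v + t *s e \<in> ?D \<longleftrightarrow> v \<in> ?D" for v t
  proof -
    have te: "t *s e \<in> perp z0" "t *s e \<in> perp H"
      using e z0p by (auto intro!: vec.subspace_scale)
    have "v + u \<in> perp A \<longleftrightarrow> v \<in> perp A" if "u \<in> perp A" for u A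
      using vec.subspace_add[OF subspace_perp, of v A u] vec.subspace_diff[OF subspace_perp, of "v + u" A u] that
      by auto
    then show ?thesis using te by simp
  qed
  have "card {v \<in> ?D. h (v + t *s e) (v + t *s e) = 0} = card ?I" for t
  proof -
    have "bij_betw (\<lambda>v. v + t *s e) {v \<in> ?D. h (v + t *s e) (v + t *s e) = 0} ?I"
    proof (rule bij_betwI[where g = "\<lambda>v. v - t *s e"])
      show "(\<lambda>v. v + t *s e) \<in> {v \<in> ?D. h (v + t *s e) (v + t *s e) = 0} \<rightarrow> ?I"
        using shift by blast
      show "(\<lambda>v. v - t *s e) \<in> ?I \<rightarrow> {v \<in> ?D. h (v + t *s e) (v + t *s e) = 0}"
      proof
        fix v assume "v \<in> ?I"
        then show "v - t *s e \<in> {v \<in> ?D. h (v + t *s e) (v + t *s e) = 0}"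
          using shift[of "v - t *s e" t] by simp
      qed
    qed simp_all
    from bij_betw_same_card[OF this] show ?thesis .
  qed
  \<comment> \<open>Double count of the pairs (v, t) with v in \<open>?D\<close> and v + t e
    isotropic: each t contributes |I| because translation by t e preserves \<open>?D\<close>, and
    each v contributes r.\<close>
  then have "CARD('k) * card ?I = (\<Sum>t\<in>UNIV. card {v \<in> ?D. h (v + t *s e) (v + t *s e) = 0})" by simp
  also have "\<dots> = (\<Sum>v\<in>?D. card {t \<in> UNIV. h (v + t *s e) (v + t *s e) = 0})"
    by (rule sum_card_swap) auto
  also have "\<dots> = (\<Sum>v\<in>?D. r)"
    using card_isotropic_translates[OF he ee] by (intro sum.cong) auto
  also have "\<dots> = card ?D * r" by simp
  also have "card ?D = card (perp H) - card (perp z0)" using z0p by (intro card_Diff_subset) auto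
  also have "\<dots> = (CARD('k) - 1) * CARD('k) ^ (?m + 2)"
  proof -
    have "vec.dim (perp H) = ?m + 3" "vec.dim (perp z0) = ?m + 2"
      using dim_perp[OF sH] dim_perp[OF maximal_subspace[OF z0(1)]] z0(1) H(2)[symmetric]
      by (simp_all add: maximal_iff)
    then show ?thesis by (simp add: card_subspace diff_mult_distrib eval_nat_numeral)
  qed
  finally have "(CARD('k) * (CARD('k) - 1) * CARD('k) ^ ?m) * card ?S
      = (CARD('k) * (CARD('k) - 1) * CARD('k) ^ ?m) * (CARD('k) * r)"
    unfolding card_I by (simp add: algebra_simps power_add power2_eq_square)
  then have "card ?S = CARD('k) * r" using q_gt_1 by simp
  then show ?thesis by (simp add: card_k eval_nat_numeral)
qed

lemma card_maximals_over_hyperplane: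
  assumes "isotropic H" "Suc (vec.dim H) = d"
  shows "card {z \<in> X. H \<subseteq> z} = r ^ 3 + 1"
proof -
  obtain z0 where z0: "z0 \<in> X" "H \<subseteq> z0" using iso_extend[OF assms(1)] by blast
  have "{z \<in> X. H \<subseteq> z} = insert z0 {z \<in> X. H \<subseteq> z \<and> z \<noteq> z0}" using z0 by auto
  then show ?thesis using card_other_maximals_over_hyperplane[OF assms z0] by simp
qed

text \<open>Let \<open>x\<close> lie over \<open>U\<close> and miss \<open>v\<close>. Then H = x
  \<inter> perp {v} is a hyperplane of \<open>x\<close>, and z = span (v, H) is a maximal subspace
  over \<open>U' = span (v, U)\<close>. Conversely each such \<open>z\<close> has a power of q many
  hyperplanes \<open>H\<close> through \<open>U\<close> that miss \<open>v\<close>, and each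
  \<open>H\<close> lies in r^3 maximal subspaces other than \<open>z\<close>. With r = -1 in F, the
  \<open>x\<close> that miss \<open>v\<close> therefore count as minus the \<open>z\<close>.\<close>

lemma of_nat_card_maximals_over_eq_0:
  assumes U: "isotropic U" "vec.dim U < d" and r: "of_nat r = (- 1 :: 'f::comm_ring_1)"
  shows "of_nat (card {x \<in> X. U \<subseteq> x}) = (0 :: 'f)"
proof -
  have sU: "vec.subspace U" using U iso_subspace by simp
  obtain v where v: "v \<in> perp U" "v \<notin> U" "h v v = 0" using exists_isotropic_vector[OF U] by blast
  define U' where "U' = vec.span (insert v U)"
  have U': "isotropic U'" "vec.subspace U'" "U \<subseteq> U'" "v \<in> U'" "vec.dim U' = Suc (vec.dim U)"
    using iso_span_insert[OF U(1) v(1,3)] vec.span_superset[of "insert v U"] dim_insert_subspace[OF sU v(2)]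
    by (auto simp: U'_def)
  have U'_sub: "U' \<subseteq> x \<longleftrightarrow> U \<subseteq> x \<and> v \<in> x" if "x \<in> X" for x
    using U' vec.span_minimal[of "insert v U" x] maximal_subspace[OF that] by (auto simp: U'_def)
  let ?Y = "{x \<in> X. U \<subseteq> x \<and> v \<notin> x}" and ?Z = "{z \<in> X. U' \<subseteq> z}"
  \<comment> \<open>The hyperplanes of \<open>z\<close> that contain \<open>U\<close> and miss
    \<open>v\<close>, phrased as complements to fit \<open>card_complements\<close>.\<close>
  let ?Hyp = "\<lambda>z. {H. vec.subspace H \<and> H \<subseteq> z \<and> H \<inter> U' = U \<and> vec.dim H + vec.dim U' = vec.dim z + vec.dim U}"
  let ?F = "\<lambda>p. {x \<in> X. snd p \<subseteq> x \<and> x \<noteq> fst p}"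
  have Hyp: "Suc (vec.dim H) = d" "v \<notin> H" "isotropic H" "z = vec.span (insert v H)" "z \<in> X"
    if z: "z \<in> ?Z" and H: "H \<in> ?Hyp z" for z H
  proof -
    show 1: "Suc (vec.dim H) = d" using z H U' by (simp add: maximal_iff)
    show 2: "v \<notin> H" using H U' v by auto
    show "isotropic H" using z H iso_mono[of z H] by (simp add: maximal_iff)
    show "z = vec.span (insert v H)"
      using z H U' 1 2 by (intro maximal_eq_span_insert) auto
    show "z \<in> X" using z by simp
  qed
  have F: "H = x \<inter> perp {v}" "v \<notin> x" "U \<subseteq> x" "x \<in> X"
    if z: "z \<in> ?Z" and H: "H \<in> ?Hyp z" and x: "x \<in> ?F (z, H)" for x z H
  proof -
    note zH = Hyp[OF z H]
    have xX: "x \<in> X" "H \<subseteq> x" "x \<noteq> z" using x by auto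
    show "v \<notin> x"
    proof
      assume "v \<in> x"
      then have "z = x" using maximal_eq_span_insert[OF xX(1), of H v] zH xX H by simp
      then show False using xX by simp
    qed
    then have "v \<notin> perp x" using mem_maximal[OF xX(1)] v by blast
    then have nsub: "\<not> x \<subseteq> perp {v}" using subset_perp_sym[of x "{v}"] by auto
    have sub: "H \<subseteq> x \<inter> perp {v}"
    proof
      fix u assume u: "u \<in> H"
      moreover have "u \<in> z" "v \<in> z" using u z H U' by auto
      then have "h u v = 0" using zH(5) by (auto simp: maximal_iff totally_isotropic_def)
      ultimately show "u \<in> x \<inter> perp {v}" using xX by (auto simp: perp_def)
    qed
    have sx: "vec.subspace (x \<inter> perp {v})" using maximal_subspace[OF xX(1)] by (simp add: vec.subspace_inter)
    have "vec.dim (x \<inter> perp {v}) < d"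
    proof (rule ccontr)
      assume "\<not> vec.dim (x \<inter> perp {v}) < d"
      then have "x \<inter> perp {v} = x"
        using sx maximal_subspace[OF xX(1)] xX(1) by (intro vec.subspace_dim_equal) (auto simp: maximal_iff)
      then show False using nsub by blast
    qed
    then show "H = x \<inter> perp {v}" using sub H sx zH(1) by (intro vec.subspace_dim_equal) auto
    show "U \<subseteq> x" using H xX by blast
    show "x \<in> X" by (rule xX(1))
  qed
  have Y_eq: "?Y = (\<Union>p\<in>Sigma ?Z ?Hyp. ?F p)"
  proof (intro equalityI subsetI)
    fix x assume x: "x \<in> ?Y"
    then have xX: "x \<in> X" "U \<subseteq> x" "v \<notin> x" by auto
    define H where "H = x \<inter> perp {v}"
    define z where "z = vec.span (insert v H)"
    have sx: "vec.subspace x" and sH: "vec.subspace H"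
      using maximal_subspace[OF xX(1)] by (auto simp: H_def vec.subspace_inter)
    have cv: "c = 0" if "c *s v \<in> x" for c using subspace_scale_cancel[OF sx that] xX by auto
    have "vec.span {v} \<inter> x = {0}"
      using cv vec.subspace_0[OF sx] by (auto simp: vec.span_singleton)
    moreover have "isotropic (vec.span {v})"
    proof -
      have "isotropic {0}" by (auto simp: totally_isotropic_def)
      then have "isotropic (vec.span {v, 0})" using v by (intro iso_span_insert) (auto simp: perp_def)
      then show ?thesis by (simp add: insert_commute)
    qed
    moreover have "v \<noteq> 0" using v vec.subspace_0[OF sU] by auto
    ultimately have dH: "Suc (vec.dim H) = d"
      using dim_maximal_Int_perp[of "vec.span {v}" x] xX(1) by (simp add: perp_span H_def)
    have isoH: "isotropic H" using iso_mono[of x H] xX sH by (auto simp: maximal_iff H_def)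
    have vH: "v \<notin> H" "v \<in> perp H" using xX h_eq_0_sym by (auto simp: H_def perp_def)
    have zX: "z \<in> X"
      using iso_span_insert[OF isoH vH(2) v(3)] dim_insert_subspace[OF sH vH(1)] dH by (simp add: z_def maximal_iff)
    have zsup: "v \<in> z" "H \<subseteq> z" using vec.span_superset[of "insert v H"] by (auto simp: z_def)
    have UH: "U \<subseteq> H" using xX v h_eq_0_sym by (auto simp: H_def perp_def)
    have "H \<inter> U' = U"
    proof (intro equalityI subsetI)
      fix u assume u: "u \<in> H \<inter> U'"
      then obtain c where c: "u - c *s v \<in> U" using sU by (auto simp: U'_def in_span_insert_subspace_iff)
      then have "c *s v \<in> x" using vec.subspace_diff[OF sx, of u "u - c *s v"] u xX by (auto simp: H_def)
      then have "c = 0" by (rule cv)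
      then show "u \<in> U" using c by simp
    qed (use UH U' in auto)
    then have "H \<in> ?Hyp z" using sH zsup dH U' zX by (auto simp: maximal_iff)
    moreover have "z \<in> ?Z" using zX zsup UH U'_sub by auto
    moreover have "x \<in> ?F (z, H)" using xX zsup by (auto simp: H_def)
    ultimately show "x \<in> (\<Union>p\<in>Sigma ?Z ?Hyp. ?F p)" by blast
  next
    fix x assume "x \<in> (\<Union>p\<in>Sigma ?Z ?Hyp. ?F p)"
    then obtain z H where "z \<in> ?Z" "H \<in> ?Hyp z" "x \<in> ?F (z, H)" by blast
    from F[OF this] show "x \<in> ?Y" by simp
  qed
  have "card ?Y = (\<Sum>p\<in>Sigma ?Z ?Hyp. card (?F p))"
    unfolding Y_eq
  proof (intro card_UN_disjoint ballI impI)
    fix p p' assume p: "p \<in> Sigma ?Z ?Hyp" "p' \<in> Sigma ?Z ?Hyp" "p \<noteq> p'"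
    obtain z H z' H' where [simp]: "p = (z, H)" "p' = (z', H')" by fastforce
    have zH: "z \<in> ?Z" "H \<in> ?Hyp z" "z' \<in> ?Z" "H' \<in> ?Hyp z'" using p by auto
    have False if "x \<in> ?F p" "x \<in> ?F p'" for x
    proof -
      have "H = H'" using F(1)[OF zH(1,2), of x] F(1)[OF zH(3,4), of x] that by simp
      moreover from this have "z = z'" using Hyp(4)[OF zH(1,2)] Hyp(4)[OF zH(3,4)] by simp
      ultimately show False using p(3) by simp
    qed
    then show "?F p \<inter> ?F p' = {}" by blast
  qed auto
  also have "\<dots> = (\<Sum>p\<in>Sigma ?Z ?Hyp. r ^ 3)"
  proof (intro sum.cong refl)
    fix p assume p: "p \<in> Sigma ?Z ?Hyp"
    obtain z H where [simp]: "p = (z, H)" by fastforce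
    have zH: "z \<in> ?Z" "H \<in> ?Hyp z" using p by auto
    then have "H \<subseteq> z" by blast
    then show "card (?F p) = r ^ 3"
      using card_other_maximals_over_hyperplane[OF Hyp(3,1,5)[OF zH]] by simp
  qed
  also have "\<dots> = (\<Sum>z\<in>?Z. card (?Hyp z)) * r ^ 3" by (simp add: card_SigmaI)
  finally have "of_nat (card ?Y) = (\<Sum>z\<in>?Z. of_nat (card (?Hyp z))) * (- 1 :: 'f)"
    by (simp add: r)
  also have "(\<Sum>z\<in>?Z. of_nat (card (?Hyp z))) = (\<Sum>z\<in>?Z. 1 :: 'f)"
  proof (intro sum.cong refl)
    fix z assume "z \<in> ?Z"
    then obtain e where "card (?Hyp z) = CARD('k) ^ e"
      using card_complements[OF sU U'(2) _ U'(3), of z] maximal_subspace by blast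
    then show "of_nat (card (?Hyp z)) = (1 :: 'f)" by (simp add: card_k r)
  qed
  finally have "of_nat (card ?Y) = - (of_nat (card ?Z) :: 'f)" by simp
  moreover have "card {x \<in> X. U \<subseteq> x} = card ?Z + card ?Y"
  proof -
    have "{x \<in> X. U \<subseteq> x} = ?Z \<union> ?Y" using U'_sub by blast
    moreover have "?Z \<inter> ?Y = {}" using U'_sub by blast
    ultimately show ?thesis by (simp add: card_Un_disjoint)
  qed
  ultimately show ?thesis by simp
qed

text \<open>No relation of the scheme is empty, which is what makes a function of the intersection
  dimension recoverable from its matrix. To lower the dimension by one, exchange \<open>y\<close>
  for another maximal subspace \<open>z\<close> through a hyperplane \<open>H\<close> of
  \<open>y\<close> that misses a vector \<open>v\<close> of \<open>x \<inter> y\<close>.\<close>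

lemma exists_maximals_at_distance:
  assumes "i \<le> d"
  shows "\<exists>x\<in>X. \<exists>y\<in>X. vec.dim (x \<inter> y) + i = d"
  using assms
proof (induction i)
  case 0
  have "isotropic {0}" by (auto simp: totally_isotropic_def)
  then obtain x where "x \<in> X" by (rule iso_extend)
  then show ?case by (intro bexI[of _ x]) (auto simp: maximal_iff)
next
  case (Suc i)
  then obtain x y where xy: "x \<in> X" "y \<in> X" "vec.dim (x \<inter> y) + i = d" by auto
  have sxy: "vec.subspace x" "vec.subspace y" "vec.subspace (x \<inter> y)"
    using xy by (auto simp: maximal_subspace vec.subspace_inter)
  have "\<not> x \<inter> y \<subseteq> {0}"
  proof
    assume "x \<inter> y \<subseteq> {0}"
    then have "vec.dim (x \<inter> y) = 0" by simp
    then show False using xy(3) Suc.prems by linarith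
  qed
  then obtain v where v: "v \<in> x" "v \<in> y" "v \<noteq> 0" by auto
  let ?C = "{V. vec.subspace V \<and> V \<subseteq> y \<and> V \<inter> vec.span {v} = {0} \<and>
      vec.dim V + vec.dim (vec.span {v}) = vec.dim y + vec.dim {0 :: 'k ^ 'n}}"
  have "vec.span {v} \<subseteq> y" using v sxy by (intro vec.span_minimal) auto
  then obtain e where "card ?C = CARD('k) ^ e"
    using card_complements[of "{0}" "vec.span {v}" y] sxy by (auto simp: vec.subspace_0)
  then have "card ?C \<noteq> 0" by simp
  then have "?C \<noteq> {}" by (metis card.empty)
  then obtain H where H: "H \<in> ?C" by blast
  then have H: "vec.subspace H" "H \<subseteq> y" "H \<inter> vec.span {v} = {0}" "Suc (vec.dim H) = d"
    using v xy by (auto simp: maximal_iff)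
  have vH: "v \<notin> H" using H(3) v vec.span_base[of v "{v}"] by auto
  have isoH: "isotropic H" using iso_mono[of y H] H xy by (simp add: maximal_iff)
  have "card {z \<in> X. H \<subseteq> z \<and> z \<noteq> y} \<noteq> 0"
    using card_other_maximals_over_hyperplane[OF isoH H(4) xy(2) H(2)] r_gt_1 by simp
  then have "{z \<in> X. H \<subseteq> z \<and> z \<noteq> y} \<noteq> {}" by (metis card.empty)
  then obtain z where z: "z \<in> X" "H \<subseteq> z" "z \<noteq> y" by auto
  have y_span: "y = vec.span (insert v H)" using maximal_eq_span_insert[OF xy(2) H(1,2,4) v(2) vH] .
  \<comment> \<open>A vector u of \<open>x \<inter> z\<close> outside \<open>H\<close> would be
    orthogonal to \<open>v\<close> and to \<open>H\<close>, hence to \<open>y\<close>, hence in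
    \<open>y\<close>; then \<open>y\<close> and \<open>z\<close> would both be the span of u and
    \<open>H\<close>.\<close>
  have "x \<inter> z = x \<inter> y \<inter> H"
  proof (intro equalityI subsetI)
    fix u assume u: "u \<in> x \<inter> z"
    have "u \<in> H"
    proof (rule ccontr)
      assume uH: "u \<notin> H"
      have "u \<in> perp (insert v H)"
        using u z v xy(1) by (auto simp: perp_def maximal_iff totally_isotropic_def)
      then have "u \<in> perp y" using y_span perp_span by metis
      moreover have "h u u = 0" using u xy(1) by (auto simp: maximal_iff totally_isotropic_def)
      ultimately have "u \<in> y" using mem_maximal[OF xy(2)] by simp
      then have "y = vec.span (insert u H)" using maximal_eq_span_insert[OF xy(2) H(1,2,4) _ uH] by simp
      moreover have "z = vec.span (insert u H)" using maximal_eq_span_insert[OF z(1) H(1) z(2) H(4) _ uH] u by simp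
      ultimately show False using z by simp
    qed
    then show "u \<in> x \<inter> y \<inter> H" using u H by auto
  qed (use z in auto)
  moreover have "vec.dim (x \<inter> y) = Suc (vec.dim (x \<inter> y \<inter> H))"
    using v vH sxy H xy(2) by (intro dim_Int_hyperplane[of y]) (auto simp: maximal_iff)
  ultimately show ?case using xy z by (intro bexI[of _ x] bexI[of _ z]) auto
qed

end

section \<open>Matrices counting common subspaces\<close>

context hermitian_space
begin

definition subs :: "nat \<Rightarrow> ('k ^ 'n) set \<Rightarrow> ('k ^ 'n) set set" where
  "subs j T = {W. vec.subspace W \<and> W \<subseteq> T \<and> vec.dim W = j}"

text \<open>For \<open>j \<le> d\<close> this is C_(d-j) of the overview; the index here is the
  dimension of the counted subspaces.\<close>

definition bmat :: "nat \<Rightarrow> ('k ^ 'n) set \<Rightarrow> ('k ^ 'n) set \<Rightarrow> 'f::field" where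
  "bmat j x y = (if x \<in> X \<and> y \<in> X then of_nat (card (subs j (x \<inter> y))) else 0)"

text \<open>The Gaussian number (q^n - 1)/(q - 1), as a sum because q - 1 may vanish in F.\<close>

definition qnum :: "nat \<Rightarrow> nat" where
  "qnum n = (\<Sum>i<n. CARD('k) ^ i)"

text \<open>The diagonal entry of multiplication by C_1 at \<open>bmat m\<close>. For an
  m-dimensional V inside x, each of the \<open>qnum (d - m)\<close> hyperplanes of x through V
  accounts for r^3 maximal subspaces, and each of the \<open>qnum d\<close> hyperplanes orthogonal
  to V for one more; \<open>qnum m\<close> is taken off because it is booked with the
  \<open>bmat (m - 1)\<close> term.\<close>

definition lam :: "nat \<Rightarrow> 'f::field" where
  "lam m = of_nat (qnum (d - m)) * of_nat r ^ 3 + of_nat (qnum d) - of_nat (qnum m)"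

lemma card_subs: "vec.subspace T \<Longrightarrow> card (subs j T) = gauss_binomial CARD('k) (vec.dim T) j"
  unfolding subs_def by (rule card_subspaces)

lemma bmat_gauss_binomial:
  "x \<in> X \<Longrightarrow> y \<in> X \<Longrightarrow> bmat j x y = of_nat (gauss_binomial CARD('k) (vec.dim (x \<inter> y)) j)"
  by (simp add: bmat_def card_subs vec.subspace_inter maximal_subspace)

lemma subs_isotropic: "isotropic T \<Longrightarrow> U \<in> subs j T \<Longrightarrow> isotropic U"
  using iso_mono by (auto simp: subs_def)

lemma bmat_eq_sum:
  assumes "x \<in> X" "z \<in> X"
  shows "bmat j x z = (\<Sum>U\<in>subs j x. of_bool (U \<subseteq> z))"
proof -
  have "subs j x \<inter> {U. U \<subseteq> z} = subs j (x \<inter> z)" by (auto simp: subs_def)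
  then show ?thesis using assms by (simp add: bmat_def)
qed

lemma bmat_sym: "bmat j x y = bmat j y x"
  by (simp add: bmat_def Int_commute)

lemma bmat_mult:
  assumes x: "x \<in> X" and y: "y \<in> X"
  shows "(\<Sum>z\<in>X. bmat j x z * bmat k z y)
    = (\<Sum>U\<in>subs j x. \<Sum>V\<in>subs k y. of_nat (card {z \<in> X. U \<subseteq> z \<and> V \<subseteq> z}) :: 'f::field)"
proof -
  have "(\<Sum>z\<in>X. bmat j x z * bmat k z y)
      = (\<Sum>z\<in>X. \<Sum>U\<in>subs j x. \<Sum>V\<in>subs k y. of_bool (U \<subseteq> z \<and> V \<subseteq> z) :: 'f)"
  proof (intro sum.cong refl)
    fix z assume z: "z \<in> X"
    have "bmat j x z * (bmat k z y :: 'f)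
        = (\<Sum>U\<in>subs j x. of_bool (U \<subseteq> z)) * (\<Sum>V\<in>subs k y. of_bool (V \<subseteq> z))"
      using bmat_eq_sum[OF x z, of j, where ?'a = 'f] bmat_eq_sum[OF y z, of k, where ?'a = 'f]
      by (simp only: bmat_sym[of k z y])
    also have "\<dots> = (\<Sum>U\<in>subs j x. \<Sum>V\<in>subs k y. of_bool (U \<subseteq> z) * of_bool (V \<subseteq> z))"
      by (rule sum_product)
    finally show "bmat j x z * (bmat k z y :: 'f)
        = (\<Sum>U\<in>subs j x. \<Sum>V\<in>subs k y. of_bool (U \<subseteq> z \<and> V \<subseteq> z))"
      by (simp only: of_bool_conj)
  qed
  also have "\<dots> = (\<Sum>U\<in>subs j x. \<Sum>z\<in>X. \<Sum>V\<in>subs k y. of_bool (U \<subseteq> z \<and> V \<subseteq> z))"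
    by (rule sum.swap)
  also have "\<dots> = (\<Sum>U\<in>subs j x. \<Sum>V\<in>subs k y. \<Sum>z\<in>X. of_bool (U \<subseteq> z \<and> V \<subseteq> z))"
    by (intro sum.cong refl sum.swap)
  also have "\<dots> = (\<Sum>U\<in>subs j x. \<Sum>V\<in>subs k y. of_nat (card {z \<in> X. U \<subseteq> z \<and> V \<subseteq> z}))"
    by (simp add: Int_def)
  finally show ?thesis .
qed

section \<open>Maximal isotropic subspaces over two given ones\<close>

lemma iso_subspace_sum:
  assumes "isotropic U" "isotropic V" "U \<subseteq> perp V"
  shows "isotropic (subspace_sum U V)"
proof -
  have sub: "vec.subspace U" "vec.subspace V" using assms iso_subspace by auto
  have UV: "U \<subseteq> perp U" "V \<subseteq> perp V" "V \<subseteq> perp U"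
    using assms subset_perp_sym[of U V] by (auto simp: iso_iff)
  have "h (u + v) (u' + v') = 0" if "u \<in> U" "v \<in> V" "u' \<in> U" "v' \<in> V" for u v u' v'
  proof -
    have "h u u' = 0" "h u v' = 0" "h v u' = 0" "h v v' = 0"
      using that UV assms(3) by (auto simp: perp_def)
    then show ?thesis by (simp add: h_add_left h_add_right)
  qed
  then show ?thesis
    using subspace_subspace_sum[OF sub] unfolding totally_isotropic_def by (auto simp: subspace_sum_def)
qed

lemma maximals_over_pair:
  assumes "isotropic U" "isotropic V"
  shows "{z \<in> X. U \<subseteq> z \<and> V \<subseteq> z} = (if U \<subseteq> perp V then {z \<in> X. subspace_sum U V \<subseteq> z} else {})"
proof -
  have "U \<subseteq> z \<and> V \<subseteq> z \<longleftrightarrow> subspace_sum U V \<subseteq> z" if "z \<in> X" for z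
    using subspace_sum_subset_iff[of U V z] assms that by (simp add: iso_subspace maximal_subspace)
  moreover have "U \<subseteq> perp V" if "z \<in> X" "U \<subseteq> z" "V \<subseteq> z" for z
    using maximal_subset_perp[OF that(1)] perp_antimono[OF that(3)] that(2) by blast
  ultimately show ?thesis by auto
qed

lemma card_maximals_over_maximal:
  assumes "S \<in> X"
  shows "card {z \<in> X. S \<subseteq> z} = 1"
proof -
  have "z = S" if "z \<in> X" "S \<subseteq> z" for z
    using vec.subspace_dim_equal[of S z] that assms by (simp add: maximal_iff iso_subspace)
  then have "{z \<in> X. S \<subseteq> z} = {S}" using assms by auto
  then show ?thesis by simp
qed

text \<open>Both sides count flags \<open>W \<subseteq> V \<subseteq> T\<close> with
  \<open>W \<subseteq> x\<close>; the number of \<open>V\<close> over a given \<open>W\<close> does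
  not depend on \<open>W\<close>.\<close>

lemma sum_card_subs_swap:
  assumes T: "vec.subspace T" and x: "vec.subspace x" and m: "m' \<le> m"
  shows "(\<Sum>V\<in>subs m T. card (subs m' (V \<inter> x)))
    = card (subs m' (T \<inter> x)) * gauss_binomial CARD('k) (vec.dim T - m') (m - m')"
proof -
  have "(\<Sum>V\<in>subs m T. card (subs m' (V \<inter> x))) = (\<Sum>V\<in>subs m T. card {W \<in> subs m' (T \<inter> x). W \<subseteq> V})"
    by (intro sum.cong refl arg_cong[where f = card]) (auto simp: subs_def)
  also have "\<dots> = (\<Sum>W\<in>subs m' (T \<inter> x). card {V \<in> subs m T. W \<subseteq> V})"
    by (rule sum_card_swap) auto
  also have "\<dots> = (\<Sum>W\<in>subs m' (T \<inter> x). gauss_binomial CARD('k) (vec.dim T - m') (m - m'))"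
  proof (intro sum.cong refl)
    fix W assume "W \<in> subs m' (T \<inter> x)"
    then have W: "vec.subspace W" "W \<subseteq> T" "vec.dim W = m'" by (auto simp: subs_def)
    then have "vec.dim T = vec.dim W + (vec.dim T - m')" using vec.dim_subset[of W T] by simp
    from card_subspaces_between[OF W(1) T W(2) this, of "m - m'"] m W(3)
    show "card {V \<in> subs m T. W \<subseteq> V} = gauss_binomial CARD('k) (vec.dim T - m') (m - m')"
      by (simp add: subs_def conj_ac)
  qed
  finally show ?thesis by simp
qed

text \<open>For one hyperplane \<open>H\<close> of \<open>x\<close> there are three cases: if
  \<open>H\<close> is not orthogonal to \<open>W\<close>, nothing contains both; if
  \<open>W \<subseteq> H\<close>, all r^3 + 1 maximal subspaces over \<open>H\<close> qualify; if
  \<open>W\<close> is orthogonal to \<open>H\<close> but not inside it, \<open>H + W\<close> is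
  already maximal and is the only one. The two summands encode these cases.\<close>

lemma sum_card_maximals_over_hyperplane:
  assumes x: "x \<in> X" and W: "isotropic W" and d: "d > 0"
  shows "(\<Sum>H\<in>subs (d - 1) x. card {z \<in> X. H \<subseteq> z \<and> W \<subseteq> z})
    = card (subs (d - 1) (x \<inter> perp W)) + r ^ 3 * card {H \<in> subs (d - 1) x. W \<subseteq> H}"
proof -
  have "card {z \<in> X. H \<subseteq> z \<and> W \<subseteq> z} = of_bool (H \<subseteq> perp W) + r ^ 3 * of_bool (W \<subseteq> H)"
    if "H \<in> subs (d - 1) x" for H
  proof -
    have H: "isotropic H" "Suc (vec.dim H) = d"
      using that x d subs_isotropic[of x H] by (auto simp: subs_def maximal_iff)
    note sub = iso_subspace[OF H(1)] iso_subspace[OF W]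
    note pair = maximals_over_pair[OF H(1) W]
    consider "\<not> H \<subseteq> perp W" | "H \<subseteq> perp W" "W \<subseteq> H" | "H \<subseteq> perp W" "\<not> W \<subseteq> H" by blast
    then show ?thesis
    proof cases
      case 1
      then have "\<not> W \<subseteq> H" using H(1) perp_antimono[of W H] by (auto simp: iso_iff)
      then show ?thesis using 1 pair by simp
    next
      case 2
      then have "{z \<in> X. H \<subseteq> z \<and> W \<subseteq> z} = {z \<in> X. H \<subseteq> z}" by auto
      then show ?thesis using 2 card_maximals_over_hyperplane[OF H] by simp
    next
      case 3
      have sub_sum: "H \<subseteq> subspace_sum H W" "W \<subseteq> subspace_sum H W" "vec.subspace (subspace_sum H W)"
        using subspace_sum_subset_iff[OF sub, of "subspace_sum H W"] subspace_subspace_sum[OF sub] by auto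
      have "\<not> vec.dim (subspace_sum H W) \<le> vec.dim H"
        using vec.subspace_dim_equal[OF sub(1) sub_sum(3) sub_sum(1)] 3 sub_sum(2) by auto
      then have "subspace_sum H W \<in> X"
        using iso_subspace_sum[OF H(1) W 3(1)] iso_dim_le[of "subspace_sum H W"] H(2) by (simp add: maximal_iff)
      then show ?thesis using 3 pair card_maximals_over_maximal by simp
    qed
  qed
  then have "(\<Sum>H\<in>subs (d - 1) x. card {z \<in> X. H \<subseteq> z \<and> W \<subseteq> z})
      = (\<Sum>H\<in>subs (d - 1) x. of_bool (H \<subseteq> perp W) + r ^ 3 * of_bool (W \<subseteq> H))"
    by (intro sum.cong) auto
  also have "\<dots> = (\<Sum>H\<in>subs (d - 1) x. of_bool (H \<subseteq> perp W)) + r ^ 3 * (\<Sum>H\<in>subs (d - 1) x. of_bool (W \<subseteq> H))"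
    by (simp only: sum.distrib sum_distrib_left)
  also have "(\<Sum>H\<in>subs (d - 1) x. of_bool (H \<subseteq> perp W)) = card (subs (d - 1) (x \<inter> perp W))"
  proof -
    have "subs (d - 1) x \<inter> {H. H \<subseteq> perp W} = subs (d - 1) (x \<inter> perp W)" by (auto simp: subs_def)
    then show ?thesis by simp
  qed
  also have "(\<Sum>H\<in>subs (d - 1) x. of_bool (W \<subseteq> H)) = card {H \<in> subs (d - 1) x. W \<subseteq> H}"
    by (simp add: Int_def)
  finally show ?thesis .
qed

lemma card_hyperplanes_over:
  assumes x: "x \<in> X" and W: "vec.subspace W" and d: "d > 0"
  shows "card {H \<in> subs (d - 1) x. W \<subseteq> H} = (if W \<subseteq> x then qnum (d - vec.dim W) else 0)"
proof (cases "W \<subseteq> x")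
  case True
  have le: "vec.dim W \<le> d" using True x vec.dim_subset[of W x] by (simp add: maximal_iff)
  show ?thesis
  proof (cases "vec.dim W = d")
    case dW: True
    have "\<not> W \<subseteq> H" if "H \<in> subs (d - 1) x" for H
      using that vec.dim_subset[of W H] dW d by (auto simp: subs_def)
    then have "{H \<in> subs (d - 1) x. W \<subseteq> H} = {}" by blast
    then show ?thesis using dW by (simp only: qnum_def) simp
  next
    case False
    then obtain n where n: "d = Suc (vec.dim W + n)" using le by (metis le_neq_implies_less less_imp_Suc_add)
    have "{H \<in> subs (d - 1) x. W \<subseteq> H} = {V. vec.subspace V \<and> W \<subseteq> V \<and> V \<subseteq> x \<and> vec.dim V = vec.dim W + n}"
      using n by (auto simp: subs_def)
    then have "card {H \<in> subs (d - 1) x. W \<subseteq> H} = gauss_binomial CARD('k) (Suc n) n"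
      using card_subspaces_between[OF W maximal_subspace[OF x] True, of "Suc n" n] n x by (simp add: maximal_iff)
    then show ?thesis using True n gauss_binomial_pred[of "CARD('k)" n] by (simp add: qnum_def)
  qed
next
  case False
  then have "{H \<in> subs (d - 1) x. W \<subseteq> H} = {}" by (auto simp: subs_def)
  then show ?thesis using False by simp
qed

lemma gauss_binomial_hyperplane: "n > 0 \<Longrightarrow> gauss_binomial CARD('k) n (n - 1) = qnum n"
  using gauss_binomial_pred[of "CARD('k)" "n - 1"] by (simp add: qnum_def)

text \<open>With s = dim (W \<inter> x), the space \<open>x \<inter> perp W\<close> has codimension
  m - s in \<open>x\<close>, the same as that of \<open>W \<inter> x\<close> in \<open>W\<close>. So
  the two counts are \<open>qnum d\<close> and \<open>qnum m\<close> for s = m, both 1 for s = m -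
  1, and both 0 below. The case \<open>m = 0\<close> is set apart because the truncated
  \<open>m - 1\<close> would count the zero subspace.\<close>

lemma card_hyperplanes_perp:
  assumes x: "x \<in> X" and W: "isotropic W" "vec.dim W = m" and d: "d > 0"
  shows "card (subs (d - 1) (x \<inter> perp W)) + of_bool (W \<subseteq> x) * qnum m
    = (if m = 0 then 0 else card (subs (m - 1) (W \<inter> x))) + of_bool (W \<subseteq> x) * qnum d"
proof -
  have sW: "vec.subspace W" and sx: "vec.subspace x" using W x by (auto simp: iso_subspace maximal_subspace)
  define s where "s = vec.dim (W \<inter> x)"
  have dim: "vec.dim (x \<inter> perp W) + m = d + s"
    using dim_maximal_Int_perp[OF W(1) x] W(2) by (simp add: s_def)
  have 1: "card (subs (d - 1) (x \<inter> perp W)) = gauss_binomial CARD('k) (vec.dim (x \<inter> perp W)) (d - 1)"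
    by (intro card_subs vec.subspace_inter sx subspace_perp)
  have 2: "card (subs (m - 1) (W \<inter> x)) = gauss_binomial CARD('k) s (m - 1)"
    unfolding s_def by (intro card_subs vec.subspace_inter sx sW)
  have sm: "s \<le> m" using vec.dim_subset[of "W \<inter> x" W] W(2) by (simp add: s_def)
  have iff: "W \<subseteq> x \<longleftrightarrow> s = m"
  proof
    assume "W \<subseteq> x" then show "s = m" using W(2) by (simp add: s_def Int_absorb2)
  next
    assume "s = m"
    then have "W \<inter> x = W" using W(2) sW sx by (intro vec.subspace_dim_equal) (auto simp: s_def vec.subspace_inter)
    then show "W \<subseteq> x" by blast
  qed
  consider "s = m" | "Suc s = m" | "Suc (Suc s) \<le> m" using sm by linarith
  then show ?thesis
  proof cases
    case c: 1
    then have "vec.dim (x \<inter> perp W) = d" using dim by simp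
    then have "card (subs (d - 1) (x \<inter> perp W)) = qnum d" using 1 d gauss_binomial_hyperplane by simp
    moreover have "(if m = 0 then 0 else card (subs (m - 1) (W \<inter> x))) = qnum m"
      using 2 c gauss_binomial_hyperplane[of m] by (simp add: qnum_def)
    ultimately show ?thesis using c iff by simp
  next
    case c: 2
    then have "vec.dim (x \<inter> perp W) = d - 1" using dim by simp
    then show ?thesis using 1 2 c iff by auto
  next
    case c: 3
    then have "vec.dim (x \<inter> perp W) < d - 1" "s < m - 1" using dim d by auto
    then show ?thesis using 1 2 c iff gauss_binomial_eq_0 by auto
  qed
qed

lemma bmat_hyperplane_mult:
  assumes x: "x \<in> X" and y: "y \<in> X" and d: "d > 0" and m: "m \<le> d"
  shows "(\<Sum>z\<in>X. bmat (d - 1) x z * bmat m z y)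
    = lam m * bmat m x y + (if m = 0 then 0 else of_nat (qnum (d - (m - 1))) * bmat (m - 1) x y :: 'f::field)"
proof -
  have "(\<Sum>z\<in>X. bmat (d - 1) x z * bmat m z y)
      = (\<Sum>H\<in>subs (d - 1) x. \<Sum>V\<in>subs m y. of_nat (card {z \<in> X. H \<subseteq> z \<and> V \<subseteq> z}) :: 'f)"
    by (rule bmat_mult[OF x y])
  also have "\<dots> = (\<Sum>V\<in>subs m y. of_nat (\<Sum>H\<in>subs (d - 1) x. card {z \<in> X. H \<subseteq> z \<and> V \<subseteq> z}))"
    by (subst sum.swap) simp
  also have "\<dots> = (\<Sum>V\<in>subs m y. lam m * of_bool (V \<subseteq> x)
      + of_nat (if m = 0 then 0 else card (subs (m - 1) (V \<inter> x))))"
  proof (intro sum.cong refl)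
    fix V assume V: "V \<in> subs m y"
    have iV: "isotropic V" and dV: "vec.dim V = m" using V y subs_isotropic by (auto simp: maximal_iff subs_def)
    let ?a = "card (subs (d - 1) (x \<inter> perp V))" and ?b = "if m = 0 then 0 else card (subs (m - 1) (V \<inter> x))"
    have "of_nat ?a + of_bool (V \<subseteq> x) * of_nat (qnum m) = (of_nat ?b + of_bool (V \<subseteq> x) * of_nat (qnum d) :: 'f)"
      using arg_cong[OF card_hyperplanes_perp[OF x iV dV d], of "of_nat :: nat \<Rightarrow> 'f"]
      by (simp only: of_nat_add of_nat_mult of_nat_of_bool)
    then have a: "of_nat ?a = (of_nat ?b + of_bool (V \<subseteq> x) * (of_nat (qnum d) - of_nat (qnum m)) :: 'f)"
      by (cases "V \<subseteq> x") (simp_all add: algebra_simps)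
    have "card {H \<in> subs (d - 1) x. V \<subseteq> H} = of_bool (V \<subseteq> x) * qnum (d - m)"
      using card_hyperplanes_over[OF x iso_subspace[OF iV] d] dV by simp
    then have "of_nat (\<Sum>H\<in>subs (d - 1) x. card {z \<in> X. H \<subseteq> z \<and> V \<subseteq> z})
        = (of_nat ?a + of_nat r ^ 3 * (of_bool (V \<subseteq> x) * of_nat (qnum (d - m))) :: 'f)"
      unfolding sum_card_maximals_over_hyperplane[OF x iV d] by simp
    then show "of_nat (\<Sum>H\<in>subs (d - 1) x. card {z \<in> X. H \<subseteq> z \<and> V \<subseteq> z})
        = lam m * of_bool (V \<subseteq> x) + (of_nat ?b :: 'f)"
      unfolding a lam_def by (simp add: algebra_simps)
  qed
  also have "\<dots> = lam m * (\<Sum>V\<in>subs m y. of_bool (V \<subseteq> x))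
      + of_nat (\<Sum>V\<in>subs m y. if m = 0 then 0 else card (subs (m - 1) (V \<inter> x)))"
    by (simp only: sum.distrib sum_distrib_left of_nat_sum)
  also have "(\<Sum>V\<in>subs m y. of_bool (V \<subseteq> x)) = (bmat m x y :: 'f)"
    unfolding bmat_sym[of m x y] by (rule bmat_eq_sum[OF y x, symmetric])
  also have "of_nat (\<Sum>V\<in>subs m y. if m = 0 then 0 else card (subs (m - 1) (V \<inter> x)))
      = (if m = 0 then 0 else of_nat (qnum (d - (m - 1))) * bmat (m - 1) x y :: 'f)"
  proof (cases "m = 0")
    case False
    \<comment> \<open>The off-diagonal coefficient is the number of m-dimensional subspaces of
      \<open>y\<close> through a given one of dimension m - 1.\<close>
    have "(\<Sum>V\<in>subs m y. card (subs (m - 1) (V \<inter> x))) = card (subs (m - 1) (y \<inter> x)) * gauss_binomial CARD('k) (d - (m - 1)) 1"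
      using sum_card_subs_swap[OF maximal_subspace[OF y] maximal_subspace[OF x], of "m - 1" m] False y
      by (simp add: maximal_iff)
    then show ?thesis using False x y by (simp add: bmat_def Int_commute gauss_binomial_1 qnum_def)
  qed simp
  finally show ?thesis .
qed

section \<open>The multiplication law when r = -1 in F\<close>

lemma of_nat_card_maximals_over_pair:
  assumes U: "isotropic U" and V: "isotropic V" and r: "of_nat r = (- 1 :: 'f::field)"
  shows "of_nat (card {z \<in> X. U \<subseteq> z \<and> V \<subseteq> z}) = (of_bool (U \<subseteq> perp V \<and> vec.dim (subspace_sum U V) = d) :: 'f)"
proof (cases "U \<subseteq> perp V")
  case True
  note S = iso_subspace_sum[OF U V True]
  show ?thesis
  proof (cases "vec.dim (subspace_sum U V) = d")
    case dim: True
    then have "subspace_sum U V \<in> X" using S by (simp add: maximal_iff)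
    then show ?thesis using True dim maximals_over_pair[OF U V] card_maximals_over_maximal by simp
  next
    case False
    then have "vec.dim (subspace_sum U V) < d" using iso_dim_le[OF S] by simp
    from of_nat_card_maximals_over_eq_0[OF S this r]
    show ?thesis using True False maximals_over_pair[OF U V] by simp
  qed
next
  case False
  then show ?thesis by (simp only: maximals_over_pair[OF U V]) simp
qed

text \<open>Orthogonality to \<open>U\<close> puts \<open>V\<close> inside T = y \<inter> perp U,
  and the sum has dimension d exactly when \<open>V\<close> meets S = U \<inter> y in dimension j +
  k - d. Sorted by W = V \<inter> S, the \<open>V\<close> are the complements of S/W in T/W; each
  \<open>W\<close> contributes a power of q, which is 1 in F.\<close>

lemma of_nat_card_complementary:
  assumes U: "isotropic U" "vec.dim U = j" and y: "y \<in> X" and r: "of_nat r = (- 1 :: 'f::field)"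
    and jk: "d \<le> j + k"
  shows "of_nat (card {V \<in> subs k y. U \<subseteq> perp V \<and> vec.dim (subspace_sum U V) = d})
    = (of_nat (card (subs (j + k - d) (U \<inter> y))) :: 'f)"
proof -
  let ?m = "j + k - d" and ?T = "y \<inter> perp U" and ?S = "U \<inter> y"
  let ?C = "\<lambda>W. {V. vec.subspace V \<and> V \<subseteq> ?T \<and> V \<inter> ?S = W \<and> vec.dim V + vec.dim ?S = vec.dim ?T + vec.dim W}"
  have sU: "vec.subspace U" and sy: "vec.subspace y" using U y by (auto simp: iso_subspace maximal_subspace)
  have sub: "vec.subspace ?T" "vec.subspace ?S" using sU sy by (auto simp: vec.subspace_inter)
  have ST: "?S \<subseteq> ?T" using U by (auto simp: iso_iff)
  have dimT: "vec.dim ?T + j = d + vec.dim ?S" using dim_maximal_Int_perp[OF U(1) y] U(2) by simp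
  have "{V \<in> subs k y. U \<subseteq> perp V \<and> vec.dim (subspace_sum U V) = d} = (\<Union>W\<in>subs ?m ?S. ?C W)" (is "?L = ?R")
  proof (intro equalityI subsetI)
    fix V assume V: "V \<in> ?L"
    then have sV: "vec.subspace V" "V \<subseteq> y" "vec.dim V = k" by (auto simp: subs_def)
    have UV: "V \<inter> ?S = U \<inter> V" using sV by auto
    have "vec.dim (U \<inter> V) = ?m" using dim_subspace_sum[OF sU sV(1)] V U(2) sV by auto
    moreover have "V \<subseteq> ?T" using V sV subset_perp_sym[of U V] by auto
    ultimately have "V \<in> ?C (V \<inter> ?S)" "V \<inter> ?S \<in> subs ?m ?S"
      using sV UV dimT jk sub sU by (auto simp: subs_def vec.subspace_inter)
    then show "V \<in> ?R" by blast
  next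
    fix V assume "V \<in> ?R"
    then obtain W where W: "W \<in> subs ?m ?S" "V \<in> ?C W" by blast
    then have V: "vec.subspace V" "V \<subseteq> y" "U \<subseteq> perp V" using subset_perp_sym[of U V] by auto
    have "V \<inter> ?S = U \<inter> V" using V by auto
    then have dW: "vec.dim (U \<inter> V) = ?m" using W by (auto simp: subs_def)
    have "vec.dim V = k" using W dimT jk by (auto simp: subs_def)
    moreover from this have "vec.dim (subspace_sum U V) = d"
      using dim_subspace_sum[OF sU V(1)] dW U(2) jk by simp
    ultimately show "V \<in> ?L" using V by (auto simp: subs_def)
  qed
  then have "card ?L = (\<Sum>W\<in>subs ?m ?S. card (?C W))"
    by (simp only:) (intro card_UN_disjoint, auto)
  then have "of_nat (card ?L) = (\<Sum>W\<in>subs ?m ?S. of_nat (card (?C W)) :: 'f)" by simp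
  also have "\<dots> = (\<Sum>W\<in>subs ?m ?S. 1)"
  proof (intro sum.cong refl)
    fix W assume "W \<in> subs ?m ?S"
    then obtain e where "card (?C W) = CARD('k) ^ e"
      using card_complements[OF _ sub(2,1) _ ST, of W] by (auto simp: subs_def)
    then show "of_nat (card (?C W)) = (1 :: 'f)" by (simp add: card_k r)
  qed
  finally show ?thesis by simp
qed

theorem bmat_mult_divided_power:
  assumes x: "x \<in> X" and y: "y \<in> X" and r: "of_nat r = (- 1 :: 'f::field)" and jk: "j \<le> d" "k \<le> d"
  shows "(\<Sum>z\<in>X. bmat j x z * bmat k z y)
    = (if d \<le> j + k then of_nat ((d - j) + (d - k) choose (d - k)) * bmat (j + k - d) x y else 0 :: 'f)"
proof -
  have "(\<Sum>z\<in>X. bmat j x z * bmat k z y)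
      = (\<Sum>U\<in>subs j x. \<Sum>V\<in>subs k y. of_nat (card {z \<in> X. U \<subseteq> z \<and> V \<subseteq> z}) :: 'f)"
    by (rule bmat_mult[OF x y])
  also have "\<dots> = (\<Sum>U\<in>subs j x. \<Sum>V\<in>subs k y. of_bool (U \<subseteq> perp V \<and> vec.dim (subspace_sum U V) = d))"
    using x y subs_isotropic by (intro sum.cong refl of_nat_card_maximals_over_pair r) (auto simp: maximal_iff)
  also have "\<dots> = (\<Sum>U\<in>subs j x. of_nat (card {V \<in> subs k y. U \<subseteq> perp V \<and> vec.dim (subspace_sum U V) = d}))"
    by (simp add: Int_def)
  finally have eq: "(\<Sum>z\<in>X. bmat j x z * bmat k z y)
      = (\<Sum>U\<in>subs j x. of_nat (card {V \<in> subs k y. U \<subseteq> perp V \<and> vec.dim (subspace_sum U V) = d}) :: 'f)" .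
  show ?thesis
  proof (cases "d \<le> j + k")
    case True
    \<comment> \<open>Here \<open>d - ?m\<close> is \<open>(d - j) + (d - k)\<close> and
      \<open>j - ?m\<close> is \<open>d - k\<close>, the entries of the binomial in the
      statement.\<close>
    let ?m = "j + k - d"
    have "(\<Sum>U\<in>subs j x. of_nat (card {V \<in> subs k y. U \<subseteq> perp V \<and> vec.dim (subspace_sum U V) = d}) :: 'f)
        = of_nat (\<Sum>U\<in>subs j x. card (subs ?m (U \<inter> y)))"
      unfolding of_nat_sum
    proof (intro sum.cong refl of_nat_card_complementary y r True)
      fix U assume "U \<in> subs j x"
      then show "isotropic U" "vec.dim U = j" using x subs_isotropic by (auto simp: maximal_iff subs_def)
    qed
    also have "(\<Sum>U\<in>subs j x. card (subs ?m (U \<inter> y))) = card (subs ?m (x \<inter> y)) * gauss_binomial CARD('k) (d - ?m) (j - ?m)"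
      using sum_card_subs_swap[OF maximal_subspace[OF x] maximal_subspace[OF y], of ?m j] x jk
      by (simp add: maximal_iff)
    also have "of_nat \<dots> = (bmat ?m x y * of_nat (d - ?m choose (j - ?m)) :: 'f)"
      using x y r by (simp add: bmat_def of_nat_gauss_binomial_q_1 card_k)
    finally show ?thesis
      using eq True jk by (simp add: mult.commute)
  next
    case False
    have 0: "card {V \<in> subs k y. U \<subseteq> perp V \<and> vec.dim (subspace_sum U V) = d} = 0" if "U \<in> subs j x" for U
    proof -
      have "vec.dim (subspace_sum U V) \<noteq> d" if "V \<in> subs k y" for V
        using dim_subspace_sum[of U V] that \<open>U \<in> subs j x\<close> False by (auto simp: subs_def)
      then have "{V \<in> subs k y. U \<subseteq> perp V \<and> vec.dim (subspace_sum U V) = d} = {}" by blast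
      then show ?thesis by (simp only: card.empty)
    qed
    have "(\<Sum>U\<in>subs j x. of_nat (card {V \<in> subs k y. U \<subseteq> perp V \<and> vec.dim (subspace_sum U V) = d}) :: 'f)
        = (\<Sum>U\<in>subs j x. 0)"
      by (rule sum.cong[OF refl]) (simp only: 0 of_nat_0)
    then show ?thesis unfolding eq using False by simp
  qed
qed

end

section \<open>Local algebras\<close>

lemma (in cring) exists_maximalideal_containing:
  assumes J: "ideal J R" "\<one> \<notin> J"
  obtains I where "maximalideal I R" "J \<subseteq> I"
proof -
  let ?A = "{I. ideal I R \<and> J \<subseteq> I \<and> \<one> \<notin> I}"
  have "\<exists>M\<in>?A. \<forall>I\<in>?A. M \<subseteq> I \<longrightarrow> I = M"
  proof (rule subset_Zorn_nonempty)
    show "?A \<noteq> {}" using J by blast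
  next
    fix C assume C: "C \<noteq> {}" "subset.chain ?A C"
    then have CA: "C \<subseteq> ?A" and tot: "\<And>I I'. I \<in> C \<Longrightarrow> I' \<in> C \<Longrightarrow> I \<subseteq> I' \<or> I' \<subseteq> I"
      by (simp_all add: subset_chain_def)
    from CA have "C \<subseteq> {I. ideal I R}" by blast
    then have "subset.chain {I. ideal I R} C" using tot by (simp add: subset_chain_def)
    from chain_Union_is_ideal[OF this] have "ideal (\<Union>C) R" using C(1) by simp
    moreover obtain I where I: "I \<in> C" using C(1) by (meson ex_in_conv)
    have "J \<subseteq> \<Union>C" using subsetD[OF CA I] Union_upper[OF I] by (simp add: order.trans[of J I])
    moreover have "\<one> \<notin> I" if "I \<in> C" for I using subsetD[OF CA that] by simp
    then have "\<one> \<notin> \<Union>C" by (simp add: Union_iff)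
    ultimately show "\<Union>C \<in> ?A" by simp
  qed
  then obtain M where M: "M \<in> ?A" and max: "\<And>I. I \<in> ?A \<Longrightarrow> M \<subseteq> I \<Longrightarrow> I = M" by (elim bexE) simp
  then have M: "ideal M R" "J \<subseteq> M" "\<one> \<notin> M" by simp_all
  have "maximalideal M R"
  proof (rule maximalidealI[OF M(1)])
    show "carrier R \<noteq> M" using M one_closed by metis
    fix I assume I: "ideal I R" "M \<subseteq> I" "I \<subseteq> carrier R"
    show "I = M \<or> I = carrier R"
    proof (cases "\<one> \<in> I")
      case True
      then show ?thesis using ideal.one_imp_carrier[OF I(1)] by simp
    next
      case False
      then show ?thesis using max[of I] M(2) I(1,2) by simp
    qed
  qed
  then show ?thesis using that M(2) by simp
qed

text \<open>If \<open>y\<close> and \<open>u \<oplus> y\<close> were both non-units, the unique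
  maximal ideal would contain them and their difference \<open>u\<close>. The intended instance has
  C_1 - b for \<open>y\<close>, the scalar b - a for \<open>u\<close>, and hence C_1 - a for the
  sum.\<close>

lemma (in cring) local_nonunits:
  assumes loc: "\<exists>!I. maximalideal I R" and y: "y \<in> carrier R" and u: "u \<in> Units R"
    and nonunit: "u \<oplus> y \<notin> Units R"
  shows "y \<in> Units R"
proof (rule ccontr)
  assume ny: "y \<notin> Units R"
  have uc: "u \<in> carrier R" using u by (rule Units_closed)
  have contain: "\<exists>I. maximalideal I R \<and> x \<in> I" if x: "x \<in> carrier R" "x \<notin> Units R" for x
  proof -
    have "\<one> \<notin> PIdl x"
    proof
      assume "\<one> \<in> PIdl x"
      then obtain k where k: "k \<in> carrier R" "\<one> = k \<otimes> x" by (auto simp: cgenideal_def)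
      have "\<exists>k\<in>carrier R. k \<otimes> x = \<one> \<and> x \<otimes> k = \<one>"
        using k m_comm[OF k(1) x(1)] by (intro bexI[of _ k]) simp_all
      then show False using x by (simp add: Units_def)
    qed
    then obtain I where I: "maximalideal I R" "PIdl x \<subseteq> I"
      by (rule exists_maximalideal_containing[OF cgenideal_ideal[OF x(1)]])
    show ?thesis using I(1) subsetD[OF I(2) cgenideal_self[OF x(1)]] by (intro exI[of _ I] conjI)
  qed
  obtain I where I: "maximalideal I R" "y \<in> I" using contain[OF y ny] by (elim exE conjE)
  obtain I' where I': "maximalideal I' R" "u \<oplus> y \<in> I'"
    using contain[OF a_closed[OF uc y] nonunit] by (elim exE conjE)
  have [simp]: "I' = I" using ex1_implies_ex loc I(1) I'(1) by (metis)
  interpret I: maximalideal I R by (rule I(1))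
  have "(u \<oplus> y) \<oplus> (\<ominus> y) \<in> I"
    using I(2) I'(2) by (intro I.a_closed[OF _ I.a_inv_closed]) simp_all
  moreover have "(u \<oplus> y) \<oplus> (\<ominus> y) = u" using y uc by (simp add: a_assoc r_neg)
  ultimately have "inv u \<otimes> u \<in> I" using u by (intro I.I_l_closed) auto
  then have "\<one> \<in> I" using u by simp
  then show False using I.one_imp_carrier I.I_notcarr by simp
qed

text \<open>The left side of the first equation is R^2 times that of the second, so R^4 = 1. The
  first equation says that the odd power R^(2d+1) is -1, and modulo R^4 = 1 an odd power of R is R
  or its inverse.\<close>

lemma eq_minus_one_if_powers:
  fixes R :: "'f::field"
  assumes d: "d \<ge> 2" and 1: "(R\<^sup>2) ^ (d - 1) * R ^ 3 = - 1" and 2: "(R\<^sup>2) ^ (d - 2) * R ^ 3 = - (R\<^sup>2)"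
  shows "R = - 1"
proof -
  obtain e where e: "d = e + 2" using d by (metis le_add_diff_inverse2)
  have "(R\<^sup>2) ^ (d - 1) * R ^ 3 = R\<^sup>2 * ((R\<^sup>2) ^ (d - 2) * R ^ 3)" by (simp add: e)
  then have "- 1 = R\<^sup>2 * - (R\<^sup>2)" by (simp only: 1 2)
  then have R4: "R ^ 4 = 1" by (simp flip: power_add)
  have "2 * e + 5 = 2 * (d - 1) + 3" by (simp add: e)
  then have R5: "R ^ (2 * e + 5) = - 1" by (simp only: power_add power_mult 1)
  show ?thesis
  proof (cases "even e")
    case True
    then obtain f where f: "e = 2 * f" by blast
    have "2 * e + 5 = 4 * (f + 1) + 1" by (simp add: f)
    then have "R ^ (2 * e + 5) = (R ^ 4) ^ (f + 1) * R" by (simp only: power_add power_mult power_one_right)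
    then show ?thesis using R4 R5 by simp
  next
    case False
    then obtain f where f: "e = 2 * f + 1" by (rule oddE)
    have "2 * e + 5 + 1 = 4 * (f + 2)" by (simp add: f)
    then have "R ^ (2 * e + 5) * R = (R ^ 4) ^ (f + 2)" by (metis power_add power_mult power_one_right)
    then have "- R = 1" using R4 R5 by simp
    then show ?thesis by (metis minus_minus)
  qed
qed

section \<open>The adjacency algebra as functions of the intersection dimension\<close>

context hermitian_space
begin

text \<open>The general element of the adjacency algebra, with coefficients indexed by s = dim (x
  \<inter> y) instead of the relation index i = d - s, since subspace counts depend on s. Only the
  values of \<open>c\<close> up to \<open>d\<close> matter.\<close>

definition dist_mat :: "(nat \<Rightarrow> 'f::field) \<Rightarrow> ('k ^ 'n) set \<Rightarrow> ('k ^ 'n) set \<Rightarrow> 'f" where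
  "dist_mat c x y = (if x \<in> X \<and> y \<in> X then c (vec.dim (x \<inter> y)) else 0)"

lemma dim_maximal_Int_le: "x \<in> X \<Longrightarrow> vec.dim (x \<inter> y) \<le> d"
  using vec.dim_subset[of "x \<inter> y" x] by (simp add: maximal_iff)

lemma carrier_dual_polar_algebra:
  "carrier (dual_polar_algebra h d) = range (dist_mat :: (nat \<Rightarrow> 'f::field) \<Rightarrow> _)"
proof -
  have eq: "(\<Sum>i\<le>d. c i * adjacency_matrix (dual_polar_rel h d) i x y) = dist_mat (\<lambda>s. c (d - s)) x y"
    for c :: "nat \<Rightarrow> 'f" and x y
  proof (cases "x \<in> X \<and> y \<in> X")
    case True
    have "(\<Sum>i\<le>d. c i * adjacency_matrix (dual_polar_rel h d) i x y)
        = (\<Sum>i\<le>d. if i = d - vec.dim (x \<inter> y) then c i else 0)"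
      using True dim_maximal_Int_le[of x y]
      by (intro sum.cong refl) (auto simp: adjacency_matrix_def dual_polar_rel_def)
    then show ?thesis using True by (simp add: dist_mat_def)
  next
    case False
    then show ?thesis by (auto simp: dist_mat_def adjacency_matrix_def dual_polar_rel_def)
  qed
  have eq': "dist_mat c = (\<lambda>x y. \<Sum>i\<le>d. c (d - i) * adjacency_matrix (dual_polar_rel h d) i x y)"
    for c :: "nat \<Rightarrow> 'f"
    unfolding eq by (intro ext) (auto simp: dist_mat_def dim_maximal_Int_le)
  show ?thesis
    unfolding dual_polar_algebra_def adjacency_algebra_def using eq eq' by (fastforce simp: image_iff)
qed

lemma dual_polar_algebra_simps [simp]:
  fixes M N :: "('k ^ 'n) set \<Rightarrow> ('k ^ 'n) set \<Rightarrow> 'f::field"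
  shows "M \<otimes>\<^bsub>dual_polar_algebra h d\<^esub> N = (\<lambda>x y. \<Sum>z\<in>X. M x z * N z y)"
    and "M \<oplus>\<^bsub>dual_polar_algebra h d\<^esub> N = (\<lambda>x y. M x y + N x y)"
    and "\<zero>\<^bsub>dual_polar_algebra h d\<^esub> = (\<lambda>x y. 0 :: 'f)"
    and "c \<odot>\<^bsub>dual_polar_algebra h d\<^esub> M = (\<lambda>x y. c * M x y)"
  by (simp_all add: dual_polar_algebra_def adjacency_algebra_def)

lemma bmat_eq_dist_mat: "bmat j = dist_mat (\<lambda>s. of_nat (gauss_binomial CARD('k) s j))"
  by (intro ext) (auto simp: dist_mat_def bmat_gauss_binomial, simp_all add: bmat_def)

lemma bmat_d_eq_one: "bmat d = \<one>\<^bsub>dual_polar_algebra h d\<^esub>"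
proof (intro ext)
  fix x y :: "('k ^ 'n) set"
  have "vec.dim (x \<inter> y) = d \<longleftrightarrow> x = y" if "x \<in> X" "y \<in> X"
  proof
    assume "vec.dim (x \<inter> y) = d"
    then have "x \<inter> y = x" "x \<inter> y = y"
      using that by (intro vec.subspace_dim_equal; simp add: maximal_iff maximal_subspace vec.subspace_inter iso_subspace)+
    then show "x = y" by simp
  qed (use that in \<open>auto simp: maximal_iff\<close>)
  moreover have "vec.dim (x \<inter> y) < d" if "x \<in> X" "y \<in> X" "vec.dim (x \<inter> y) \<noteq> d"
    using dim_maximal_Int_le[of x y] that by simp
  ultimately show "bmat d x y = \<one>\<^bsub>dual_polar_algebra h d\<^esub> x y"
    by (auto simp: bmat_eq_dist_mat dist_mat_def dual_polar_algebra_def adjacency_algebra_def gauss_binomial_eq_0)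
qed

lemma bmat_d_mult:
  assumes "x \<in> X" "y \<in> X"
  shows "(\<Sum>z\<in>X. bmat d x z * M z y) = (M x y :: 'f::field)"
proof -
  have "(\<Sum>z\<in>X. bmat d x z * M z y) = (\<Sum>z\<in>X. if z = x then M z y else 0)"
    using assms by (intro sum.cong refl)
      (auto simp: bmat_d_eq_one dual_polar_algebra_def adjacency_algebra_def)
  then show ?thesis using assms by simp
qed

lemma dist_mat_mem [simp]: "dist_mat c \<in> carrier (dual_polar_algebra h d)"
  by (simp add: carrier_dual_polar_algebra)

lemma dist_mat_eq_iff: "dist_mat c = dist_mat c' \<longleftrightarrow> (\<forall>s\<le>d. c s = c' s)"
proof
  assume eq: "dist_mat c = dist_mat c'"
  show "\<forall>s\<le>d. c s = c' s"
  proof (intro allI impI)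
    fix s assume "s \<le> d"
    then obtain x y where "x \<in> X" "y \<in> X" "vec.dim (x \<inter> y) = s"
      using exists_maximals_at_distance[of "d - s"] by auto
    then show "c s = c' s" using fun_cong[OF fun_cong[OF eq, of x], of y] by (simp add: dist_mat_def)
  qed
qed (auto simp: dist_mat_def fun_eq_iff dim_maximal_Int_le)

text \<open>The ring axioms, closure under multiplication included, are part of
  \<open>maximalideal\<close> and come with the ideal that locality provides. Commutativity holds
  because every matrix in the algebra is symmetric: MN is its own transpose, which is NM.\<close>

lemma cring_dual_polar_algebra:
  assumes "local_algebra (dual_polar_algebra h d :: ('f::field, _) module)"
  shows "cring (dual_polar_algebra h d :: ('f, _) module)"
proof -
  let ?A = "dual_polar_algebra h d :: ('f, _) module"
  obtain I where "maximalideal I ?A" using assms by (auto simp: local_algebra_def)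
  then interpret I: maximalideal I ?A .
  have sym: "M x y = M y x" if "M \<in> carrier ?A" for M x y
    using that by (auto simp: carrier_dual_polar_algebra dist_mat_def Int_commute)
  have "M \<otimes>\<^bsub>?A\<^esub> N = N \<otimes>\<^bsub>?A\<^esub> M" if M: "M \<in> carrier ?A" and N: "N \<in> carrier ?A" for M N
  proof (intro ext)
    fix x y
    have "(M \<otimes>\<^bsub>?A\<^esub> N) x y = (M \<otimes>\<^bsub>?A\<^esub> N) y x" using sym[OF I.m_closed[OF M N]] .
    also have "\<dots> = (N \<otimes>\<^bsub>?A\<^esub> M) x y" by (simp add: sym[OF M, of y] sym[OF N, of _ x] mult.commute)
    finally show "(M \<otimes>\<^bsub>?A\<^esub> N) x y = (N \<otimes>\<^bsub>?A\<^esub> M) x y" .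
  qed
  then show ?thesis
    by (intro cring.intro comm_monoid.intro comm_monoid_axioms.intro I.ring_axioms I.monoid_axioms) auto
qed

text \<open>A nonzero matrix in the algebra annihilated by C_1 - a shows that C_1 - a is a non-unit,
  and likewise for b. Their difference is the scalar b - a, a unit if a and b differ.\<close>

lemma local_eigenvalues_eq:
  fixes a b :: "'f::field" and c c' :: "nat \<Rightarrow> 'f"
  assumes loc: "local_algebra (dual_polar_algebra h d :: ('f::field, _) module)"
    and a: "\<And>x y. x \<in> X \<Longrightarrow> y \<in> X \<Longrightarrow> (\<Sum>z\<in>X. bmat (d - 1) x z * dist_mat c z y) = a * dist_mat c x y"
    and b: "\<And>x y. x \<in> X \<Longrightarrow> y \<in> X \<Longrightarrow> (\<Sum>z\<in>X. bmat (d - 1) x z * dist_mat c' z y) = b * dist_mat c' x y"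
    and c: "s \<le> d" "c s \<noteq> 0" and c': "s' \<le> d" "c' s' \<noteq> 0"
  shows "a = b"
proof (rule ccontr)
  assume ab: "a \<noteq> b"
  let ?A = "dual_polar_algebra h d :: ('f, _) module"
  interpret cring ?A by (rule cring_dual_polar_algebra[OF loc])
  \<comment> \<open>C_1 - e times the identity; \<open>bmat d\<close> is the identity.\<close>
  define Z where "Z e = dist_mat (\<lambda>s. of_nat (gauss_binomial CARD('k) s (d - 1)) - e * of_nat (gauss_binomial CARD('k) s d) :: 'f)" for e
  have Z_apply: "Z e x y = bmat (d - 1) x y - e * bmat d x y" for e x y
    by (simp add: Z_def bmat_eq_dist_mat dist_mat_def)
  have Zc: "Z e \<in> carrier ?A" for e by (simp add: Z_def)
  have nonunit: "Z e \<notin> Units ?A"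
    if ev: "\<And>x y. x \<in> X \<Longrightarrow> y \<in> X \<Longrightarrow> (\<Sum>z\<in>X. bmat (d - 1) x z * dist_mat c z y) = e * dist_mat c x y"
      and c: "s \<le> d" "c s \<noteq> 0" for e c s
  proof
    assume u: "Z e \<in> Units ?A"
    have "Z e \<otimes>\<^bsub>?A\<^esub> dist_mat c = \<zero>\<^bsub>?A\<^esub>"
    proof (intro ext)
      fix x y
      show "(Z e \<otimes>\<^bsub>?A\<^esub> dist_mat c) x y = \<zero>\<^bsub>?A\<^esub> x y"
      proof (cases "x \<in> X \<and> y \<in> X")
        case True
        have "(Z e \<otimes>\<^bsub>?A\<^esub> dist_mat c) x y
          = (\<Sum>z\<in>X. bmat (d - 1) x z * dist_mat c z y) - e * (\<Sum>z\<in>X. bmat d x z * dist_mat c z y)"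
          by (simp add: Z_apply algebra_simps sum_subtractf sum_distrib_left)
        then show ?thesis using True ev[of x y] bmat_d_mult[of x y "dist_mat c"] by simp
      next
        case False
        then show ?thesis by (auto simp: Z_def dist_mat_def intro!: sum.neutral)
      qed
    qed
    then have "inv\<^bsub>?A\<^esub> (Z e) \<otimes>\<^bsub>?A\<^esub> (Z e \<otimes>\<^bsub>?A\<^esub> dist_mat c) = \<zero>\<^bsub>?A\<^esub>"
      using u by (simp only: r_null Units_inv_closed)
    then have "dist_mat c = \<zero>\<^bsub>?A\<^esub>"
      using u by (metis Units_inv_closed Units_closed Units_l_inv dist_mat_mem l_one m_assoc)
    also have "\<dots> = dist_mat (\<lambda>_. 0)" by (simp add: dist_mat_def fun_eq_iff)
    finally show False using c by (simp add: dist_mat_eq_iff)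
  qed
  \<comment> \<open>The scalar matrices, as members of the algebra; \<open>u (b - a)\<close> is
    inverted by \<open>u (inverse (b - a))\<close>.\<close>
  define u where "u e = dist_mat (\<lambda>s. e * of_nat (gauss_binomial CARD('k) s d) :: 'f)" for e
  have u_apply: "u e = (\<lambda>x y. e * bmat d x y)" for e
    by (simp add: u_def bmat_eq_dist_mat dist_mat_def fun_eq_iff)
  have uu: "u e \<otimes>\<^bsub>?A\<^esub> u f = u (e * f)" for e f
  proof (intro ext)
    fix x y
    show "(u e \<otimes>\<^bsub>?A\<^esub> u f) x y = u (e * f) x y"
    proof (cases "x \<in> X \<and> y \<in> X")
      case True
      have "(u e \<otimes>\<^bsub>?A\<^esub> u f) x y = e * f * (\<Sum>z\<in>X. bmat d x z * bmat d z y)"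
        by (simp add: u_apply sum_distrib_left algebra_simps)
      then show ?thesis using True bmat_d_mult[of x y "bmat d :: _ \<Rightarrow> _ \<Rightarrow> 'f"] by (simp add: u_apply)
    next
      case False
      then show ?thesis by (auto simp: u_def dist_mat_def intro!: sum.neutral)
    qed
  qed
  have "u 1 = \<one>\<^bsub>?A\<^esub>" by (simp add: u_apply flip: bmat_d_eq_one)
  then have "u (b - a) \<in> Units ?A"
    using uu[of "b - a" "inverse (b - a)"] uu[of "inverse (b - a)" "b - a"] ab
    unfolding Units_def by (auto simp: u_def intro!: bexI[of _ "u (inverse (b - a))"] simp del: dual_polar_algebra_simps)
  moreover have "u (b - a) \<oplus>\<^bsub>?A\<^esub> Z b = Z a"
    by (simp add: u_apply Z_apply algebra_simps fun_eq_iff)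
  ultimately have "Z b \<in> Units ?A"
    using local_nonunits[OF _ Zc, of "u (b - a)" b] loc nonunit[OF a c] by (simp add: local_algebra_def)
  then show False using nonunit[OF b c'] by simp
qed

end

text \<open>For Gaussian binomials \<open>g s j\<close> this is the passage from distance matrices
  to the C_i. Solvability gives the spanning property, and uniqueness below gives linear
  independence.\<close>

lemma triangular_solve:
  fixes g :: "nat \<Rightarrow> nat \<Rightarrow> 'f::field"
  assumes "\<And>s. g s s = 1" "\<And>s j. s < j \<Longrightarrow> g s j = 0"
  shows "\<exists>a. \<forall>s<n. c s = (\<Sum>j<n. a j * g s j)"
proof (induction n)
  case (Suc n)
  then obtain a where a: "\<And>s. s < n \<Longrightarrow> c s = (\<Sum>j<n. a j * g s j)" by blast
  \<comment> \<open>The new coefficient settles equation \<open>n\<close>; the earlier equations do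
    not involve it because \<open>g s n = 0\<close> for \<open>s < n\<close>.\<close>
  let ?a = "a(n := c n - (\<Sum>j<n. a j * g n j))"
  have "c s = (\<Sum>j<Suc n. ?a j * g s j)" if "s < Suc n" for s
  proof (cases "s = n")
    case False
    then show ?thesis using that a[of s] assms(2)[of s n] by simp
  qed (simp add: assms(1))
  then show ?case by blast
qed simp

lemma triangular_unique:
  fixes g :: "nat \<Rightarrow> nat \<Rightarrow> 'f::field"
  assumes "\<And>s. g s s = 1" "\<And>s j. s < j \<Longrightarrow> g s j = 0"
    and "\<And>s. s < n \<Longrightarrow> (\<Sum>j<n. a j * g s j) = 0" "s < n"
  shows "a s = 0"
  using assms(4)
proof (induction s rule: less_induct)
  case (less s)
  have "(\<Sum>j<n. a j * g s j) = (\<Sum>j<n. if j = s then a s else 0)"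
  proof (intro sum.cong refl)
    fix j assume "j \<in> {..<n}"
    then show "a j * g s j = (if j = s then a s else 0)"
      using less.IH[of j] assms(1,2) by (cases j s rule: linorder_cases) auto
  qed
  then show ?case using assms(3)[OF less.prems] less.prems by simp
qed

section \<open>Equality of the eigenvalues and the value of r in F\<close>

context hermitian_space
begin

lemma qnum_Suc: "qnum (Suc n) = qnum n + CARD('k) ^ n"
  by (simp add: qnum_def)

text \<open>\<open>bmat 0\<close> is an eigenvector for \<open>lam 0\<close>. If the entries
  differed, \<open>bmat 1 + \<alpha> bmat 0\<close> would be an eigenvector for
  \<open>lam 1\<close>, with \<alpha> determined by \<alpha> (lam 1 - lam 0) = qnum d.\<close>

lemma local_lam_0_eq_lam_1:
  assumes loc: "local_algebra (dual_polar_algebra h d :: ('f::field, _) module)" and d: "d > 0"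
  shows "lam 0 = (lam 1 :: 'f)"
proof (rule ccontr)
  assume neq: "lam 0 \<noteq> (lam 1 :: 'f)"
  let ?g = "\<lambda>s j. of_nat (gauss_binomial CARD('k) s j) :: 'f"
  define \<alpha> :: 'f where "\<alpha> = of_nat (qnum d) / (lam 1 - lam 0)"
  have \<alpha>: "of_nat (qnum d) = \<alpha> * (lam 1 - lam 0)" using neq by (simp add: \<alpha>_def)
  define c where "c s = ?g s 1 + \<alpha> * ?g s 0" for s
  have c: "dist_mat c x y = bmat 1 x y + \<alpha> * bmat 0 x y" for x y
    by (simp add: c_def bmat_eq_dist_mat dist_mat_def)
  have "\<exists>s\<le>d. c s \<noteq> 0"
  proof (cases "\<alpha> = 0")
    case True
    then show ?thesis using d by (intro exI[of _ 1]) (simp add: c_def)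
  qed (auto simp: c_def intro!: exI[of _ 0])
  then obtain s where s: "s \<le> d" "c s \<noteq> 0" by blast
  have "lam 0 = (lam 1 :: 'f)"
  proof (rule local_eigenvalues_eq[OF loc, of "\<lambda>s. ?g s 0" _ c _ 0 s])
    fix x y assume xy: "x \<in> X" "y \<in> X"
    show "(\<Sum>z\<in>X. bmat (d - 1) x z * dist_mat (\<lambda>s. ?g s 0) z y) = lam 0 * dist_mat (\<lambda>s. ?g s 0) x y"
      using bmat_hyperplane_mult[OF xy d, of 0, where ?'f = 'f] by (simp add: bmat_eq_dist_mat[of 0])
    have "(\<Sum>z\<in>X. bmat (d - 1) x z * dist_mat c z y)
      = (\<Sum>z\<in>X. bmat (d - 1) x z * bmat 1 z y) + \<alpha> * (\<Sum>z\<in>X. bmat (d - 1) x z * bmat 0 z y)"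
      by (simp add: c algebra_simps sum.distrib sum_distrib_left)
    also have "\<dots> = lam 1 * dist_mat c x y"
      using bmat_hyperplane_mult[OF xy d, of 0, where ?'f = 'f] bmat_hyperplane_mult[OF xy d, of 1, where ?'f = 'f] d
      by (simp add: c \<alpha> algebra_simps)
    finally show "(\<Sum>z\<in>X. bmat (d - 1) x z * dist_mat c z y) = lam 1 * dist_mat c x y" .
  qed (use s in auto)
  with neq show False ..
qed

text \<open>The same back substitution one row further. As \<open>lam 1 = lam 0\<close> is already
  known, both corrections \<alpha> and \<beta> divide by \<open>lam 2 - lam 0\<close> alone.\<close>

lemma local_lam_0_eq_lam_2:
  assumes loc: "local_algebra (dual_polar_algebra h d :: ('f::field, _) module)" and d: "d \<ge> 2"
  shows "lam 0 = (lam 2 :: 'f)"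
proof (rule ccontr)
  assume neq: "lam 0 \<noteq> (lam 2 :: 'f)"
  have d0: "d > 0" using d by simp
  have lam1: "lam 1 = (lam 0 :: 'f)" using local_lam_0_eq_lam_1[OF loc d0] by simp
  let ?g = "\<lambda>s j. of_nat (gauss_binomial CARD('k) s j) :: 'f"
  define \<alpha> :: 'f where "\<alpha> = of_nat (qnum (d - 1)) / (lam 2 - lam 0)"
  define \<beta> :: 'f where "\<beta> = \<alpha> * of_nat (qnum d) / (lam 2 - lam 0)"
  have \<alpha>: "of_nat (qnum (d - 1)) = \<alpha> * (lam 2 - lam 0)" using neq by (simp add: \<alpha>_def)
  have \<beta>: "\<alpha> * of_nat (qnum d) = \<beta> * (lam 2 - lam 0)" using neq by (simp add: \<beta>_def)
  define c where "c s = ?g s 2 + \<alpha> * ?g s 1 + \<beta> * ?g s 0" for s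
  have c: "dist_mat c x y = bmat 2 x y + \<alpha> * bmat 1 x y + \<beta> * bmat 0 x y" for x y
    by (simp add: c_def bmat_eq_dist_mat dist_mat_def)
  \<comment> \<open>By triangularity \<open>c 0 = \<beta>\<close>; if this is 0 then
    \<open>c 1 = \<alpha>\<close>, and if both are 0 then \<open>c 2 = 1\<close>.\<close>
  have "\<exists>s\<le>d. c s \<noteq> 0"
  proof (cases "\<beta> = 0")
    case True
    show ?thesis
    proof (cases "\<alpha> = 0")
      case \<alpha>0: True
      have "c 2 = 1" using True \<alpha>0 by (simp add: c_def)
      then show ?thesis using d by (intro exI[of _ 2]) simp
    next
      case False
      have "gauss_binomial CARD('k) 1 2 = 0" by (rule gauss_binomial_eq_0) simp
      then have "c 1 = \<alpha>" using True by (simp add: c_def)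
      then show ?thesis using False d by (intro exI[of _ 1]) simp
    qed
  next
    case False
    have "c 0 = \<beta>" using gauss_binomial_eq_0[of 0 2] by (simp add: c_def)
    then show ?thesis using False by (intro exI[of _ 0]) simp
  qed
  then obtain s where s: "s \<le> d" "c s \<noteq> 0" by blast
  have "lam 0 = (lam 2 :: 'f)"
  proof (rule local_eigenvalues_eq[OF loc, of "\<lambda>s. ?g s 0" _ c _ 0 s])
    fix x y assume xy: "x \<in> X" "y \<in> X"
    show "(\<Sum>z\<in>X. bmat (d - 1) x z * dist_mat (\<lambda>s. ?g s 0) z y) = lam 0 * dist_mat (\<lambda>s. ?g s 0) x y"
      using bmat_hyperplane_mult[OF xy d0, of 0, where ?'f = 'f] by (simp add: bmat_eq_dist_mat[of 0])
    have "(\<Sum>z\<in>X. bmat (d - 1) x z * dist_mat c z y)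
      = (\<Sum>z\<in>X. bmat (d - 1) x z * bmat 2 z y) + \<alpha> * (\<Sum>z\<in>X. bmat (d - 1) x z * bmat 1 z y)
        + \<beta> * (\<Sum>z\<in>X. bmat (d - 1) x z * bmat 0 z y)"
      by (simp add: c algebra_simps sum.distrib sum_distrib_left)
    also have "(\<Sum>z\<in>X. bmat (d - 1) x z * bmat 2 z y) = (lam 2 * bmat 2 x y + of_nat (qnum (d - 1)) * bmat 1 x y :: 'f)"
      using bmat_hyperplane_mult[OF xy d0, of 2, where ?'f = 'f] d by simp
    also have "(\<Sum>z\<in>X. bmat (d - 1) x z * bmat 1 z y) = (lam 0 * bmat 1 x y + of_nat (qnum d) * bmat 0 x y :: 'f)"
      using bmat_hyperplane_mult[OF xy d0, of 1, where ?'f = 'f] d by (simp add: lam1[simplified])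
    also have "(\<Sum>z\<in>X. bmat (d - 1) x z * bmat 0 z y) = (lam 0 * bmat 0 x y :: 'f)"
      using bmat_hyperplane_mult[OF xy d0, of 0, where ?'f = 'f] d by simp
    also have "lam 2 * bmat 2 x y + of_nat (qnum (d - 1)) * bmat 1 x y
        + \<alpha> * (lam 0 * bmat 1 x y + of_nat (qnum d) * bmat 0 x y) + \<beta> * (lam 0 * bmat 0 x y)
      = lam 2 * bmat 2 x y + (of_nat (qnum (d - 1)) + \<alpha> * lam 0) * bmat 1 x y
        + (\<alpha> * of_nat (qnum d) + \<beta> * lam 0) * bmat 0 x y"
      by (simp add: algebra_simps)
    also have "\<dots> = lam 2 * dist_mat c x y"
      unfolding \<alpha> \<beta> c by (simp add: algebra_simps)
    finally show "(\<Sum>z\<in>X. bmat (d - 1) x z * dist_mat c z y) = lam 2 * dist_mat c x y" .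
  qed (use s in auto)
  with neq show False ..
qed

lemma local_imp_of_nat_r:
  assumes loc: "local_algebra (dual_polar_algebra h d :: ('f::field, _) module)" and d: "d \<ge> 2"
  shows "of_nat r = (- 1 :: 'f)"
proof (rule eq_minus_one_if_powers[OF d])
  let ?R = "of_nat r :: 'f"
  have q: "(of_nat CARD('k) :: 'f) = ?R\<^sup>2" by (simp add: card_k)
  obtain e where e: "d = Suc (Suc e)" using d by (metis add_2_eq_Suc le_Suc_ex)
  have l1: "lam 0 = (lam 1 :: 'f)" using local_lam_0_eq_lam_1[OF loc] d by simp
  have l2: "lam 1 = (lam 2 :: 'f)" using local_lam_0_eq_lam_2[OF loc d] l1 by simp
  have q0: "qnum 0 = 0" "qnum (Suc 0) = 1" "qnum 2 = 1 + CARD('k)"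
    by (simp_all add: qnum_def eval_nat_numeral)
  have "lam 0 - lam 1 = ((?R\<^sup>2) ^ (d - 1) * ?R ^ 3 + 1 :: 'f)"
    unfolding lam_def by (simp add: e qnum_Suc q0 q algebra_simps)
  then show "(?R\<^sup>2) ^ (d - 1) * ?R ^ 3 = - 1" using l1 by (simp add: eq_neg_iff_add_eq_0)
  have "lam 1 - lam 2 = ((?R\<^sup>2) ^ (d - 2) * ?R ^ 3 + ?R\<^sup>2 :: 'f)"
    unfolding lam_def by (simp add: e qnum_Suc q0 q algebra_simps)
  then show "(?R\<^sup>2) ^ (d - 2) * ?R ^ 3 = - (?R\<^sup>2)" using l2 by (simp add: eq_neg_iff_add_eq_0)
qed

text \<open>The C_i of the overview, continued by zero beyond \<open>d\<close> so that the divided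
  power law holds for all indices.\<close>

definition cmat :: "nat \<Rightarrow> ('k ^ 'n) set \<Rightarrow> ('k ^ 'n) set \<Rightarrow> 'f::field" where
  "cmat i = (if i \<le> d then bmat (d - i) else (\<lambda>x y. 0))"

lemma cmat_outside: "\<not> (x \<in> X \<and> y \<in> X) \<Longrightarrow> cmat i x y = 0"
  by (auto simp: cmat_def bmat_def)

lemma cmat_mult:
  assumes loc: "local_algebra (dual_polar_algebra h d :: ('f::field, _) module)" and d: "d > 0"
  shows "(\<Sum>z\<in>X. cmat i x z * cmat j z y) = (of_nat (i + j choose j) * cmat (i + j) x y :: 'f)"
proof (cases "x \<in> X \<and> y \<in> X")
  case False
  then show ?thesis by (auto simp: cmat_def bmat_def intro!: sum.neutral)
next
  case xy: True
  consider "i > d \<or> j > d" | "i \<le> d" "j \<le> d" "d = 1" | "i \<le> d" "j \<le> d" "d \<ge> 2" using d by linarith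
  then show ?thesis
  proof cases
    case 1
    then show ?thesis by (auto simp: cmat_def)
  next
    case 2
    have id: "(\<Sum>z\<in>X. bmat 1 x z * M z y) = M x y" for M :: "('k ^ 'n) set \<Rightarrow> ('k ^ 'n) set \<Rightarrow> 'f"
      using bmat_d_mult[of x y M] xy 2 by simp
    have "lam 1 = (0 :: 'f)" unfolding lam_def using 2 by (simp add: qnum_def)
    then have lam: "lam 0 = (0 :: 'f)" using local_lam_0_eq_lam_1[OF loc d] by simp
    have 00: "(\<Sum>z\<in>X. bmat 0 x z * bmat 0 z y) = (0 :: 'f)"
      using bmat_hyperplane_mult[of x y 0, where ?'f = 'f] xy 2 lam by simp
    have id': "(\<Sum>z\<in>X. bmat 0 x z * bmat 1 z y) = (bmat 0 x y :: 'f)"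
      using bmat_d_mult[of y x "bmat 0 :: _ \<Rightarrow> _ \<Rightarrow> 'f"] xy 2
      by (simp add: bmat_sym[of 0 x] bmat_sym[of "Suc 0" _ y] mult.commute)
    have c: "cmat 0 = (bmat (Suc 0) :: _ \<Rightarrow> _ \<Rightarrow> 'f)" "cmat (Suc 0) = (bmat 0 :: _ \<Rightarrow> _ \<Rightarrow> 'f)"
      "cmat (Suc (Suc 0)) = (\<lambda>x y. 0 :: 'f)"
      unfolding cmat_def using 2 by auto
    consider "i = 0" "j = 0" | "i = 0" "j = 1" | "i = 1" "j = 0" | "i = 1" "j = 1" using 2 by linarith
    then show ?thesis
    proof cases
      case 1 then show ?thesis using id[of "bmat 1"] c by simp
    next
      case 2 then show ?thesis using id[of "bmat 0"] c by simp
    next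
      case 3 then show ?thesis using id' c by simp
    next
      case 4 then show ?thesis using 00 c by simp
    qed
  next
    case 3
    have "(\<Sum>z\<in>X. bmat (d - i) x z * bmat (d - j) z y)
      = (if d \<le> (d - i) + (d - j) then of_nat ((d - (d - i)) + (d - (d - j)) choose (d - (d - j))) * bmat ((d - i) + (d - j) - d) x y else 0 :: 'f)"
      using xy local_imp_of_nat_r[OF loc 3(3)] by (intro bmat_mult_divided_power) auto
    moreover have "(d - i) + (d - j) - d = d - (i + j)" "d \<le> (d - i) + (d - j) \<longleftrightarrow> i + j \<le> d" using 3 by auto
    ultimately show ?thesis using 3 by (simp add: cmat_def)
  qed
qed

lemma sum_cmat:
  "(\<Sum>i\<le>d. a i * cmat i x y) = dist_mat (\<lambda>s. \<Sum>j<Suc d. a (d - j) * of_nat (gauss_binomial CARD('k) s j)) x (y :: ('k ^ 'n) set)"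
proof (cases "x \<in> X \<and> y \<in> X")
  case True
  have "(\<Sum>i\<le>d. a i * cmat i x y) = (\<Sum>j\<le>d. a (d - j) * cmat (d - j) x y)"
    by (rule sum.reindex_bij_witness[of _ "\<lambda>i. d - i" "\<lambda>i. d - i"]) auto
  also have "\<dots> = (\<Sum>j\<le>d. a (d - j) * of_nat (gauss_binomial CARD('k) (vec.dim (x \<inter> y)) j))"
    using True by (intro sum.cong) (auto simp: cmat_def bmat_gauss_binomial)
  finally show ?thesis using True by (simp add: dist_mat_def lessThan_Suc_atMost)
qed (auto simp: cmat_outside dist_mat_def)

lemma sum_cmat_mem: "(\<lambda>x y. \<Sum>i\<le>d. a i * cmat i x y) \<in> carrier (dual_polar_algebra h d)"
  unfolding sum_cmat by (rule dist_mat_mem)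

lemma carrier_eq_sum_cmat:
  assumes "M \<in> carrier (dual_polar_algebra h d :: ('f::field, _) module)"
  obtains a where "M = (\<lambda>x y. \<Sum>i\<le>d. a i * cmat i x y)"
proof -
  obtain c where c: "M = dist_mat c" using assms by (auto simp: carrier_dual_polar_algebra)
  obtain a where a: "\<And>s. s < Suc d \<Longrightarrow> c s = (\<Sum>j<Suc d. a j * of_nat (gauss_binomial CARD('k) s j))"
    using triangular_solve[of "\<lambda>s j. of_nat (gauss_binomial CARD('k) s j)" "Suc d" c]
    by (auto simp: gauss_binomial_eq_0 simp del: sum.lessThan_Suc)
  have "M = (\<lambda>x y. \<Sum>i\<le>d. a (d - i) * cmat i x y)"
    unfolding sum_cmat c dist_mat_eq_iff using a
    by (auto simp: less_Suc_eq_le simp del: sum.lessThan_Suc intro!: sum.cong)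
  then show ?thesis by (rule that)
qed

lemma sum_cmat_eq_0D:
  assumes "(\<lambda>x y. \<Sum>i\<le>d. a i * cmat i x y) = (\<lambda>x y. 0 :: 'f::field)" "i \<le> d"
  shows "a i = 0"
proof -
  have "dist_mat (\<lambda>s. \<Sum>j<Suc d. a (d - j) * of_nat (gauss_binomial CARD('k) s j)) = dist_mat (\<lambda>_. 0 :: 'f)"
    using assms(1) unfolding sum_cmat by (simp add: dist_mat_def fun_eq_iff del: sum.lessThan_Suc)
  then have "\<And>s. s < Suc d \<Longrightarrow> (\<Sum>j<Suc d. a (d - j) * of_nat (gauss_binomial CARD('k) s j)) = 0"
    by (simp add: dist_mat_eq_iff less_Suc_eq_le del: sum.lessThan_Suc)
  then have "a (d - (d - i)) = 0"
    using triangular_unique[where g = "\<lambda>s j. of_nat (gauss_binomial CARD('k) s j)" and a = "\<lambda>j. a (d - j)"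
        and n = "Suc d" and s = "d - i"]
    by (simp add: gauss_binomial_eq_0 del: sum.lessThan_Suc)
  then show ?thesis using assms(2) by simp
qed

end

section \<open>Multinomial coefficients of reduced monomials\<close>

lemma prime_dvd_choose_prime_power:
  fixes p :: nat
  assumes p: "prime p" and k: "0 < k" "k < p ^ n"
  shows "p dvd (p ^ n choose k)"
proof (rule ccontr)
  assume "\<not> p dvd (p ^ n choose k)"
  then have "coprime (p ^ n) (p ^ n choose k)" using p by (simp add: prime_imp_coprime)
  moreover have "k * (p ^ n choose k) = p ^ n * (p ^ n - 1 choose (k - 1))"
    using k by (intro times_binomial_minus1_eq) auto
  then have "p ^ n dvd k * (p ^ n choose k)" by simp
  ultimately have "p ^ n dvd k" by (simp add: coprime_dvd_mult_left_iff)
  then show False using k by (auto dest: dvd_imp_le)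
qed

text \<open>A case of Lucas's theorem. In the Vandermonde sum for P + m with P = p^j, all terms but
  the two outer ones vanish modulo p, so adding P to m raises the value by one.\<close>

lemma of_nat_choose_prime_power:
  assumes p: "prime p" "CHAR('f::comm_ring_1) = p"
  shows "of_nat (n choose p ^ j) = (of_nat (n div p ^ j) :: 'f)"
proof (induction n rule: less_induct)
  case (less n)
  let ?P = "p ^ j"
  have P: "?P > 0" using p(1) prime_gt_0_nat by simp
  show ?case
  proof (cases "n < ?P")
    case False
    then obtain m where m: "n = ?P + m" by (metis le_Suc_ex not_less)
    have "of_nat (n choose ?P) = (\<Sum>k\<le>?P. of_nat (?P choose k) * of_nat (m choose (?P - k)) :: 'f)"
      unfolding m vandermonde[symmetric] by simp
    also have "\<dots> = (\<Sum>k\<in>{0, ?P}. of_nat (?P choose k) * of_nat (m choose (?P - k)))"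
    proof (rule sum.mono_neutral_right)
      show "\<forall>k\<in>{..?P} - {0, ?P}. of_nat (?P choose k) * of_nat (m choose (?P - k)) = (0 :: 'f)"
      proof
        fix k assume "k \<in> {..?P} - {0, ?P}"
        then have "p dvd (?P choose k)" using p by (intro prime_dvd_choose_prime_power) auto
        then have "of_nat (?P choose k) = (0 :: 'f)" using p(2) by (simp add: of_nat_eq_0_iff_char_dvd)
        then show "of_nat (?P choose k) * of_nat (m choose (?P - k)) = (0 :: 'f)" by simp
      qed
    qed auto
    also have "\<dots> = of_nat (m choose ?P) + 1" using P by simp
    also have "\<dots> = of_nat (m div ?P) + 1" using less[of m] m P by simp
    also have "\<dots> = of_nat (n div ?P)" using P by (simp add: m)
    finally show ?thesis .
  qed (simp add: binomial_eq_0)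
qed

section \<open>Weights and base p digits\<close>

lemma weight_eq_sum:
  assumes "finite K" "Poly_Mapping.keys m \<subseteq> K"
  shows "weight p m = (\<Sum>j\<in>K. Poly_Mapping.lookup m j * p ^ j)"
  unfolding weight_def using assms by (intro sum.mono_neutral_left) (auto simp: in_keys_iff)

lemma weight_add: "weight p (m + m') = weight p m + weight p m'"
proof -
  let ?K = "Poly_Mapping.keys m \<union> Poly_Mapping.keys m'"
  have "Poly_Mapping.keys (m + m') \<subseteq> ?K" by (rule Poly_Mapping.keys_add)
  then show ?thesis
    using weight_eq_sum[of ?K "m + m'" p] weight_eq_sum[of ?K m p] weight_eq_sum[of ?K m' p]
    by (simp add: lookup_add sum.distrib algebra_simps)
qed

lemma weight_single [simp]: "weight p (Poly_Mapping.single j k) = k * p ^ j"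
  by (cases "k = 0") (simp_all add: weight_def)

lemma weight_0 [simp]: "weight p 0 = 0"
  by (simp add: weight_def)

text \<open>The exponents of a reduced monomial are the base p digits of its weight, so there is
  exactly one of each weight. Their classes are the monomial basis of the truncated polynomial
  algebra.\<close>

definition reduced :: "nat \<Rightarrow> (nat \<Rightarrow>\<^sub>0 nat) \<Rightarrow> bool" where
  "reduced p m \<longleftrightarrow> (\<forall>j. Poly_Mapping.lookup m j < p)"

lemma digit_of_sum:
  fixes l :: "nat \<Rightarrow> nat"
  assumes "\<And>i. l i < p"
  shows "(\<Sum>i<J. l i * p ^ i) div p ^ j mod p = (if j < J then l j else 0)"
  using assms
proof (induction J arbitrary: l j)
  case (Suc J)
  have p: "p > 0" using Suc.prems[of 0] by simp
  have eq: "(\<Sum>i<Suc J. l i * p ^ i) = l 0 + p * (\<Sum>i<J. l (Suc i) * p ^ i)"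
    unfolding sum.lessThan_Suc_shift by (simp add: sum_distrib_left algebra_simps)
  show ?case
  proof (cases j)
    case 0
    then show ?thesis unfolding eq using Suc.prems[of 0] by simp
  next
    case (Suc j')
    have "(\<Sum>i<Suc J. l i * p ^ i) div p ^ j = (\<Sum>i<J. l (Suc i) * p ^ i) div p ^ j'"
      unfolding eq using Suc.prems[of 0] p by (simp add: Suc div_mult2_eq)
    then show ?thesis using Suc.IH[of "\<lambda>i. l (Suc i)" j'] Suc.prems Suc by simp
  qed
qed simp

lemma reduced_digit:
  assumes "reduced p m"
  shows "weight p m div p ^ j mod p = Poly_Mapping.lookup m j"
proof -
  obtain J where J: "Poly_Mapping.keys m \<subseteq> {..<J}"
    using finite_nat_set_iff_bounded[of "Poly_Mapping.keys m"] by auto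
  then have "weight p m = (\<Sum>i<J. Poly_Mapping.lookup m i * p ^ i)" by (intro weight_eq_sum) auto
  moreover have "Poly_Mapping.lookup m j = 0" if "\<not> j < J" using J that by (auto simp: in_keys_iff)
  ultimately show ?thesis using digit_of_sum[of "Poly_Mapping.lookup m" p J j] assms by (auto simp: reduced_def)
qed

lemma reduced_weight_inj:
  assumes "reduced p m" "reduced p m'" "weight p m = weight p m'"
  shows "m = m'"
  using reduced_digit[OF assms(1)] reduced_digit[OF assms(2)] assms(3) by (intro poly_mapping_eqI) metis

lemma sum_digits:
  fixes n p :: nat
  shows "(\<Sum>i<J. (n div p ^ i mod p) * p ^ i) = n mod p ^ J"
proof (induction J)
  case (Suc J)
  have "n mod (p ^ J * p) = p ^ J * (n div p ^ J mod p) + n mod p ^ J" by (rule mod_mult2_eq)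
  then show ?case using Suc by (simp add: mult.commute)
qed simp

lemma exists_reduced_weight:
  assumes p: "p > 1"
  obtains m where "reduced p m" "weight p m = n"
proof -
  have large: "n < p ^ i" if "n \<le> i" for i
  proof -
    have "n < 2 ^ n" by (rule less_exp)
    also have "\<dots> \<le> p ^ n" using p by (intro power_mono) auto
    also have "\<dots> \<le> p ^ i" using p that by (intro power_increasing) auto
    finally show ?thesis .
  qed
  have zero: "n div p ^ i mod p = 0" if "\<not> i < n" for i
    using large[of i] that by simp
  have "{i. n div p ^ i mod p \<noteq> 0} \<subseteq> {..<n}"
  proof
    fix i assume "i \<in> {i. n div p ^ i mod p \<noteq> 0}"
    then show "i \<in> {..<n}" using zero[of i] by (cases "i < n") simp_all
  qed
  then have fin: "finite {i. n div p ^ i mod p \<noteq> 0}" by (rule finite_subset) simp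
  define m where "m = Abs_poly_mapping (\<lambda>i. n div p ^ i mod p)"
  have look: "Poly_Mapping.lookup m i = n div p ^ i mod p" for i
    using fin by (simp add: m_def)
  have "Poly_Mapping.keys m \<subseteq> {..<n}"
  proof
    fix i assume "i \<in> Poly_Mapping.keys m"
    then show "i \<in> {..<n}" using zero[of i] by (cases "i < n") (simp_all add: in_keys_iff look)
  qed
  then have "weight p m = (\<Sum>i<n. (n div p ^ i mod p) * p ^ i)"
    using weight_eq_sum[of "{..<n}" m p] by (simp add: look)
  also have "\<dots> = n" unfolding sum_digits using large[of n] by simp
  finally show ?thesis using that[of m] p by (simp add: reduced_def look)
qed

text \<open>
  The monomial \<open>m\<close> is to be sent to the corresponding product of the divided powers
  \<open>x ^ (p ^ j) / (p ^ j)!\<close>; \<open>kappa p m\<close> is the coefficient of that product with respect to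
  \<open>x ^ w / w!\<close>, \<open>w\<close> the weight of \<open>m\<close>.
\<close>

definition fact_prod :: "nat \<Rightarrow> (nat \<Rightarrow>\<^sub>0 nat) \<Rightarrow> nat" where
  "fact_prod p m = (\<Prod>j\<in>Poly_Mapping.keys m. fact (p ^ j) ^ Poly_Mapping.lookup m j)"

definition kappa :: "nat \<Rightarrow> (nat \<Rightarrow>\<^sub>0 nat) \<Rightarrow> nat" where
  "kappa p m = fact (weight p m) div fact_prod p m"

section \<open>The factorial quotients modulo p\<close>

lemma fact_prod_pos: "fact_prod p m > 0"
  by (simp add: fact_prod_def prod_pos)

lemma fact_prod_add: "fact_prod p (m + m') = fact_prod p m * fact_prod p m'"
proof -
  let ?K = "Poly_Mapping.keys m \<union> Poly_Mapping.keys m'"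
  have *: "fact_prod p m = (\<Prod>j\<in>?K. fact (p ^ j) ^ Poly_Mapping.lookup m j)"
    if "Poly_Mapping.keys m \<subseteq> ?K" for m
    unfolding fact_prod_def using that by (intro prod.mono_neutral_left) (auto simp: in_keys_iff)
  have "Poly_Mapping.keys (m + m') \<subseteq> ?K" by (rule Poly_Mapping.keys_add)
  from *[OF this] *[of m] *[of m'] show ?thesis by (simp add: lookup_add power_add prod.distrib)
qed

lemma fact_power_dvd_fact: "(fact a :: nat) ^ k dvd fact (k * a)"
proof (induction k)
  case (Suc k)
  have "(fact a :: nat) * fact a ^ k dvd fact a * fact (k * a)" using Suc by (intro mult_dvd_mono) auto
  also have "\<dots> dvd fact (a + k * a)" by (rule fact_fact_dvd_fact)
  finally show ?case by simp
qed simp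

lemma fact_prod_dvd: "fact_prod p m dvd fact (weight p m)"
proof -
  have "(\<Prod>j\<in>K. fact (p ^ j) ^ l j) dvd (fact (\<Sum>j\<in>K. l j * p ^ j) :: nat)"
    if "finite K" for K and l :: "nat \<Rightarrow> nat"
    using that
  proof (induction K rule: finite_induct)
    case (insert i K)
    have "fact (p ^ i) ^ l i * (\<Prod>j\<in>K. fact (p ^ j) ^ l j) dvd (fact (l i * p ^ i) * fact (\<Sum>j\<in>K. l j * p ^ j) :: nat)"
      using insert by (intro mult_dvd_mono fact_power_dvd_fact) auto
    also have "\<dots> dvd fact (l i * p ^ i + (\<Sum>j\<in>K. l j * p ^ j))" by (rule fact_fact_dvd_fact)
    finally show ?case using insert by simp
  qed simp
  then show ?thesis by (simp add: fact_prod_def weight_def)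
qed

lemma kappa_mult_fact_prod: "kappa p m * fact_prod p m = fact (weight p m)"
  using fact_prod_dvd by (simp add: kappa_def)

text \<open>The binomial is the factor in the divided power law C_w C_w', so m |-> kappa m C_(weight
  m) turns products of monomials into products of matrices.\<close>

lemma kappa_add:
  "kappa p (m + m') = (weight p m + weight p m' choose weight p m') * kappa p m * kappa p m'"
proof -
  let ?w = "weight p m" and ?w' = "weight p m'"
  have "kappa p (m + m') * (fact_prod p m * fact_prod p m') = fact (?w + ?w')"
    using kappa_mult_fact_prod[of p "m + m'"] by (simp add: fact_prod_add weight_add)
  also have "\<dots> = fact ?w' * fact ?w * (?w + ?w' choose ?w')"
    using binomial_fact_lemma[of ?w' "?w + ?w'"] by simp
  also have "\<dots> = ((?w + ?w' choose ?w') * kappa p m * kappa p m') * (fact_prod p m * fact_prod p m')"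
    by (simp only: kappa_mult_fact_prod[symmetric]) (simp add: algebra_simps)
  finally show ?thesis using fact_prod_pos[of p m] fact_prod_pos[of p m'] by simp
qed

lemma kappa_0 [simp]: "kappa p 0 = 1"
  by (simp add: kappa_def fact_prod_def)

lemma kappa_single_1 [simp]: "kappa p (Poly_Mapping.single j (Suc 0)) = 1"
  by (simp add: kappa_def fact_prod_def)

text \<open>One more variable of weight p^j contributes a binomial with lower entry p^j, which
  modulo p is the quotient by p^j.\<close>

lemma of_nat_kappa_add_variable:
  assumes p: "prime p" "CHAR('f::comm_ring_1) = p"
  shows "of_nat (kappa p (m + Poly_Mapping.single j 1)) = (of_nat (weight p m div p ^ j + 1) * of_nat (kappa p m) :: 'f)"
proof -
  have "p ^ j > 0" using p(1) prime_gt_0_nat by simp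
  then have "(weight p m + p ^ j) div p ^ j = weight p m div p ^ j + 1" by simp
  then show ?thesis
    using of_nat_choose_prime_power[OF p, of "weight p m + p ^ j" j]
    by (simp add: kappa_add)
qed

text \<open>Building up \<open>m\<close> one variable at a time, the factor for raising an exponent
  to e is e modulo p, by the digit description, and 0 < e < p throughout. Modulo p,
  \<open>kappa p m\<close> is thus the product of the factorials of the exponents.\<close>

lemma of_nat_kappa_nonzero:
  assumes p: "prime p" "CHAR('f::field) = p" and m: "reduced p m"
  shows "of_nat (kappa p m) \<noteq> (0 :: 'f)"
  using m
proof (induction "weight p m" arbitrary: m rule: less_induct)
  case less
  show ?case
  proof (cases "m = 0")
    case False
    then obtain j where j: "Poly_Mapping.lookup m j > 0" by (metis poly_mapping_eqI lookup_zero gr0I)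
    define m' where "m' = m - Poly_Mapping.single j 1"
    have m: "m = m' + Poly_Mapping.single j 1"
      using j by (intro poly_mapping_eqI) (auto simp: m'_def lookup_add lookup_minus lookup_single when_def)
    have lt: "Poly_Mapping.lookup m' i \<le> Poly_Mapping.lookup m i" for i by (simp add: m lookup_add)
    then have red: "reduced p m'" using less.prems unfolding reduced_def by (meson le_less_trans)
    have "p ^ j > 0" using p(1) prime_gt_0_nat by simp
    then have "weight p m' < weight p m" by (simp add: m weight_add)
    then have IH: "of_nat (kappa p m') \<noteq> (0 :: 'f)" using less.hyps red by blast
    have "of_nat (weight p m' div p ^ j + 1) \<noteq> (0 :: 'f)"
    proof
      assume "of_nat (weight p m' div p ^ j + 1) = (0 :: 'f)"
      then have "p dvd weight p m' div p ^ j + 1" using p(2) by (simp only: of_nat_eq_0_iff_char_dvd)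
      then have "(weight p m' div p ^ j mod p + 1) mod p = 0" by (simp add: mod_Suc_eq)
      then have "(Poly_Mapping.lookup m' j + 1) mod p = 0" by (simp add: reduced_digit[OF red])
      moreover have "Poly_Mapping.lookup m' j + 1 = Poly_Mapping.lookup m j" by (simp add: m lookup_add)
      moreover have "Poly_Mapping.lookup m j < p" using less.prems by (simp add: reduced_def)
      ultimately show False using j by simp
    qed
    then show ?thesis using IH of_nat_kappa_add_variable[OF p, of m' j] by (simp add: m)
  qed simp
qed

text \<open>The factor for raising the exponent from p - 1 to p is p itself.\<close>

lemma of_nat_kappa_pth_power:
  assumes p: "prime p" "CHAR('f::comm_ring_1) = p"
  shows "of_nat (kappa p (Poly_Mapping.single j p)) = (0 :: 'f)"
proof -
  have p0: "p > 0" using p(1) prime_gt_0_nat by simp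
  then have "Poly_Mapping.single j p = Poly_Mapping.single j (p - 1) + Poly_Mapping.single j 1"
    by (simp flip: single_add)
  moreover have "(p - 1) * p ^ j div p ^ j + 1 = p" using p0 by simp
  moreover have "of_nat p = (0 :: 'f)" using p(2) of_nat_CHAR by blast
  ultimately show ?thesis using of_nat_kappa_add_variable[OF p, of "Poly_Mapping.single j (p - 1)" j] by simp
qed

section \<open>Homomorphisms and quotients\<close>

text \<open>The linear extension of \<open>F\<close> from monomials to polynomials. It is
  scalar-valued; the matrix-valued map \<open>phi\<close> below uses it entry by entry.\<close>

definition lin :: "('a \<Rightarrow> 'f) \<Rightarrow> ('a \<Rightarrow>\<^sub>0 'f) \<Rightarrow> 'f::comm_ring_1" where
  "lin F f = (\<Sum>m\<in>Poly_Mapping.keys f. Poly_Mapping.lookup f m * F m)"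

lemma lin_eq_sum:
  assumes "finite K" "Poly_Mapping.keys f \<subseteq> K"
  shows "lin F f = (\<Sum>m\<in>K. Poly_Mapping.lookup f m * F m)"
  unfolding lin_def using assms by (intro sum.mono_neutral_left) (auto simp: in_keys_iff)

lemma lin_add: "lin F (f + g) = lin F f + lin F g"
proof -
  let ?K = "Poly_Mapping.keys f \<union> Poly_Mapping.keys g"
  have "Poly_Mapping.keys (f + g) \<subseteq> ?K" by (rule Poly_Mapping.keys_add)
  then show ?thesis
    using lin_eq_sum[of ?K "f + g" F] lin_eq_sum[of ?K f F] lin_eq_sum[of ?K g F]
    by (simp add: lookup_add sum.distrib algebra_simps)
qed

lemma lin_0 [simp]: "lin F 0 = 0"
  by (simp add: lin_def)

lemma lin_single: "lin F (Poly_Mapping.single m c) = c * F m"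
  by (cases "c = 0") (simp_all add: lin_def)

lemma lin_sum: "lin F (\<Sum>i\<in>I. f i) = (\<Sum>i\<in>I. lin F (f i))"
  by (induction I rule: infinite_finite_induct) (simp_all add: lin_add)

lemma poly_mapping_eq_sum_single:
  "f = (\<Sum>m\<in>Poly_Mapping.keys f. Poly_Mapping.single m (Poly_Mapping.lookup f m))"
proof (rule poly_mapping_eqI)
  fix k
  show "Poly_Mapping.lookup f k
      = Poly_Mapping.lookup (\<Sum>m\<in>Poly_Mapping.keys f. Poly_Mapping.single m (Poly_Mapping.lookup f m)) k"
    by (cases "k \<in> Poly_Mapping.keys f") (simp_all add: lookup_sum lookup_single when_def in_keys_iff)
qed

lemma lin_mult:
  "lin F (f * g) = (\<Sum>m\<in>Poly_Mapping.keys f. \<Sum>m'\<in>Poly_Mapping.keys g.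
     Poly_Mapping.lookup f m * Poly_Mapping.lookup g m' * F (m + m'))"
proof -
  have "f * g = (\<Sum>m\<in>Poly_Mapping.keys f. \<Sum>m'\<in>Poly_Mapping.keys g.
      Poly_Mapping.single (m + m') (Poly_Mapping.lookup f m * Poly_Mapping.lookup g m'))"
    by (subst poly_mapping_eq_sum_single[of f], subst poly_mapping_eq_sum_single[of g])
      (simp add: sum_product mult_single)
  then show ?thesis by (simp add: lin_sum lin_single)
qed

lemma lin_scale: "lin F (Poly_Mapping.single 0 c * f) = c * lin F (f :: 'a::monoid_add \<Rightarrow>\<^sub>0 _)"
proof (cases "c = 0")
  case False
  then have "lin F (Poly_Mapping.single 0 c * f) = (\<Sum>m\<in>Poly_Mapping.keys f. c * Poly_Mapping.lookup f m * F m)"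
    unfolding lin_mult by simp
  then show ?thesis by (simp add: lin_def sum_distrib_left mult.assoc)
qed simp

lemma cring_polynomial_algebra: "cring (polynomial_algebra :: ('f::field, _) module)"
proof (rule cringI)
  show "abelian_group (polynomial_algebra :: ('f, _) module)"
  proof (rule abelian_groupI)
    fix x :: "(nat \<Rightarrow>\<^sub>0 nat) \<Rightarrow>\<^sub>0 'f"
    show "\<exists>y\<in>carrier polynomial_algebra. y \<oplus>\<^bsub>polynomial_algebra\<^esub> x = \<zero>\<^bsub>polynomial_algebra\<^esub>"
      by (intro bexI[of _ "- x"]) (simp_all add: polynomial_algebra_def)
  qed (simp_all add: polynomial_algebra_def algebra_simps)
  show "comm_monoid (polynomial_algebra :: ('f, _) module)"
    by (rule comm_monoidI) (simp_all add: polynomial_algebra_def algebra_simps)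
qed (simp add: polynomial_algebra_def algebra_simps)

lemma polynomial_algebra_simps [simp]:
  "carrier polynomial_algebra = UNIV"
  "f \<otimes>\<^bsub>polynomial_algebra\<^esub> g = f * g"
  "f \<oplus>\<^bsub>polynomial_algebra\<^esub> g = f + g"
  "\<one>\<^bsub>polynomial_algebra\<^esub> = 1"
  "\<zero>\<^bsub>polynomial_algebra\<^esub> = 0"
  "c \<odot>\<^bsub>polynomial_algebra\<^esub> f = Poly_Mapping.single 0 c * f"
  by (simp_all add: polynomial_algebra_def)

section \<open>Quotient algebras and induced homomorphisms\<close>

lemma quotient_algebra_simps:
  "carrier (quotient_algebra A I) = carrier (A Quot I)"
  "U \<otimes>\<^bsub>quotient_algebra A I\<^esub> V = U \<otimes>\<^bsub>A Quot I\<^esub> V"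
  "U \<oplus>\<^bsub>quotient_algebra A I\<^esub> V = U \<oplus>\<^bsub>A Quot I\<^esub> V"
  "\<one>\<^bsub>quotient_algebra A I\<^esub> = \<one>\<^bsub>A Quot I\<^esub>"
  "\<zero>\<^bsub>quotient_algebra A I\<^esub> = \<zero>\<^bsub>A Quot I\<^esub>"
  "c \<odot>\<^bsub>quotient_algebra A I\<^esub> U = (\<Union>u\<in>U. I +>\<^bsub>A\<^esub> (c \<odot>\<^bsub>A\<^esub> u))"
  by (simp_all add: quotient_algebra_def ring.defs)

lemma ring_quotient_algebra:
  assumes "ideal I A"
  shows "ring (quotient_algebra A I)"
proof -
  interpret Q: ring "A Quot I" by (rule ideal.quotient_is_ring[OF assms])
  show ?thesis
  proof (rule ringI)
    show "abelian_group (quotient_algebra A I)"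
    proof (rule abelian_groupI)
      fix U assume "U \<in> carrier (quotient_algebra A I)"
      then show "\<exists>V\<in>carrier (quotient_algebra A I). V \<oplus>\<^bsub>quotient_algebra A I\<^esub> U = \<zero>\<^bsub>quotient_algebra A I\<^esub>"
        by (intro bexI[of _ "\<ominus>\<^bsub>A Quot I\<^esub> U"]) (simp_all add: quotient_algebra_simps Q.l_neg)
    qed (simp_all add: quotient_algebra_simps Q.a_ac)
    show "Group.monoid (quotient_algebra A I)"
      by (rule monoidI) (simp_all add: quotient_algebra_simps Q.m_assoc)
  qed (simp_all add: quotient_algebra_simps Q.l_distr Q.r_distr)
qed

lemma ring_hom_quotient_algebra_iff:
  "\<phi> \<in> ring_hom (quotient_algebra A I) S \<longleftrightarrow> \<phi> \<in> ring_hom (A Quot I) S"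
  by (simp add: ring_hom_def quotient_algebra_simps)

lemma ring_iso_quotient_algebra_iff:
  "\<phi> \<in> ring_iso (quotient_algebra A I) S \<longleftrightarrow> \<phi> \<in> ring_iso (A Quot I) S"
  by (simp add: ring_iso_def ring_hom_quotient_algebra_iff quotient_algebra_simps)

lemma Quot_cosetE:
  assumes "ideal I R" "U \<in> carrier (R Quot I)"
  obtains f where "f \<in> carrier R" "U = I +>\<^bsub>R\<^esub> f"
  using assms(2) that by (auto simp: FactRing_simps)

lemma Quot_cosetI: "ideal I R \<Longrightarrow> f \<in> carrier R \<Longrightarrow> I +>\<^bsub>R\<^esub> f \<in> carrier (R Quot I)"
  by (auto simp: FactRing_simps)

lemma a_r_coset_mem_iff: "u \<in> I +>\<^bsub>R\<^esub> f \<longleftrightarrow> (\<exists>i\<in>I. u = i \<oplus>\<^bsub>R\<^esub> f)"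
  by (simp add: a_r_coset_def')

lemma (in ring_hom_ring) image_coset:
  assumes I: "ideal I R" "I \<subseteq> a_kernel R S h" and f: "f \<in> carrier R"
  shows "h ` (I +> f) = {h f}"
proof -
  interpret I: ideal I R by (rule I(1))
  have "h u = h f" if u: "u \<in> I +> f" for u
  proof -
    obtain i where i: "i \<in> I" "u = i \<oplus> f"
      using u unfolding a_r_coset_mem_iff by (rule bexE)
    have "i \<in> a_kernel R S h" using I(2) i(1) by (rule subsetD)
    then have ic: "i \<in> carrier R" and hi: "h i = \<zero>\<^bsub>S\<^esub>" by (simp_all only: a_kernel_def' mem_Collect_eq)
    have "h (i \<oplus> f) = h i \<oplus>\<^bsub>S\<^esub> h f" by (rule hom_add[OF ic f])
    also have "\<dots> = h f" unfolding hi by (rule S.l_zero[OF hom_closed[OF f]])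
    finally show ?thesis unfolding i(2) .
  qed
  then have "h ` (I +> f) \<subseteq> {h f}" by (intro image_subsetI) simp
  moreover have "h f \<in> h ` (I +> f)" by (rule imageI[OF I.a_rcos_self[OF f]])
  ultimately show ?thesis by (intro equalityI) simp_all
qed

lemma (in ring_hom_ring) induced_ring_hom:
  assumes I: "ideal I R" "I \<subseteq> a_kernel R S h"
  shows "(\<lambda>U. the_elem (h ` U)) \<in> ring_hom (R Quot I) S"
proof (rule ring_hom_memI)
  interpret I: ideal I R by (rule I(1))
  let ?\<psi> = "\<lambda>U. the_elem (h ` U)"
  have \<psi>: "?\<psi> (I +> f) = h f" if "f \<in> carrier R" for f using image_coset[OF I that] by simp
  show "?\<psi> U \<in> carrier S" if U: "U \<in> carrier (R Quot I)" for U
  proof -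
    obtain f where "f \<in> carrier R" "U = I +> f" by (rule Quot_cosetE[OF I(1) U])
    then show ?thesis by (simp add: \<psi>)
  qed
  show "?\<psi> (U \<otimes>\<^bsub>R Quot I\<^esub> V) = ?\<psi> U \<otimes>\<^bsub>S\<^esub> ?\<psi> V"
    if UV: "U \<in> carrier (R Quot I)" "V \<in> carrier (R Quot I)" for U V
  proof -
    obtain f where f: "f \<in> carrier R" "U = I +> f" by (rule Quot_cosetE[OF I(1) UV(1)])
    obtain g where g: "g \<in> carrier R" "V = I +> g" by (rule Quot_cosetE[OF I(1) UV(2)])
    note fg = f g
    have "U \<otimes>\<^bsub>R Quot I\<^esub> V = I +> (f \<otimes> g)" using fg by (simp add: FactRing_def I.rcoset_mult_add)
    then show ?thesis using fg by (simp add: \<psi>)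
  qed
  show "?\<psi> (U \<oplus>\<^bsub>R Quot I\<^esub> V) = ?\<psi> U \<oplus>\<^bsub>S\<^esub> ?\<psi> V"
    if UV: "U \<in> carrier (R Quot I)" "V \<in> carrier (R Quot I)" for U V
  proof -
    obtain f where f: "f \<in> carrier R" "U = I +> f" by (rule Quot_cosetE[OF I(1) UV(1)])
    obtain g where g: "g \<in> carrier R" "V = I +> g" by (rule Quot_cosetE[OF I(1) UV(2)])
    note fg = f g
    have "U \<oplus>\<^bsub>R Quot I\<^esub> V = I +> (f \<oplus> g)" using fg by (simp add: FactRing_def I.a_rcos_sum)
    then show ?thesis using fg by (simp add: \<psi>)
  qed
  show "?\<psi> \<one>\<^bsub>R Quot I\<^esub> = \<one>\<^bsub>S\<^esub>" by (simp add: FactRing_def \<psi>)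
qed

text \<open>The first isomorphism theorem for algebras. Beyond rings, the point is that the union
  defining the scalar multiple of a coset collapses to one coset: representatives have the same
  image under \<psi>, hence so do their multiples. The inverse of the induced map is used, since the
  isomorphism has to start at \<open>B\<close>.\<close>

lemma algebra_isomorphic_quotient_kernel:
  fixes A :: "('f::field, 'a) module" and B :: "('f, 'b) module"
  assumes hom: "ring_hom_ring A B \<psi>" and surj: "\<psi> ` carrier A = carrier B"
    and smult_closed: "\<And>c x. x \<in> carrier A \<Longrightarrow> c \<odot>\<^bsub>A\<^esub> x \<in> carrier A"
    and smult: "\<And>c x. x \<in> carrier A \<Longrightarrow> \<psi> (c \<odot>\<^bsub>A\<^esub> x) = c \<odot>\<^bsub>B\<^esub> \<psi> x"
  shows "algebra_isomorphic B (quotient_algebra A (a_kernel A B \<psi>))"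
proof -
  interpret ring_hom_ring A B \<psi> by (rule hom)
  let ?K = "a_kernel A B \<psi>" and ?\<theta> = "\<lambda>U. the_elem (\<psi> ` U)"
  let ?Q = "quotient_algebra A (a_kernel A B \<psi>)"
  have K: "ideal ?K A" by (rule kernel_is_ideal)
  interpret K: ideal ?K A by (rule K)
  have ker_img: "\<psi> ` (?K +>\<^bsub>A\<^esub> f) = {\<psi> f}" if "f \<in> carrier A" for f
    using image_coset[OF K subset_refl that] .
  have iso: "?\<theta> \<in> ring_iso ?Q B"
    unfolding ring_iso_quotient_algebra_iff by (rule FactRing_iso_set[OF surj])
  have bij: "bij_betw ?\<theta> (carrier ?Q) (carrier B)" using iso unfolding ring_iso_def mem_Collect_eq by (rule conjunct2)
  have eq_coset: "?K +>\<^bsub>A\<^esub> u = ?K +>\<^bsub>A\<^esub> v" if "u \<in> carrier A" "v \<in> carrier A" "\<psi> u = \<psi> v" for u v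
  proof -
    let ?w = "u \<oplus>\<^bsub>A\<^esub> \<ominus>\<^bsub>A\<^esub> v"
    have nv: "\<ominus>\<^bsub>A\<^esub> v \<in> carrier A" by (rule R.a_inv_closed[OF that(2)])
    have wc: "?w \<in> carrier A" by (rule R.a_closed[OF that(1) nv])
    have "\<psi> ?w = \<psi> u \<oplus>\<^bsub>B\<^esub> \<ominus>\<^bsub>B\<^esub> \<psi> v" using hom_add[OF that(1) nv] hom_a_inv[OF that(2)] by (rule back_subst)
    also have "\<dots> = \<zero>\<^bsub>B\<^esub>" unfolding that(3) by (rule S.r_neg[OF hom_closed[OF that(2)]])
    finally have "?w \<in> ?K" using wc by (simp only: a_kernel_def' mem_Collect_eq)
    moreover have "u = ?w \<oplus>\<^bsub>A\<^esub> v"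
      unfolding R.a_assoc[OF that(1) nv that(2)] R.l_neg[OF that(2)] by (rule R.r_zero[OF that(1), symmetric])
    ultimately have "u \<in> ?K +>\<^bsub>A\<^esub> v" unfolding a_r_coset_mem_iff by (intro bexI[of _ ?w])
    then show ?thesis using K.a_repr_independence'[OF _ that(2)] by simp
  qed
  have lin: "c \<odot>\<^bsub>?Q\<^esub> U \<in> carrier ?Q" "?\<theta> (c \<odot>\<^bsub>?Q\<^esub> U) = c \<odot>\<^bsub>B\<^esub> ?\<theta> U" if U: "U \<in> carrier ?Q" for c U
  proof -
    obtain f where f: "f \<in> carrier A" "U = ?K +>\<^bsub>A\<^esub> f"
      using U unfolding quotient_algebra_simps by (rule Quot_cosetE[OF K])
    have "?K +>\<^bsub>A\<^esub> (c \<odot>\<^bsub>A\<^esub> u) = ?K +>\<^bsub>A\<^esub> (c \<odot>\<^bsub>A\<^esub> f)" if u: "u \<in> U" for u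
    proof -
      have uc: "u \<in> carrier A" using K.a_elemrcos_carrier[OF f(1)] u f(2) by simp
      have "\<psi> u = \<psi> f" using ker_img[OF f(1)] imageI[OF u, of \<psi>] f(2) by simp
      then show ?thesis
        by (intro eq_coset smult_closed uc f(1)) (simp only: smult[OF uc] smult[OF f(1)])
    qed
    moreover have "f \<in> U" unfolding f(2) by (rule K.a_rcos_self[OF f(1)])
    ultimately have cU: "c \<odot>\<^bsub>?Q\<^esub> U = ?K +>\<^bsub>A\<^esub> (c \<odot>\<^bsub>A\<^esub> f)"
      unfolding quotient_algebra_simps by (intro UN_constant_eq ballI)
    show "c \<odot>\<^bsub>?Q\<^esub> U \<in> carrier ?Q"
      unfolding cU unfolding quotient_algebra_simps by (intro Quot_cosetI[OF K] smult_closed f(1))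
    show "?\<theta> (c \<odot>\<^bsub>?Q\<^esub> U) = c \<odot>\<^bsub>B\<^esub> ?\<theta> U"
      unfolding cU unfolding f(2) ker_img[OF f(1)] ker_img[OF smult_closed[OF f(1)]] the_elem_eq
      by (rule smult[OF f(1)])
  qed
  let ?inv = "inv_into (carrier ?Q) ?\<theta>"
  have "?inv \<in> ring_iso B ?Q" using ring_iso_set_sym[OF ring_quotient_algebra[OF K] iso] .
  moreover have "?inv (c \<odot>\<^bsub>B\<^esub> x) = c \<odot>\<^bsub>?Q\<^esub> ?inv x" if x: "x \<in> carrier B" for c x
  proof -
    have img: "x \<in> ?\<theta> ` carrier ?Q" using x unfolding bij_betw_imp_surj_on[OF bij] .
    have ix: "?inv x \<in> carrier ?Q" "?\<theta> (?inv x) = x"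
      by (rule inv_into_into[OF img], rule f_inv_into_f[OF img])
    have "?inv (?\<theta> (c \<odot>\<^bsub>?Q\<^esub> ?inv x)) = c \<odot>\<^bsub>?Q\<^esub> ?inv x"
      by (rule inv_into_f_f[OF bij_betw_imp_inj_on[OF bij] lin(1)[OF ix(1)]])
    then show ?thesis unfolding lin(2)[OF ix(1)] ix(2) .
  qed
  ultimately show ?thesis unfolding algebra_isomorphic_def by (intro bexI[of _ ?inv] allI ballI)
qed

section \<open>Divided power bases\<close>

lemma variable_power: "variable j ^ k = (Poly_Mapping.single (Poly_Mapping.single j k) 1 :: (nat \<Rightarrow>\<^sub>0 nat) \<Rightarrow>\<^sub>0 'f::field)"
  by (induction k) (simp_all add: variable_def monomial_def mult_single flip: single_add)

lemma nonreduced_split: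
  assumes "\<not> reduced p m"
  obtains m' j where "m = m' + Poly_Mapping.single j p"
proof -
  obtain j where j: "p \<le> Poly_Mapping.lookup m j" using assms by (auto simp: reduced_def not_less)
  have "m = (m - Poly_Mapping.single j p) + Poly_Mapping.single j p"
    using j by (intro poly_mapping_eqI) (auto simp: lookup_add lookup_minus lookup_single when_def)
  then show ?thesis by (rule that)
qed

text \<open>Separates the algebra from the geometry: \<open>C\<close> is a basis of an adjacency
  algebra that multiplies like divided powers truncated above degree \<open>d\<close>. The instance
  is \<open>cmat\<close>.\<close>

locale divided_power_basis =
  fixes Xs :: "'x set" and Rel :: "nat \<Rightarrow> ('x \<times> 'x) set" and d p :: nat
    and C :: "nat \<Rightarrow> 'x \<Rightarrow> 'x \<Rightarrow> 'f::field"
  assumes prime_p: "prime p" and char_p: "CHAR('f) = p"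
    and ring_A: "ring (adjacency_algebra Xs Rel d :: ('f, _) module)"
    and C_mult: "(\<Sum>z\<in>Xs. C i x z * C j z y) = of_nat (i + j choose j) * C (i + j) x y"
    and C_0: "C 0 = \<one>\<^bsub>adjacency_algebra Xs Rel d\<^esub>"
    and C_gt: "n > d \<Longrightarrow> C n = (\<lambda>x y. 0)"
    and C_mem: "(\<lambda>x y. \<Sum>i\<le>d. a i * C i x y) \<in> carrier (adjacency_algebra Xs Rel d)"
    and C_span: "M \<in> carrier (adjacency_algebra Xs Rel d :: ('f, _) module) \<Longrightarrow>
      \<exists>a. M = (\<lambda>x y. \<Sum>i\<le>d. a i * C i x y)"
    and C_indep: "(\<lambda>x y. \<Sum>i\<le>d. a i * C i x y) = (\<lambda>x y. 0) \<Longrightarrow> i \<le> d \<Longrightarrow> a i = 0"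
begin

abbreviation A :: "('f, 'x \<Rightarrow> 'x \<Rightarrow> 'f) module" where "A \<equiv> adjacency_algebra Xs Rel d"
abbreviation P :: "('f, (nat \<Rightarrow>\<^sub>0 nat) \<Rightarrow>\<^sub>0 'f) module" where "P \<equiv> polynomial_algebra"
abbreviation I :: "((nat \<Rightarrow>\<^sub>0 nat) \<Rightarrow>\<^sub>0 'f) set" where "I \<equiv> pth_power_ideal p"
abbreviation T :: "('f, ((nat \<Rightarrow>\<^sub>0 nat) \<Rightarrow>\<^sub>0 'f) set) module" where "T \<equiv> truncated_algebra p"

section \<open>The map from polynomials to matrices\<close>

lemma A_simps:
  "M \<otimes>\<^bsub>A\<^esub> N = (\<lambda>x y. \<Sum>z\<in>Xs. M x z * N z y)"
  "M \<oplus>\<^bsub>A\<^esub> N = (\<lambda>x y. M x y + N x y)"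
  "\<zero>\<^bsub>A\<^esub> = (\<lambda>x y. 0)"
  "c \<odot>\<^bsub>A\<^esub> M = (\<lambda>x y. c * M x y)"
  by (simp_all add: adjacency_algebra_def)

text \<open>The image of the monomial \<open>m\<close> under the algebra homomorphism that sends the
  variable of index j to C_(p^j); in particular variables of weight above \<open>d\<close> go to
  0.\<close>

definition coef :: "(nat \<Rightarrow>\<^sub>0 nat) \<Rightarrow> 'x \<Rightarrow> 'x \<Rightarrow> 'f" where
  "coef m x y = of_nat (kappa p m) * C (weight p m) x y"

definition phi :: "((nat \<Rightarrow>\<^sub>0 nat) \<Rightarrow>\<^sub>0 'f) \<Rightarrow> 'x \<Rightarrow> 'x \<Rightarrow> 'f" where
  "phi f x y = lin (\<lambda>m. coef m x y) f"

lemma coef_mult: "(\<Sum>z\<in>Xs. coef m x z * coef m' z y) = coef (m + m') x y"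
proof -
  have "(\<Sum>z\<in>Xs. coef m x z * coef m' z y)
      = of_nat (kappa p m) * of_nat (kappa p m') * (\<Sum>z\<in>Xs. C (weight p m) x z * C (weight p m') z y)"
    by (simp add: coef_def sum_distrib_left mult_ac)
  then show ?thesis by (simp add: C_mult coef_def kappa_add weight_add mult_ac)
qed

lemma phi_mult: "phi (f * g) x y = (\<Sum>z\<in>Xs. phi f x z * phi g z y)"
proof -
  let ?f = "Poly_Mapping.lookup f" and ?g = "Poly_Mapping.lookup g"
  have "(\<Sum>z\<in>Xs. phi f x z * phi g z y)
      = (\<Sum>z\<in>Xs. \<Sum>m\<in>Poly_Mapping.keys f. \<Sum>m'\<in>Poly_Mapping.keys g. ?f m * ?g m' * (coef m x z * coef m' z y))"
    by (simp add: phi_def lin_def sum_product mult_ac)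
  also have "\<dots> = (\<Sum>m\<in>Poly_Mapping.keys f. \<Sum>z\<in>Xs. \<Sum>m'\<in>Poly_Mapping.keys g. ?f m * ?g m' * (coef m x z * coef m' z y))"
    by (rule sum.swap)
  also have "\<dots> = (\<Sum>m\<in>Poly_Mapping.keys f. \<Sum>m'\<in>Poly_Mapping.keys g. \<Sum>z\<in>Xs. ?f m * ?g m' * (coef m x z * coef m' z y))"
    by (intro sum.cong refl sum.swap)
  also have "\<dots> = (\<Sum>m\<in>Poly_Mapping.keys f. \<Sum>m'\<in>Poly_Mapping.keys g. ?f m * ?g m' * coef (m + m') x y)"
    by (simp add: coef_mult flip: sum_distrib_left)
  finally show ?thesis by (simp add: phi_def lin_mult)
qed

text \<open>The coordinates of \<open>phi f\<close> in the basis C_0, ..., C_d, obtained by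
  collecting monomials of equal weight; weights above \<open>d\<close> disappear with
  \<open>C_gt\<close>.\<close>

lemma phi_eq_sum:
  "phi f x y = (\<Sum>i\<le>d. (\<Sum>m\<in>{m \<in> Poly_Mapping.keys f. weight p m = i}. Poly_Mapping.lookup f m * of_nat (kappa p m)) * C i x y)"
proof -
  let ?t = "\<lambda>m. Poly_Mapping.lookup f m * coef m x y"
  let ?K = "{m \<in> Poly_Mapping.keys f. weight p m \<le> d}"
  have 0: "coef m x y = 0" if "\<not> weight p m \<le> d" for m
    using C_gt[of "weight p m"] that by (simp add: coef_def)
  have "phi f x y = (\<Sum>m\<in>?K. ?t m)"
    unfolding phi_def lin_def by (intro sum.mono_neutral_right) (auto simp: 0)
  also have "\<dots> = (\<Sum>i\<le>d. \<Sum>m\<in>{m \<in> ?K. weight p m = i}. ?t m)"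
    by (rule sum.group[symmetric]) auto
  also have "\<dots> = (\<Sum>i\<le>d. (\<Sum>m\<in>{m \<in> Poly_Mapping.keys f. weight p m = i}. Poly_Mapping.lookup f m * of_nat (kappa p m)) * C i x y)"
  proof (intro sum.cong refl)
    fix i assume "i \<in> {..d}"
    then have "{m \<in> ?K. weight p m = i} = {m \<in> Poly_Mapping.keys f. weight p m = i}" by auto
    then show "(\<Sum>m\<in>{m \<in> ?K. weight p m = i}. ?t m)
        = (\<Sum>m\<in>{m \<in> Poly_Mapping.keys f. weight p m = i}. Poly_Mapping.lookup f m * of_nat (kappa p m)) * C i x y"
      unfolding sum_distrib_right by (intro sum.cong) (auto simp: coef_def mult_ac)
  qed
  finally show ?thesis .
qed

lemma phi_mem: "phi f \<in> carrier A"
proof -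
  have "phi f = (\<lambda>x y. \<Sum>i\<le>d. (\<Sum>m\<in>{m \<in> Poly_Mapping.keys f. weight p m = i}. Poly_Mapping.lookup f m * of_nat (kappa p m)) * C i x y)"
    by (intro ext phi_eq_sum)
  then show ?thesis by (simp only: C_mem)
qed

lemma phi_ring_hom: "ring_hom_ring P A phi"
proof (rule ring_hom_ringI)
  show "ring P" by (rule cring.axioms(1)[OF cring_polynomial_algebra])
  have "phi 1 = phi (Poly_Mapping.single 0 1)" by simp
  also have "\<dots> = C 0" unfolding phi_def lin_single by (simp add: coef_def fun_eq_iff)
  finally show "phi \<one>\<^bsub>P\<^esub> = \<one>\<^bsub>A\<^esub>" by (simp only: polynomial_algebra_simps C_0)
qed (simp_all only: ring_A phi_mem A_simps polynomial_algebra_simps, simp_all add: fun_eq_iff phi_mult, simp_all add: phi_def lin_add)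

lemma phi_smult: "phi (c \<odot>\<^bsub>P\<^esub> f) = c \<odot>\<^bsub>A\<^esub> phi f"
  by (simp add: phi_def lin_scale A_simps fun_eq_iff)

lemma p_gt_1: "p > 1" using prime_p prime_gt_1_nat by simp

lemma phi_surj: "phi ` UNIV = carrier A"
proof (intro equalityI subsetI)
  fix M assume "M \<in> carrier A"
  then obtain a where a: "M = (\<lambda>x y. \<Sum>i\<le>d. a i * C i x y)" using C_span by meson
  have "\<exists>m. reduced p m \<and> weight p m = i" for i using exists_reduced_weight[OF p_gt_1, of i] by metis
  then obtain \<mu> where \<mu>: "\<And>i. reduced p (\<mu> i)" "\<And>i. weight p (\<mu> i) = i" by metis
  \<comment> \<open>One reduced monomial for each weight; its \<open>kappa\<close> is invertible in
    F and is divided out.\<close>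
  define f where "f = (\<Sum>i\<le>d. Poly_Mapping.single (\<mu> i) (a i / of_nat (kappa p (\<mu> i)) :: 'f))"
  have "of_nat (kappa p (\<mu> i)) \<noteq> (0 :: 'f)" for i using of_nat_kappa_nonzero[OF prime_p char_p \<mu>(1)] .
  then have "phi f = M"
    by (simp add: fun_eq_iff a f_def phi_def lin_sum lin_single coef_def \<mu>(2))
  then show "M \<in> phi ` UNIV" by (rule range_eqI[OF sym])
qed (use phi_mem in auto)

lemma kappa_nonreduced:
  assumes "\<not> reduced p m"
  shows "of_nat (kappa p m) = (0 :: 'f)"
  using nonreduced_split[OF assms] of_nat_kappa_pth_power[OF prime_p char_p]
  by (metis kappa_add mult_zero_right of_nat_mult)

text \<open>Among the monomials of weight \<open>weight p m\<close>, only \<open>m\<close> is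
  reduced and the others have \<open>kappa\<close> zero in F. So the coordinate of
  \<open>phi f\<close> at that weight is the coefficient of \<open>m\<close> times a unit.\<close>

lemma phi_eq_0D:
  assumes f: "phi f = (\<lambda>x y. 0)" and m: "reduced p m" "weight p m \<le> d"
  shows "Poly_Mapping.lookup f m = 0"
proof -
  let ?c = "\<lambda>i. \<Sum>m\<in>{m \<in> Poly_Mapping.keys f. weight p m = i}. Poly_Mapping.lookup f m * of_nat (kappa p m) :: 'f"
  have "(\<lambda>x y. \<Sum>i\<le>d. ?c i * C i x y) = (\<lambda>x y. 0)"
    unfolding f[symmetric] by (intro ext phi_eq_sum[symmetric])
  from C_indep[OF this m(2)] have "?c (weight p m) = 0" .
  also have "?c (weight p m) = (\<Sum>m'\<in>{m' \<in> Poly_Mapping.keys f. weight p m' = weight p m}.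
      if m' = m then Poly_Mapping.lookup f m * of_nat (kappa p m) else 0)"
  proof (intro sum.cong refl)
    fix m' assume m': "m' \<in> {m' \<in> Poly_Mapping.keys f. weight p m' = weight p m}"
    show "Poly_Mapping.lookup f m' * of_nat (kappa p m') = (if m' = m then Poly_Mapping.lookup f m * of_nat (kappa p m) else 0)"
    proof (cases "m' = m")
      case False
      then have "\<not> reduced p m'" using reduced_weight_inj[OF _ m(1)] m' by auto
      then show ?thesis using False kappa_nonreduced by simp
    qed simp
  qed
  also have "\<dots> = Poly_Mapping.lookup f m * of_nat (kappa p m)"
    by (cases "m \<in> Poly_Mapping.keys f") (simp_all add: in_keys_iff)
  finally show ?thesis using of_nat_kappa_nonzero[OF prime_p char_p m(1)] by simp
qed

section \<open>Passage to the truncated algebra and its weight ideal\<close>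

lemma ideal_I: "ideal I P"
  unfolding pth_power_ideal_def
  by (rule ring.genideal_ideal[OF cring.axioms(1)[OF cring_polynomial_algebra]]) simp

lemma I_subset_kernel: "I \<subseteq> a_kernel P A phi"
  unfolding pth_power_ideal_def
proof (rule ring.genideal_minimal[OF cring.axioms(1)[OF cring_polynomial_algebra]])
  show "ideal (a_kernel P A phi) P" by (rule ring_hom_ring.kernel_is_ideal[OF phi_ring_hom])
  show "{variable j ^ p |j. True} \<subseteq> a_kernel P A phi"
  proof
    fix f :: "(nat \<Rightarrow>\<^sub>0 nat) \<Rightarrow>\<^sub>0 'f" assume "f \<in> {variable j ^ p |j. True}"
    then obtain j where "f = Poly_Mapping.single (Poly_Mapping.single j p) 1" by (auto simp: variable_power)
    then have "phi f = (\<lambda>x y. 0)"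
      using of_nat_kappa_pth_power[OF prime_p char_p] by (simp add: phi_def lin_single coef_def fun_eq_iff)
    then show "f \<in> a_kernel P A phi" by (simp add: a_kernel_def' A_simps)
  qed
qed

lemma nonreduced_mem_I:
  assumes "\<not> reduced p m"
  shows "Poly_Mapping.single m c \<in> I"
proof -
  obtain m' j where m: "m = m' + Poly_Mapping.single j p" by (rule nonreduced_split[OF assms])
  have "{variable j ^ p |j. True} \<subseteq> I"
    unfolding pth_power_ideal_def
    by (rule ring.genideal_self[OF cring.axioms(1)[OF cring_polynomial_algebra]]) simp
  then have "variable j ^ p \<in> I" by (rule subsetD) auto
  then have "Poly_Mapping.single m' c \<otimes>\<^bsub>P\<^esub> variable j ^ p \<in> I" by (rule ideal.I_l_closed[OF ideal_I]) simp
  then show ?thesis by (simp add: variable_power mult_single m)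
qed

definition psi :: "((nat \<Rightarrow>\<^sub>0 nat) \<Rightarrow>\<^sub>0 'f) set \<Rightarrow> 'x \<Rightarrow> 'x \<Rightarrow> 'f" where
  "psi U = the_elem (phi ` U)"

lemma psi_coset: "psi (I +>\<^bsub>P\<^esub> f) = phi f"
  using ring_hom_ring.image_coset[OF phi_ring_hom ideal_I I_subset_kernel, of f] by (simp add: psi_def)

lemma ring_T: "ring T"
  unfolding truncated_algebra_def by (rule ring_quotient_algebra[OF ideal_I])

lemma psi_ring_hom: "ring_hom_ring T A psi"
proof (rule ring_hom_ringI2[OF ring_T ring_A])
  show "psi \<in> ring_hom T A"
    unfolding truncated_algebra_def ring_hom_quotient_algebra_iff psi_def[abs_def]
    by (rule ring_hom_ring.induced_ring_hom[OF phi_ring_hom ideal_I I_subset_kernel])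
qed

lemma T_cosetE:
  assumes "U \<in> carrier T"
  obtains f where "U = I +>\<^bsub>P\<^esub> f"
  using assms unfolding truncated_algebra_def quotient_algebra_simps by (rule Quot_cosetE[OF ideal_I])

lemma T_cosetI: "I +>\<^bsub>P\<^esub> f \<in> carrier T"
  unfolding truncated_algebra_def quotient_algebra_simps by (rule Quot_cosetI[OF ideal_I]) simp

lemma coset_add: "I +>\<^bsub>P\<^esub> (f + g) = (I +>\<^bsub>P\<^esub> f) \<oplus>\<^bsub>T\<^esub> (I +>\<^bsub>P\<^esub> g)"
proof -
  interpret ideal I P by (rule ideal_I)
  show ?thesis
    unfolding truncated_algebra_def quotient_algebra_simps using a_rcos_sum[of f g] by (simp add: FactRing_def)
qed

lemma coset_mult: "I +>\<^bsub>P\<^esub> (f * g) = (I +>\<^bsub>P\<^esub> f) \<otimes>\<^bsub>T\<^esub> (I +>\<^bsub>P\<^esub> g)"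
proof -
  interpret ideal I P by (rule ideal_I)
  show ?thesis
    unfolding truncated_algebra_def quotient_algebra_simps using rcoset_mult_add[of f g] by (simp add: FactRing_def)
qed

lemma coset_eq_zero:
  assumes "f \<in> I"
  shows "I +>\<^bsub>P\<^esub> f = \<zero>\<^bsub>T\<^esub>"
proof -
  interpret ideal I P by (rule ideal_I)
  show ?thesis
    unfolding truncated_algebra_def quotient_algebra_simps using a_rcos_const[OF assms] by (simp add: FactRing_def)
qed

lemma T_smult_coset: "c \<odot>\<^bsub>T\<^esub> (I +>\<^bsub>P\<^esub> f) = I +>\<^bsub>P\<^esub> (Poly_Mapping.single 0 c * f)"
proof -
  interpret ideal I P by (rule ideal_I)
  have "I +>\<^bsub>P\<^esub> (Poly_Mapping.single 0 c * u) = I +>\<^bsub>P\<^esub> (Poly_Mapping.single 0 c * f)" if u: "u \<in> I +>\<^bsub>P\<^esub> f" for u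
  proof -
    obtain i where i: "i \<in> I" "u = i + f" using u by (auto simp: a_r_coset_mem_iff)
    have "Poly_Mapping.single 0 c \<otimes>\<^bsub>P\<^esub> i \<in> I" by (rule I_l_closed[OF i(1)]) simp
    then have "Poly_Mapping.single 0 c * u \<in> I +>\<^bsub>P\<^esub> (Poly_Mapping.single 0 c * f)"
      unfolding a_r_coset_mem_iff i(2) by (auto simp: distrib_left intro!: bexI[of _ "Poly_Mapping.single 0 c * i"])
    then show ?thesis using a_repr_independence'[of "Poly_Mapping.single 0 c * u" "Poly_Mapping.single 0 c * f"] by simp
  qed
  moreover have "f \<in> I +>\<^bsub>P\<^esub> f" by (rule a_rcos_self) simp
  ultimately show ?thesis
    unfolding truncated_algebra_def quotient_algebra_simps polynomial_algebra_simps by (intro UN_constant_eq ballI)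
qed

lemma psi_surj: "psi ` carrier T = carrier A"
proof (intro equalityI subsetI)
  fix M assume "M \<in> psi ` carrier T"
  then obtain U where U: "U \<in> carrier T" "M = psi U" by (rule imageE)
  obtain f where "U = I +>\<^bsub>P\<^esub> f" by (rule T_cosetE[OF U(1)])
  then show "M \<in> carrier A" by (simp only: U(2) psi_coset phi_mem)
next
  fix M assume "M \<in> carrier A"
  then obtain f where "M = phi f" unfolding phi_surj[symmetric] by (rule imageE)
  then have "M = psi (I +>\<^bsub>P\<^esub> f)" by (simp only: psi_coset)
  then show "M \<in> psi ` carrier T" by (rule image_eqI[OF _ T_cosetI])
qed

text \<open>For the inclusion of the kernel, a representative is split into its terms: non-reduced
  ones lie in \<open>pth_power_ideal p\<close>, reduced ones of weight at most \<open>d\<close> have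
  coefficient 0, and the remaining ones are multiples of generators.\<close>

lemma weight_ideal_eq_kernel: "weight_ideal p d = a_kernel T A psi"
proof (rule equalityI)
  let ?S = "{I +>\<^bsub>P\<^esub> monomial m |m. weight p m > d}"
  have S: "?S \<subseteq> carrier T" using T_cosetI by auto
  have W: "ideal (weight_ideal p d) T"
    unfolding weight_ideal_def by (rule ring.genideal_ideal[OF ring_T S])
  show "weight_ideal p d \<subseteq> a_kernel T A psi"
    unfolding weight_ideal_def
  proof (rule ring.genideal_minimal[OF ring_T])
    show "ideal (a_kernel T A psi) T" by (rule ring_hom_ring.kernel_is_ideal[OF psi_ring_hom])
    show "?S \<subseteq> a_kernel T A psi"
    proof
      fix U assume "U \<in> ?S"
      then obtain m where m: "U = I +>\<^bsub>P\<^esub> monomial m" "weight p m > d" by auto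
      have "psi U = (\<lambda>x y. 0)"
        unfolding m(1) psi_coset using m(2) by (simp add: phi_def monomial_def lin_single coef_def C_gt fun_eq_iff)
      then show "U \<in> a_kernel T A psi" unfolding a_kernel_def' A_simps m(1) using T_cosetI by simp
    qed
  qed
  have SW: "?S \<subseteq> weight_ideal p d"
    unfolding weight_ideal_def by (rule ring.genideal_self[OF ring_T S])
  have W0: "\<zero>\<^bsub>T\<^esub> \<in> weight_ideal p d" by (rule additive_subgroup.zero_closed[OF ideal.axioms(1)[OF W]])
  show "a_kernel T A psi \<subseteq> weight_ideal p d"
  proof
    fix U assume "U \<in> a_kernel T A psi"
    then have U: "U \<in> carrier T" "psi U = (\<lambda>x y. 0)" unfolding a_kernel_def' A_simps by auto
    obtain f where f: "U = I +>\<^bsub>P\<^esub> f" by (rule T_cosetE[OF U(1)])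
    then have phi_f: "phi f = (\<lambda>x y. 0)" using U(2) by (simp only: psi_coset)
    have single: "I +>\<^bsub>P\<^esub> Poly_Mapping.single m (Poly_Mapping.lookup f m) \<in> weight_ideal p d"
      if m: "m \<in> Poly_Mapping.keys f" for m
    proof (cases "reduced p m")
      case False
      show ?thesis unfolding coset_eq_zero[OF nonreduced_mem_I[OF False]] by (rule W0)
    next
      case True
      then have "weight p m > d" using phi_eq_0D[OF phi_f True] m by (auto simp: in_keys_iff not_less[symmetric])
      then have "I +>\<^bsub>P\<^esub> monomial m \<in> weight_ideal p d" by (intro subsetD[OF SW]) auto
      \<comment> \<open>The coefficient enters as the coset of a constant polynomial, because an
        ideal is closed under multiplication by ring elements.\<close>
      then have "(I +>\<^bsub>P\<^esub> monomial m) \<otimes>\<^bsub>T\<^esub> (I +>\<^bsub>P\<^esub> Poly_Mapping.single 0 (Poly_Mapping.lookup f m)) \<in> weight_ideal p d"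
        by (rule ideal.I_r_closed[OF W _ T_cosetI])
      then show ?thesis by (simp add: monomial_def mult_single flip: coset_mult)
    qed
    have "I +>\<^bsub>P\<^esub> (\<Sum>m\<in>K. Poly_Mapping.single m (Poly_Mapping.lookup f m)) \<in> weight_ideal p d"
      if "finite K" "K \<subseteq> Poly_Mapping.keys f" for K
      using that
    proof (induction K rule: finite_induct)
      case empty
      have "0 \<in> I" using additive_subgroup.zero_closed[OF ideal.axioms(1)[OF ideal_I]] by simp
      from coset_eq_zero[OF this] show ?case using W0 by simp
    next
      case (insert m K)
      have "I +>\<^bsub>P\<^esub> Poly_Mapping.single m (Poly_Mapping.lookup f m) \<in> weight_ideal p d"
        using insert.prems by (intro single) simp
      moreover have "I +>\<^bsub>P\<^esub> (\<Sum>m\<in>K. Poly_Mapping.single m (Poly_Mapping.lookup f m)) \<in> weight_ideal p d"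
        using insert by simp
      ultimately show ?case
        unfolding sum.insert[OF insert.hyps] coset_add by (rule additive_subgroup.a_closed[OF ideal.axioms(1)[OF W]])
    qed
    from this[of "Poly_Mapping.keys f"] show "U \<in> weight_ideal p d"
      unfolding f poly_mapping_eq_sum_single[of f, symmetric] by simp
  qed
qed

theorem isomorphic_truncated_algebra:
  "algebra_isomorphic A (quotient_algebra T (weight_ideal p d))"
  unfolding weight_ideal_eq_kernel
proof (rule algebra_isomorphic_quotient_kernel[OF psi_ring_hom psi_surj])
  fix c U assume U: "U \<in> carrier T"
  obtain f where f: "U = I +>\<^bsub>P\<^esub> f" by (rule T_cosetE[OF U])
  show "c \<odot>\<^bsub>T\<^esub> U \<in> carrier T" unfolding f T_smult_coset by (rule T_cosetI)
  show "psi (c \<odot>\<^bsub>T\<^esub> U) = c \<odot>\<^bsub>A\<^esub> psi U"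
    unfolding f T_smult_coset psi_coset using phi_smult[of c f] by simp
qed

end

theorem theorem1:
  fixes h :: "'k::{field,finite} ^ 'n::finite \<Rightarrow> 'k ^ 'n \<Rightarrow> 'k"
    and p r d :: nat
  assumes "CHAR('f::field) = p" and "odd p"
    and "primepow r" and "odd r" and "\<not> p dvd r"
    and "d \<ge> 1"
    and "CARD('k) = r ^ 2" and "CARD('n) = 2 * d + 1"
    and "hermitian_form r h" and "nondegenerate_form h"
    and "local_algebra
           (dual_polar_algebra h d :: ('f, ('k ^ 'n) set \<Rightarrow> ('k ^ 'n) set \<Rightarrow> 'f) module)"
  shows "algebra_isomorphic
           (dual_polar_algebra h d :: ('f, ('k ^ 'n) set \<Rightarrow> ('k ^ 'n) set \<Rightarrow> 'f) module)
           (quotient_algebra (truncated_algebra p) (weight_ideal p d))"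
proof -
  interpret hermitian_space h r d
    using assms by unfold_locales
  note loc = assms(11)
  \<comment> \<open>An odd characteristic is positive, and a positive characteristic of a field is
    prime.\<close>
  have p: "prime p" using assms(1,2) prime_CHAR_semidom[where ?'a = 'f] odd_pos[of p] by simp
  interpret divided_power_basis "maximal_isotropics h" "dual_polar_rel h d" d p 
    "cmat :: nat \<Rightarrow> _ \<Rightarrow> _ \<Rightarrow> 'f"
  proof (rule divided_power_basis.intro, fold dual_polar_algebra_def)
    show "prime p" "CHAR('f) = p" by (fact p, fact assms(1))
    show "ring (dual_polar_algebra h d :: ('f, _) module)" 
      by (rule cring.axioms(1)[OF cring_dual_polar_algebra[OF loc]])
    show "(\<Sum>z\<in>maximal_isotropics h. cmat i x z * cmat j z y) = (of_nat (i + j choose j) * cmat (i + j) x y :: 'f)" for i j x y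
      using assms(6) by (intro cmat_mult[OF loc]) simp
    show "cmat 0 = \<one>\<^bsub>dual_polar_algebra h d :: ('f, _) module\<^esub>" by (simp add: cmat_def bmat_d_eq_one)
    show "cmat n = (\<lambda>x y. 0 :: 'f)" if "n > d" for n using that by (simp add: cmat_def)
    show "(\<lambda>x y. \<Sum>i\<le>d. a i * cmat i x y) \<in> carrier (dual_polar_algebra h d :: ('f, _) module)" for a
      by (rule sum_cmat_mem)
    show "\<exists>a. M = (\<lambda>x y. \<Sum>i\<le>d. a i * cmat i x y)" if "M \<in> carrier (dual_polar_algebra h d :: ('f, _) module)" for M
      using carrier_eq_sum_cmat[OF that] by metis
    show "a i = 0" if "(\<lambda>x y. \<Sum>i\<le>d. a i * cmat i x y) = (\<lambda>x y. 0 :: 'f)" "i \<le> d" for a i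
      using sum_cmat_eq_0D[OF that] .
  qed
  show ?thesis
    unfolding dual_polar_algebra_def by (rule isomorphic_truncated_algebra)
qed

end
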